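(* Let $R$ be a commutative Noetherian local ring and let $M$ be a finitely generated $R$-module which is Burch, rigid, and torsion-free. (i) If $\mathrm{Ass}(R)=\mathrm{Min}(R)$, then $\mathrm{depth}(R)\le 1$, that is, $R$ is either Artinian or $\mathrm{depth}(R)=1$. (ii) If $M$ has rank, then $M$ is free, and $R$ is either a field or a discrete valuation ring.
   Context: $\mathfrak{m}$ denotes the maximal ideal of $R$; all modules are finitely generated. $\mathrm{Min}(R)$ is the set of minimal primes of $R$. An $R$-module $M$ is torsion-free if every non zero-divisor of $R$ is a non zero-divisor on $M$. $M$ has rank if there is an integer $r\ge 0$ such that $M_{\mathfrak{p}}\cong R_{\mathfrak{p}}^{\oplus r}$ for all $\mathfrak{p}\in \mathrm{Ass}(R)$. $M$ is rigid if $\mathrm{Ext}^1_R(M,M)=0$. $M$ is Burch if it is an $R$-submodule of some (finitely generated) $R$-module $T$ such that $\mathfrak{m}(M:_T\mathfrak{m})\nsubseteq \mathfrak{m}M$, where $(M:_T\mathfrak{m})=\{t\in T : \mathfrak{m}t\subseteq M\}$. *)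

theory Defs
  imports "HOL-Algebra.Algebra" "HOL-Library.Extended_Nat"
begin

section \<open>Rings\<close>

definition local_ring :: "('a, 'k) ring_scheme \<Rightarrow> bool" where
  "local_ring R \<longleftrightarrow> cring R \<and> (\<exists>!I. maximalideal I R)"

definition max_ideal :: "('a, 'k) ring_scheme \<Rightarrow> 'a set" where
  "max_ideal R = (THE I. maximalideal I R)"

definition dvr :: "('a, 'k) ring_scheme \<Rightarrow> bool" where
  "dvr R \<longleftrightarrow> principal_domain R \<and> local_ring R \<and> \<not> field R"

definition artinian_ring :: "('a, 'k) ring_scheme \<Rightarrow> bool" where
  "artinian_ring R \<longleftrightarrow> ring R \<and>
     (\<forall>I :: nat \<Rightarrow> 'a set. (\<forall>n. ideal (I n) R \<and> I (Suc n) \<subseteq> I n) \<longrightarrow> (\<exists>N. \<forall>n\<ge>N. I n = I N))"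

definition Ass :: "('a, 'k) ring_scheme \<Rightarrow> 'a set set" where
  "Ass R = {P. primeideal P R \<and>
     (\<exists>x\<in>carrier R. P = {a \<in> carrier R. a \<otimes>\<^bsub>R\<^esub> x = \<zero>\<^bsub>R\<^esub>})}"

definition MinPrimes :: "('a, 'k) ring_scheme \<Rightarrow> 'a set set" where
  "MinPrimes R = {P. primeideal P R \<and> (\<forall>Q. primeideal Q R \<and> Q \<subseteq> P \<longrightarrow> Q = P)}"

text \<open>The second conjunct says that \<open>x\<^sub>i\<close> is a non zero-divisor on
  \<open>R/(x\<^sub>0,\<dots>,x\<^bsub>i-1\<^esub>)\<close>, the third that \<open>R/(x\<^sub>0,\<dots>,x\<^bsub>n-1\<^esub>)\<close> is non-zero.\<close>

definition regular_sequence :: "('a, 'k) ring_scheme \<Rightarrow> 'a list \<Rightarrow> bool" where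
  "regular_sequence R xs \<longleftrightarrow> set xs \<subseteq> carrier R \<and>
     (\<forall>i<length xs. \<forall>a\<in>carrier R.
        (xs ! i) \<otimes>\<^bsub>R\<^esub> a \<in> Idl\<^bsub>R\<^esub> (set (take i xs)) \<longrightarrow> a \<in> Idl\<^bsub>R\<^esub> (set (take i xs))) \<and>
     Idl\<^bsub>R\<^esub> (set xs) \<noteq> carrier R"

definition ring_depth :: "('a, 'k) ring_scheme \<Rightarrow> enat" where
  "ring_depth R = Sup {enat (length xs) | xs. regular_sequence R xs \<and> set xs \<subseteq> max_ideal R}"

section \<open>Modules\<close>

text \<open>The fields \<open>mult\<close> and \<open>one\<close> of a module record carry no meaning for modules;
  they are left unspecified below where the record has to be built.\<close>

definition module_span :: "('a, 'k) ring_scheme \<Rightarrow> ('a, 'm, 'l) module_scheme \<Rightarrow> 'm set \<Rightarrow> 'm set" where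
  "module_span R M A = \<Inter>{H. submodule H R M \<and> A \<subseteq> H}"

definition fin_gen :: "('a, 'k) ring_scheme \<Rightarrow> ('a, 'm, 'l) module_scheme \<Rightarrow> bool" where
  "fin_gen R M \<longleftrightarrow> (\<exists>A. finite A \<and> A \<subseteq> carrier M \<and> module_span R M A = carrier M)"

definition ideal_smult ::
  "('a, 'k) ring_scheme \<Rightarrow> ('a, 'm, 'l) module_scheme \<Rightarrow> 'a set \<Rightarrow> 'm set \<Rightarrow> 'm set" where
  "ideal_smult R M I N = module_span R M {a \<odot>\<^bsub>M\<^esub> x | a x. a \<in> I \<and> x \<in> N}"

definition mod_hom ::
  "('a, 'k) ring_scheme \<Rightarrow> ('a, 'm, 'l) module_scheme \<Rightarrow> ('a, 'n, 'j) module_scheme \<Rightarrow> ('m \<Rightarrow> 'n) set" where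
  "mod_hom R M N = {f \<in> carrier M \<rightarrow> carrier N.
     (\<forall>x\<in>carrier M. \<forall>y\<in>carrier M. f (x \<oplus>\<^bsub>M\<^esub> y) = f x \<oplus>\<^bsub>N\<^esub> f y) \<and>
     (\<forall>a\<in>carrier R. \<forall>x\<in>carrier M. f (a \<odot>\<^bsub>M\<^esub> x) = a \<odot>\<^bsub>N\<^esub> f x)}"

definition mod_iso ::
  "('a, 'k) ring_scheme \<Rightarrow> ('a, 'm, 'l) module_scheme \<Rightarrow> ('a, 'n, 'j) module_scheme \<Rightarrow> bool" where
  "mod_iso R M N \<longleftrightarrow> (\<exists>f \<in> mod_hom R M N. bij_betw f (carrier M) (carrier N))"

text \<open>\<open>R\<^sup>n\<close>\<close>

definition free_mod :: "('a, 'k) ring_scheme \<Rightarrow> nat \<Rightarrow> ('a, nat \<Rightarrow> 'a) module" where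
  "free_mod R n = \<lparr>carrier = {..<n} \<rightarrow>\<^sub>E carrier R,
     monoid.mult = undefined, one = undefined,
     ring.zero = (\<lambda>i\<in>{..<n}. \<zero>\<^bsub>R\<^esub>),
     ring.add = (\<lambda>x y. \<lambda>i\<in>{..<n}. x i \<oplus>\<^bsub>R\<^esub> y i),
     smult = (\<lambda>a x. \<lambda>i\<in>{..<n}. a \<otimes>\<^bsub>R\<^esub> x i)\<rparr>"

definition is_free :: "('a, 'k) ring_scheme \<Rightarrow> ('a, 'm, 'l) module_scheme \<Rightarrow> bool" where
  "is_free R M \<longleftrightarrow> (\<exists>n. mod_iso R M (free_mod R n))"

definition torsion_free :: "('a, 'k) ring_scheme \<Rightarrow> ('a, 'm, 'l) module_scheme \<Rightarrow> bool" where
  "torsion_free R M \<longleftrightarrow> (\<forall>a\<in>carrier R.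
     (\<forall>b\<in>carrier R. a \<otimes>\<^bsub>R\<^esub> b = \<zero>\<^bsub>R\<^esub> \<longrightarrow> b = \<zero>\<^bsub>R\<^esub>) \<longrightarrow>
     (\<forall>x\<in>carrier M. a \<odot>\<^bsub>M\<^esub> x = \<zero>\<^bsub>M\<^esub> \<longrightarrow> x = \<zero>\<^bsub>M\<^esub>))"

subsection \<open>Localization and rank\<close>

text \<open>\<open>fraction R M S x s\<close> is the fraction \<open>x/s\<close> as an equivalence class of pairs. The operations
  on classes are unions over all representatives; all members of such a union are the same class.\<close>

definition fraction ::
  "('a, 'k) ring_scheme \<Rightarrow> ('a, 'm, 'l) module_scheme \<Rightarrow> 'a set \<Rightarrow> 'm \<Rightarrow> 'a \<Rightarrow> ('m \<times> 'a) set" where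
  "fraction R M S x s = {(y, t). y \<in> carrier M \<and> t \<in> S \<and>
     (\<exists>u\<in>S. u \<odot>\<^bsub>M\<^esub> (t \<odot>\<^bsub>M\<^esub> x) = u \<odot>\<^bsub>M\<^esub> (s \<odot>\<^bsub>M\<^esub> y))}"

definition self_module :: "('a, 'k) ring_scheme \<Rightarrow> ('a, 'a) module" where
  "self_module R = \<lparr>carrier = carrier R, monoid.mult = monoid.mult R, one = \<one>\<^bsub>R\<^esub>,
     ring.zero = \<zero>\<^bsub>R\<^esub>, ring.add = ring.add R,
     smult = monoid.mult R\<rparr>"

definition loc_ring :: "('a, 'k) ring_scheme \<Rightarrow> 'a set \<Rightarrow> ('a \<times> 'a) set ring" where
  "loc_ring R S = \<lparr>carrier = {fraction R (self_module R) S a s | a s. a \<in> carrier R \<and> s \<in> S},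
     monoid.mult = (\<lambda>V W. \<Union>{fraction R (self_module R) S (a \<otimes>\<^bsub>R\<^esub> b) (s \<otimes>\<^bsub>R\<^esub> t) |
       a s b t. (a, s) \<in> V \<and> (b, t) \<in> W}),
     one = fraction R (self_module R) S \<one>\<^bsub>R\<^esub> \<one>\<^bsub>R\<^esub>,
     ring.zero = fraction R (self_module R) S \<zero>\<^bsub>R\<^esub> \<one>\<^bsub>R\<^esub>,
     ring.add = (\<lambda>V W. \<Union>{fraction R (self_module R) S (t \<otimes>\<^bsub>R\<^esub> a \<oplus>\<^bsub>R\<^esub> s \<otimes>\<^bsub>R\<^esub> b) (s \<otimes>\<^bsub>R\<^esub> t) |
       a s b t. (a, s) \<in> V \<and> (b, t) \<in> W})\<rparr>"

definition loc_module ::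
  "('a, 'k) ring_scheme \<Rightarrow> ('a, 'm, 'l) module_scheme \<Rightarrow> 'a set
     \<Rightarrow> (('a \<times> 'a) set, ('m \<times> 'a) set) module" where
  "loc_module R M S = \<lparr>carrier = {fraction R M S x s | x s. x \<in> carrier M \<and> s \<in> S},
     monoid.mult = undefined, one = undefined,
     ring.zero = fraction R M S \<zero>\<^bsub>M\<^esub> \<one>\<^bsub>R\<^esub>,
     ring.add = (\<lambda>V W. \<Union>{fraction R M S (t \<odot>\<^bsub>M\<^esub> x \<oplus>\<^bsub>M\<^esub> s \<odot>\<^bsub>M\<^esub> y) (s \<otimes>\<^bsub>R\<^esub> t) |
       x s y t. (x, s) \<in> V \<and> (y, t) \<in> W}),
     smult = (\<lambda>A V. \<Union>{fraction R M S (a \<odot>\<^bsub>M\<^esub> x) (s \<otimes>\<^bsub>R\<^esub> t) |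
       a s x t. (a, s) \<in> A \<and> (x, t) \<in> V})\<rparr>"

definition has_rank :: "('a, 'k) ring_scheme \<Rightarrow> ('a, 'm, 'l) module_scheme \<Rightarrow> bool" where
  "has_rank R M \<longleftrightarrow> (\<exists>r. \<forall>P\<in>Ass R.
     mod_iso (loc_ring R (carrier R - P)) (loc_module R M (carrier R - P))
       (free_mod (loc_ring R (carrier R - P)) r))"

subsection \<open>Ext and rigidity\<close>

text \<open>\<open>\<dots> \<rightarrow> R\<^bsup>n 2\<^esup> \<rightarrow> R\<^bsup>n 1\<^esup> \<rightarrow> R\<^bsup>n 0\<^esup> \<rightarrow> M \<rightarrow> 0\<close> is exact, with maps
  \<open>d i : R\<^bsup>n (i+1)\<^esup> \<rightarrow> R\<^bsup>n i\<^esup>\<close> and \<open>e : R\<^bsup>n 0\<^esup> \<rightarrow> M\<close>.\<close>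

definition free_resolution ::
  "('a, 'k) ring_scheme \<Rightarrow> ('a, 'm, 'l) module_scheme \<Rightarrow> (nat \<Rightarrow> nat)
     \<Rightarrow> (nat \<Rightarrow> (nat \<Rightarrow> 'a) \<Rightarrow> (nat \<Rightarrow> 'a)) \<Rightarrow> ((nat \<Rightarrow> 'a) \<Rightarrow> 'm) \<Rightarrow> bool" where
  "free_resolution R M n d e \<longleftrightarrow>
     e \<in> mod_hom R (free_mod R (n 0)) M \<and>
     (\<forall>i. d i \<in> mod_hom R (free_mod R (n (Suc i))) (free_mod R (n i))) \<and>
     e ` carrier (free_mod R (n 0)) = carrier M \<and>
     d 0 ` carrier (free_mod R (n 1)) = {x \<in> carrier (free_mod R (n 0)). e x = \<zero>\<^bsub>M\<^esub>} \<and>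
     (\<forall>i. d (Suc i) ` carrier (free_mod R (n (Suc (Suc i)))) =
        {x \<in> carrier (free_mod R (n (Suc i))). d i x = \<zero>\<^bsub>free_mod R (n i)\<^esub>})"

text \<open>Homomorphisms are restricted to the carrier, so that they are equal as HOL functions
  iff they agree on the carrier.\<close>

definition Hom_mod ::
  "('a, 'k) ring_scheme \<Rightarrow> ('a, 'm, 'l) module_scheme \<Rightarrow> ('a, 'n, 'j) module_scheme
     \<Rightarrow> ('a, 'm \<Rightarrow> 'n) module" where
  "Hom_mod R M N = \<lparr>carrier = mod_hom R M N \<inter> extensional (carrier M),
     monoid.mult = undefined, one = undefined,
     ring.zero = (\<lambda>x\<in>carrier M. \<zero>\<^bsub>N\<^esub>),
     ring.add = (\<lambda>f g. \<lambda>x\<in>carrier M. f x \<oplus>\<^bsub>N\<^esub> g x),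
     smult = (\<lambda>a f. \<lambda>x\<in>carrier M. a \<odot>\<^bsub>N\<^esub> f x)\<rparr>"

definition Hom_diff ::
  "('a, 'k) ring_scheme \<Rightarrow> (nat \<Rightarrow> nat) \<Rightarrow> (nat \<Rightarrow> (nat \<Rightarrow> 'a) \<Rightarrow> (nat \<Rightarrow> 'a))
     \<Rightarrow> nat \<Rightarrow> ((nat \<Rightarrow> 'a) \<Rightarrow> 'n) \<Rightarrow> ((nat \<Rightarrow> 'a) \<Rightarrow> 'n)" where
  "Hom_diff R n d i f = compose (carrier (free_mod R (n (Suc i)))) f (d i)"

definition Ext_cocycles ::
  "('a, 'k) ring_scheme \<Rightarrow> ('a, 'n, 'j) module_scheme \<Rightarrow> (nat \<Rightarrow> nat)
     \<Rightarrow> (nat \<Rightarrow> (nat \<Rightarrow> 'a) \<Rightarrow> (nat \<Rightarrow> 'a)) \<Rightarrow> nat \<Rightarrow> ((nat \<Rightarrow> 'a) \<Rightarrow> 'n) set" where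
  "Ext_cocycles R N n d i = {f \<in> carrier (Hom_mod R (free_mod R (n i)) N).
     Hom_diff R n d i f = \<zero>\<^bsub>Hom_mod R (free_mod R (n (Suc i))) N\<^esub>}"

primrec Ext_coboundaries ::
  "('a, 'k) ring_scheme \<Rightarrow> ('a, 'n, 'j) module_scheme \<Rightarrow> (nat \<Rightarrow> nat)
     \<Rightarrow> (nat \<Rightarrow> (nat \<Rightarrow> 'a) \<Rightarrow> (nat \<Rightarrow> 'a)) \<Rightarrow> nat \<Rightarrow> ((nat \<Rightarrow> 'a) \<Rightarrow> 'n) set" where
  "Ext_coboundaries R N n d 0 = {\<zero>\<^bsub>Hom_mod R (free_mod R (n 0)) N\<^esub>}"
| "Ext_coboundaries R N n d (Suc i) = Hom_diff R n d i ` carrier (Hom_mod R (free_mod R (n i)) N)"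

text \<open>The additive group \<open>H\<^sup>i(Hom(F, N))\<close> for the complex \<open>F\<close> with ranks \<open>n\<close> and
  differentials \<open>d\<close>; it is \<open>Ext\<^sup>i(M, N)\<close> when \<open>F\<close> resolves \<open>M\<close>.\<close>

definition Ext_group ::
  "('a, 'k) ring_scheme \<Rightarrow> ('a, 'n, 'j) module_scheme \<Rightarrow> (nat \<Rightarrow> nat)
     \<Rightarrow> (nat \<Rightarrow> (nat \<Rightarrow> 'a) \<Rightarrow> (nat \<Rightarrow> 'a)) \<Rightarrow> nat \<Rightarrow> ((nat \<Rightarrow> 'a) \<Rightarrow> 'n) set monoid" where
  "Ext_group R N n d i =
     ((add_monoid (Hom_mod R (free_mod R (n i)) N))\<lparr>carrier := Ext_cocycles R N n d i\<rparr>)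
       Mod Ext_coboundaries R N n d i"

text \<open>Ext does not depend on the resolution. Over a Noetherian ring every finitely generated
  module has a resolution by finite free modules.\<close>

definition rigid :: "('a, 'k) ring_scheme \<Rightarrow> ('a, 'm, 'l) module_scheme \<Rightarrow> bool" where
  "rigid R M \<longleftrightarrow> (\<exists>n d e. free_resolution R M n d e \<and> trivial_group (Ext_group R M n d 1))"

subsection \<open>Burch modules\<close>

definition module_colon ::
  "('a, 'm, 'l) module_scheme \<Rightarrow> 'm set \<Rightarrow> 'a set \<Rightarrow> 'm set" where
  "module_colon T N I = {t \<in> carrier T. \<forall>a\<in>I. a \<odot>\<^bsub>T\<^esub> t \<in> N}"

text \<open>The overmodule \<open>T\<close> ranges over the modules with elements in the type \<open>'t\<close>; a statement
  about \<open>burch TYPE('t) R M\<close> that is polymorphic in \<open>'t\<close> covers all \<open>T\<close>. Being a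
  submodule of \<open>T\<close> is rendered by an embedding \<open>f\<close> of \<open>M\<close> into \<open>T\<close>.\<close>

definition burch ::
  "'t itself \<Rightarrow> ('a, 'k) ring_scheme \<Rightarrow> ('a, 'm, 'l) module_scheme \<Rightarrow> bool" where
  "burch _ R M \<longleftrightarrow> (\<exists>(T :: ('a, 't) module) f.
     module R T \<and> fin_gen R T \<and> f \<in> mod_hom R M T \<and> inj_on f (carrier M) \<and>
     \<not> ideal_smult R T (max_ideal R) (module_colon T (f ` carrier M) (max_ideal R))
         \<subseteq> ideal_smult R T (max_ideal R) (f ` carrier M))"

end

theory Submission
  imports Defs
begin

text \<open>
  Let \<open>\<mm>\<close> be the maximal ideal. If \<open>M\<close> is Burch in \<open>T\<close>, then multiplication by a suitable \<open>t \<in> T\<close> with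
  \<open>\<mm>t \<subseteq> M\<close> is a homomorphism \<open>\<tau> : \<mm> \<rightarrow> M\<close> with a value outside \<open>\<mm>M\<close> (\<open>burch_hom\<close>). Suppose that
  \<open>\<mm>\<close> contains a regular element. By prime avoidance there is a regular \<open>a \<in> \<mm>\<close> with
  \<open>x = \<tau>(a) \<notin> \<mm>M\<close>. Here \<open>\<mm>x \<subseteq> aM\<close>, because \<open>bx = a\<tau>(b)\<close> for \<open>b \<in> \<mm>\<close>: the class of \<open>x\<close> spans a direct
  summand of \<open>M/aM\<close> isomorphic to the residue field. Rigidity lifts the projection to that summand to an
  endomorphism \<open>h\<close> of \<open>M\<close> with \<open>h(M) \<subseteq> Rx + aM\<close> and \<open>h(x) \<equiv> x\<close> modulo \<open>\<mm>M\<close>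
  (\<open>rigid_extension\<close>, \<open>rigid_burch_endomorphism\<close>).

  Over a complete ring \<open>h\<close> would split off from \<open>M\<close> a summand that is a discrete valuation ring. An integrality
  argument takes the place of completion. If \<open>h\<close> acts on a finitely generated module \<open>V\<close> of homomorphisms from
  or to \<open>M\<close> with \<open>hV \<subseteq> aV\<close>, then \<open>V\<close> is killed by some
  \<open>\<theta> = h\<^sup>K - c\<^sub>1 a h\<^bsup>K-1\<^esup> - \<dots> - c\<^sub>K a\<^sup>K\<close> (\<open>integral_relation\<close>). On the other hand \<open>\<theta>(x) \<equiv> x\<close> modulo \<open>\<mm>M\<close>, so neither
  \<open>\<theta>\<close> nor any of its powers kills \<open>x\<close>.

  For (i), suppose that the depth is at least two. Then \<open>R/aR\<close> has zero socle, so every \<open>f : M \<rightarrow> R\<close>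
  satisfies \<open>f(x) \<in> aR\<close>, and the action of \<open>h\<close> on \<open>V = Hom(M, R)\<close> is divisible by \<open>a\<close>. Hence every functional
  vanishes on \<open>\<theta>(M)\<close>. At an associated prime \<open>P\<close> functionals detect \<open>M \<otimes> \<kappa>(P)\<close>
  (\<open>functional_at_associated_prime\<close>), so \<open>\<theta>(M)\<close> lies in \<open>PM\<close> locally, and as \<open>P\<close> is a minimal prime, \<open>\<theta>\<close> is locally
  nilpotent (\<open>locally_nilpotent\<close>). Since \<open>M\<close> is torsion-free, a power of \<open>\<theta>\<close> kills \<open>x\<close>, a contradiction. If no
  element of \<open>\<mm>\<close> is regular, then \<open>\<mm>\<close> is an associated, hence minimal prime, and \<open>R\<close> is Artinian.

  For (ii), let \<open>\<Omega>\<close> be the kernel of a minimal presentation \<open>R\<^sup>n \<rightarrow> M\<close>. Homomorphisms \<open>\<Omega> \<rightarrow> M\<close> extend to \<open>R\<^sup>n\<close> by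
  rigidity, and \<open>\<Omega> \<subseteq> \<mm>R\<^sup>n\<close>, so the action of \<open>h\<close> on \<open>V = Hom(\<Omega>, M)\<close> is divisible by \<open>a\<close>. As \<open>\<theta>\<close> kills the values of
  the homomorphisms \<open>v \<mapsto> v\<^sub>jx\<close>, all coordinates of relations annihilate \<open>\<theta>(x) \<noteq> 0\<close>, and therefore lie in
  one associated prime (\<open>relations_in_associated_prime\<close>). Then \<open>n\<close> is at most the rank, which makes
  \<open>R\<^sup>n \<rightarrow> M\<close> injective at all associated primes and so injective (\<open>presentation_injective\<close>). Now \<open>x\<close> is a member
  of a basis of \<open>M\<close>, and \<open>\<mm>x \<subseteq> aM\<close> means \<open>\<mm> = aR\<close>. The case that no element of \<open>\<mm>\<close> is regular does not
  occur: \<open>\<mm>\<close> would be the annihilator of some \<open>c\<close>, the module \<open>M\<close> would be free, and \<open>c\<close> would kill a member of a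
  basis (\<open>mm_not_Ass_if_rank\<close>).
\<close>

section \<open>Ideals and prime avoidance\<close>

lemma (in ring) ideal_facts:
  assumes "ideal I R"
  shows ideal_carrier: "x \<in> I \<Longrightarrow> x \<in> carrier R"
    and ideal_zero: "\<zero> \<in> I"
    and ideal_add: "\<lbrakk>x \<in> I; y \<in> I\<rbrakk> \<Longrightarrow> x \<oplus> y \<in> I"
    and ideal_lmult: "\<lbrakk>r \<in> carrier R; x \<in> I\<rbrakk> \<Longrightarrow> r \<otimes> x \<in> I"
    and ideal_rmult: "\<lbrakk>r \<in> carrier R; x \<in> I\<rbrakk> \<Longrightarrow> x \<otimes> r \<in> I"
    and ideal_uminus: "x \<in> I \<Longrightarrow> \<ominus> x \<in> I"
proof -
  interpret ideal I R by fact
  show "x \<in> I \<Longrightarrow> x \<in> carrier R" "\<zero> \<in> I"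
    "\<lbrakk>x \<in> I; y \<in> I\<rbrakk> \<Longrightarrow> x \<oplus> y \<in> I"
    "\<lbrakk>r \<in> carrier R; x \<in> I\<rbrakk> \<Longrightarrow> r \<otimes> x \<in> I"
    "\<lbrakk>r \<in> carrier R; x \<in> I\<rbrakk> \<Longrightarrow> x \<otimes> r \<in> I"
    "x \<in> I \<Longrightarrow> \<ominus> x \<in> I"
    by (auto simp: I_l_closed I_r_closed)
qed

lemma (in ring) ideal_add_cancel:
  assumes "ideal I R" "x \<in> I" "x \<oplus> y \<in> I" "y \<in> carrier R"
  shows "y \<in> I"
proof -
  have x: "x \<in> carrier R" using assms ideal_carrier by auto
  have "\<ominus> x \<oplus> (x \<oplus> y) \<in> I" by (rule ideal_add[OF assms(1) ideal_uminus[OF assms(1,2)] assms(3)])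
  then show ?thesis using x assms(4) by (simp add: r_neg1 r_neg2)
qed

lemma (in cring) cring_idealI:
  assumes "I \<subseteq> carrier R" "\<zero> \<in> I"
    and add: "\<And>x y. \<lbrakk>x \<in> I; y \<in> I\<rbrakk> \<Longrightarrow> x \<oplus> y \<in> I"
    and mult: "\<And>r x. \<lbrakk>r \<in> carrier R; x \<in> I\<rbrakk> \<Longrightarrow> r \<otimes> x \<in> I"
  shows "ideal I R"
proof (rule idealI[OF ring_axioms])
  have neg: "\<ominus> x \<in> I" if "x \<in> I" for x
    using mult[of "\<ominus> \<one>" x] that assms(1) by (auto simp: l_minus)
  show "subgroup I (add_monoid R)"
    using assms(1,2) add neg by (intro subgroup.intro) (auto simp: a_inv_def[symmetric])
  show "x \<otimes> a \<in> I" "a \<otimes> x \<in> I" if "a \<in> I" "x \<in> carrier R" for a x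
    using mult[of x a] that assms(1) m_comm[of a x] by auto
qed

lemma (in cring) ideal_add_principal:
  assumes I: "ideal I R" and z: "z \<in> carrier R"
  shows "ideal {q \<oplus> r \<otimes> z | q r. q \<in> I \<and> r \<in> carrier R} R" (is "ideal ?K R")
    and "I \<subseteq> {q \<oplus> r \<otimes> z | q r. q \<in> I \<and> r \<in> carrier R}"
    and "z \<in> {q \<oplus> r \<otimes> z | q r. q \<in> I \<and> r \<in> carrier R}"
proof -
  note Ic = ideal_carrier[OF I]
  show "I \<subseteq> ?K"
  proof
    fix q assume q: "q \<in> I"
    then have "q = q \<oplus> \<zero> \<otimes> z" using z Ic by simp
    then show "q \<in> ?K" using q zero_closed by blast
  qed
  have "z = \<zero> \<oplus> \<one> \<otimes> z" using z by simp
  then show "z \<in> ?K" using ideal_zero[OF I] one_closed by blast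
  show "ideal ?K R"
  proof (rule cring_idealI)
    show "?K \<subseteq> carrier R" using z Ic by auto
    show "\<zero> \<in> ?K" using \<open>I \<subseteq> ?K\<close> ideal_zero[OF I] by (rule subsetD)
    fix u v assume "u \<in> ?K" "v \<in> ?K"
    then obtain q r q' r' where *: "u = q \<oplus> r \<otimes> z" "v = q' \<oplus> r' \<otimes> z"
      "q \<in> I" "q' \<in> I" "r \<in> carrier R" "r' \<in> carrier R" by auto
    have "u \<oplus> v = (q \<oplus> q') \<oplus> (r \<oplus> r') \<otimes> z"
      using * z Ic by (simp add: l_distr a_ac)
    then show "u \<oplus> v \<in> ?K" using * ideal_add[OF I] by blast
  next
    fix c u assume c: "c \<in> carrier R" and "u \<in> ?K"
    then obtain q r where *: "u = q \<oplus> r \<otimes> z" "q \<in> I" "r \<in> carrier R" by auto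
    then have "c \<otimes> u = c \<otimes> q \<oplus> (c \<otimes> r) \<otimes> z"
      using c z Ic by (simp add: r_distr m_assoc)
    then show "c \<otimes> u \<in> ?K" using * c ideal_lmult[OF I] by blast
  qed
qed

definition annihilator :: "('a, 'k) ring_scheme \<Rightarrow> 'a \<Rightarrow> 'a set" where
  "annihilator R x = {a \<in> carrier R. a \<otimes>\<^bsub>R\<^esub> x = \<zero>\<^bsub>R\<^esub>}"

lemma (in cring) ideal_annihilator: "x \<in> carrier R \<Longrightarrow> ideal (annihilator R x) R"
  by (rule cring_idealI) (auto simp: annihilator_def l_distr m_assoc)

lemma Ass_iff: "P \<in> Ass R \<longleftrightarrow> primeideal P R \<and> (\<exists>x\<in>carrier R. P = annihilator R x)"
  by (simp add: Ass_def annihilator_def)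

lemma (in cring) prime_complement_mult:
  assumes "primeideal P R" "s \<in> carrier R - P" "t \<in> carrier R - P"
  shows "s \<otimes> t \<in> carrier R - P"
  using primeideal.I_prime[OF assms(1), of s t] assms by auto

lemma (in cring) prime_one_notin: "primeideal P R \<Longrightarrow> \<one> \<in> carrier R - P"
  using primeideal.I_notcarr ideal.one_imp_carrier primeideal.axioms(1) by fastforce

text \<open>Multiply elements of the given ideals that lie outside \<open>P\<close>. Below this is also the way in which finitely
many elements of a localization at \<open>P\<close> receive a common denominator.\<close>

lemma (in cring) prime_avoids_finite:
  assumes P: "primeideal P R" and "finite Q"
    and "\<And>q. q \<in> Q \<Longrightarrow> ideal q R" "\<And>q. q \<in> Q \<Longrightarrow> \<not> q \<subseteq> P"
  shows "\<exists>s\<in>carrier R - P. \<forall>q\<in>Q. s \<in> q"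
  using assms(2-4)
proof (induction Q rule: finite_induct)
  case empty
  then show ?case using prime_one_notin[OF P] by auto
next
  case (insert q Q)
  then obtain s where s: "s \<in> carrier R - P" "\<forall>q\<in>Q. s \<in> q" by auto
  obtain t where t: "t \<in> q" "t \<notin> P" using insert.prems(2)[of q] by auto
  have tc: "t \<in> carrier R" using ideal_carrier[OF insert.prems(1)[of q]] t by auto
  have "s \<otimes> t \<in> carrier R - P" using prime_complement_mult[OF P] s t tc by auto
  moreover have "s \<otimes> t \<in> q" using ideal_lmult[OF insert.prems(1)[of q]] s t by auto
  moreover have "s \<otimes> t \<in> q'" if "q' \<in> Q" for q'
    using ideal_rmult[OF insert.prems(1)[of q']] s tc that by auto
  ultimately show ?case by auto
qed

text \<open>By induction on the number of primes. If some avoided ideal lies in one of the primes, it can be dropped; the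
arbitrary ideal \<open>J\<close> is then replaced by that prime. Otherwise an element that avoids all ideals but
one prime \<open>P\<close> is corrected by a product of elements of the other ideals that lies outside \<open>P\<close>.\<close>

lemma (in cring) prime_avoidance:
  assumes "finite PP" "ideal I R"
    and "ideal J R" "\<And>P. P \<in> PP \<Longrightarrow> primeideal P R"
    and "\<not> I \<subseteq> J" "\<And>P. P \<in> PP \<Longrightarrow> \<not> I \<subseteq> P"
  shows "\<exists>a\<in>I. a \<notin> J \<and> a \<notin> \<Union>PP"
  using assms
proof (induction "card PP" arbitrary: PP J)
  case 0
  then show ?case by auto
next
  case (Suc n)
  then obtain P where P: "P \<in> PP" by (metis card.empty nat.simps(3) ex_in_conv)
  define PP' where "PP' = PP - {P}"
  have n: "n = card PP'" and fin: "finite PP'" using Suc.hyps(2) Suc.prems(1) P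
    by (auto simp: PP'_def)
  have Pp: "primeideal P R" using Suc.prems P by auto
  have Pi: "ideal P R" using Pp primeideal.axioms(1) by auto
  note IH = Suc.hyps(1)[OF n fin Suc.prems(2)]
  show ?case
  proof (cases "J \<subseteq> P")
    case True
    have "\<exists>a\<in>I. a \<notin> P \<and> a \<notin> \<Union>PP'"
      by (rule IH) (use Suc.prems P Pi in \<open>auto simp: PP'_def\<close>)
    then show ?thesis using True by (auto simp: PP'_def)
  next
    case JP: False
    show ?thesis
    proof (cases "\<exists>Q\<in>PP'. Q \<subseteq> P")
      case True
      then obtain Q where Q: "Q \<in> PP" "Q \<noteq> P" "Q \<subseteq> P" by (auto simp: PP'_def)
      have "n = card (PP - {Q})" "finite (PP - {Q})" using Suc.hyps(2) Suc.prems(1) Q by auto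
      from Suc.hyps(1)[OF this Suc.prems(2), of J]
      have "\<exists>a\<in>I. a \<notin> J \<and> a \<notin> \<Union>(PP - {Q})" using Suc.prems by auto
      then show ?thesis using Q P by blast
    next
      case False
      obtain a where a: "a \<in> I" "a \<notin> J" "a \<notin> \<Union>PP'"
        using IH[of J] Suc.prems P by (auto simp: PP'_def)
      have "\<exists>s\<in>carrier R - P. \<forall>q\<in>insert I (insert J PP'). s \<in> q"
        by (rule prime_avoids_finite[OF Pp])
          (use Suc.prems(2,3,6) Suc.prems(4)[THEN primeideal.axioms(1)] P False JP fin in \<open>auto simp: PP'_def\<close>)
      then obtain s where s: "s \<in> carrier R" "s \<notin> P" "s \<in> I" "s \<in> J" "\<And>Q. Q \<in> PP' \<Longrightarrow> s \<in> Q" by auto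
      have ac: "a \<in> carrier R" using a Suc.prems ideal_carrier by auto
      have out: "a \<oplus> s \<notin> K" if "ideal K R" "s \<in> K" "a \<notin> K" for K
        using ideal_add_cancel[of K s a] that ac a_comm[of a s] s(1) by auto
      show ?thesis
      proof (cases "a \<in> P")
        case aP: True
        have "a \<oplus> s \<notin> P" using ideal_add_cancel[OF Pi aP _ s(1)] s(2) by auto
        moreover have "a \<oplus> s \<notin> J" using out Suc.prems a s by auto
        moreover have "a \<oplus> s \<notin> Q" if "Q \<in> PP'" for Q
          using out[of Q] Suc.prems(4)[of Q] a s(5)[of Q] that primeideal.axioms(1)
          by (auto simp: PP'_def)
        moreover have "a \<oplus> s \<in> I" using a s Suc.prems ideal_add by auto
        ultimately show ?thesis by (intro bexI[of _ "a \<oplus> s"]) (auto simp: PP'_def)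
      qed (use a in \<open>auto simp: PP'_def\<close>)
    qed
  qed
qed

section \<open>Associated primes and regular elements\<close>

locale noetherian_cring = cring + noetherian_ring

context noetherian_cring
begin

lemma ex_maximal_ideal_with:
  assumes "Q I0" "\<And>I. Q I \<Longrightarrow> ideal I R"
  obtains I where "Q I" "\<And>J. Q J \<Longrightarrow> I \<subseteq> J \<Longrightarrow> J = I"
proof -
  have "\<exists>I\<in>Collect Q. \<forall>J\<in>Collect Q. I \<subseteq> J \<longrightarrow> J = I"
  proof (rule subset_Zorn_nonempty)
    show "Collect Q \<noteq> {}" using assms(1) by auto
    fix C assume C: "C \<noteq> {}" "subset.chain (Collect Q) C"
    have sub: "C \<subseteq> Collect Q" using C(2) unfolding subset.chain_def by (rule conjunct1)
    then have "C \<subseteq> {I. ideal I R}" using assms(2) by auto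
    then have "subset.chain {I. ideal I R} C" using C(2) unfolding subset.chain_def by simp
    then have "\<Union>C \<in> C" by (rule ideal_chain_is_trivial[OF C(1)])
    then show "\<Union>C \<in> Collect Q" by (rule subsetD[OF sub])
  qed
  then obtain I where "I \<in> Collect Q" "\<forall>J\<in>Collect Q. I \<subseteq> J \<longrightarrow> J = I" by (rule bexE)
  then show thesis by (intro that[of I]) simp_all
qed

lemma ex_maximalideal_above:
  assumes "ideal I R" "I \<noteq> carrier R"
  shows "\<exists>J. maximalideal J R \<and> I \<subseteq> J"
proof -
  obtain J where J: "ideal J R \<and> J \<noteq> carrier R \<and> I \<subseteq> J"
    and max: "\<And>K. ideal K R \<and> K \<noteq> carrier R \<and> I \<subseteq> K \<Longrightarrow> J \<subseteq> K \<Longrightarrow> K = J"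
    by (rule ex_maximal_ideal_with[of "\<lambda>J. ideal J R \<and> J \<noteq> carrier R \<and> I \<subseteq> J" I]) (use assms in auto)
  have "maximalideal J R"
  proof (rule maximalidealI)
    show "K = J \<or> K = carrier R" if "ideal K R" "J \<subseteq> K" for K using max[of K] J that by blast
  qed (use J in auto)
  then show ?thesis using J by auto
qed

text \<open>An ideal maximal among those disjoint from the multiplicatively closed set \<open>{s b\<^sup>k | s \<notin> P}\<close> is prime,
is contained in \<open>P\<close>, and does not contain \<open>b\<close>. So for a minimal prime \<open>P\<close> and \<open>b \<in> P\<close> that set
contains \<open>0\<close>.\<close>

lemma minimal_prime_nilpotent:
  assumes P: "P \<in> MinPrimes R" and b: "b \<in> P"
  shows "\<exists>s\<in>carrier R - P. \<exists>k::nat. s \<otimes> b [^] k = \<zero>"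
proof (rule ccontr)
  assume contra: "\<not> ?thesis"
  have Pp: "primeideal P R" and Pmin: "\<And>Q. primeideal Q R \<Longrightarrow> Q \<subseteq> P \<Longrightarrow> Q = P"
    using P by (auto simp: MinPrimes_def)
  have bc: "b \<in> carrier R" using b Pp primeideal.axioms(1) ideal_carrier by blast
  define S where "S = {s \<otimes> b [^] k | s k. s \<in> carrier R - P \<and> (k::nat) \<in> UNIV}"
  have Smult: "x \<otimes> y \<in> S" if "x \<in> S" "y \<in> S" for x y
  proof -
    obtain s k t l where *: "x = s \<otimes> b [^] (k::nat)" "y = t \<otimes> b [^] (l::nat)"
      "s \<in> carrier R - P" "t \<in> carrier R - P" using \<open>x \<in> S\<close> \<open>y \<in> S\<close> by (auto simp: S_def)
    then have "x \<otimes> y = (s \<otimes> t) \<otimes> b [^] (k + l)"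
      using bc by (simp add: nat_pow_mult[symmetric] m_ac)
    then show ?thesis using prime_complement_mult[OF Pp *(3,4)] by (auto simp: S_def)
  qed
  have oneS: "\<one> \<in> S" unfolding S_def using prime_one_notin[OF Pp] bc
    by (auto intro!: exI[of _ \<one>] exI[of _ "0::nat"])
  have "\<zero> \<notin> S" unfolding S_def using contra by force
  then obtain Q where Q: "ideal Q R \<and> Q \<inter> S = {}"
    and max: "\<And>K. ideal K R \<and> K \<inter> S = {} \<Longrightarrow> Q \<subseteq> K \<Longrightarrow> K = Q"
    using ex_maximal_ideal_with[of "\<lambda>Q. ideal Q R \<and> Q \<inter> S = {}" "{\<zero>}"] zeroideal by blast
  note Q = conjunct1[OF Q] conjunct2[OF Q]
  have "primeideal Q R"
  proof (rule primeidealI[OF Q(1) is_cring])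
    show "carrier R \<noteq> Q" using Q oneS by auto
    fix x y assume xy: "x \<in> carrier R" "y \<in> carrier R" "x \<otimes> y \<in> Q"
    have meets: "\<exists>q\<in>Q. \<exists>r\<in>carrier R. q \<oplus> r \<otimes> z \<in> S" if z: "z \<in> carrier R" "z \<notin> Q" for z
    proof -
      let ?K = "{q \<oplus> r \<otimes> z | q r. q \<in> Q \<and> r \<in> carrier R}"
      note K = ideal_add_principal[OF Q(1) z(1)]
      have "?K \<inter> S \<noteq> {}"
      proof
        assume "?K \<inter> S = {}"
        with K(1) have "?K = Q" by (intro max conjI K(2))
        then show False using K(3) z(2) by (simp only:)
      qed
      then show ?thesis by auto
    qed
    show "x \<in> Q \<or> y \<in> Q"
    proof (rule ccontr)
      assume "\<not> (x \<in> Q \<or> y \<in> Q)"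
      then obtain q r q' r' where *: "q \<in> Q" "r \<in> carrier R" "q \<oplus> r \<otimes> x \<in> S"
        "q' \<in> Q" "r' \<in> carrier R" "q' \<oplus> r' \<otimes> y \<in> S" using meets[of x] meets[of y] xy by auto
      have qc: "q \<in> carrier R" "q' \<in> carrier R" using * ideal_carrier[OF Q(1)] by auto
      have "(q \<oplus> r \<otimes> x) \<otimes> (q' \<oplus> r' \<otimes> y) =
          (q \<otimes> (q' \<oplus> r' \<otimes> y) \<oplus> (r \<otimes> x) \<otimes> q') \<oplus> (r \<otimes> r') \<otimes> (x \<otimes> y)"
        using * qc xy by (simp add: l_distr r_distr m_ac a_ac)
      moreover have "q \<otimes> (q' \<oplus> r' \<otimes> y) \<in> Q" using * qc xy by (intro ideal_rmult[OF Q(1)]) auto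
      moreover have "(r \<otimes> x) \<otimes> q' \<in> Q" "(r \<otimes> r') \<otimes> (x \<otimes> y) \<in> Q"
        using * qc xy by (auto intro!: ideal_lmult[OF Q(1)])
      ultimately have "(q \<oplus> r \<otimes> x) \<otimes> (q' \<oplus> r' \<otimes> y) \<in> Q"
        using ideal_add[OF Q(1)] by simp
      moreover
      have "(q \<oplus> r \<otimes> x) \<otimes> (q' \<oplus> r' \<otimes> y) \<in> S" using Smult *(3,6) by auto
      ultimately show False using Q(2) by auto
    qed
  qed
  moreover have "Q \<subseteq> P"
  proof
    fix x assume x: "x \<in> Q"
    then have xc: "x \<in> carrier R" using Q ideal_carrier by auto
    show "x \<in> P"
    proof (rule ccontr)
      assume "x \<notin> P"
      then have "x \<otimes> b [^] (0::nat) \<in> S" using xc by (auto simp: S_def intro!: exI[of _ x] exI[of _ "0::nat"])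
      then show False using Q x xc by auto
    qed
  qed
  ultimately have "b \<in> Q" using Pmin b by auto
  moreover have "\<one> \<otimes> b [^] (1::nat) \<in> S" unfolding S_def using prime_one_notin[OF Pp] by blast
  ultimately show False using Q bc by auto
qed

text \<open>For an ideal \<open>C\<close>, choose \<open>c\<close> outside it with \<open>C : c\<close> as large as possible. If \<open>b\<close> is not in \<open>C : c\<close>,
  then \<open>C : cb\<close> equals \<open>C : c\<close>, and inductively no \<open>cb\<^sup>k\<close> lies in \<open>C\<close>.\<close>

lemma ex_absorbing_elem:
  assumes C: "ideal C R" "\<one> \<notin> C" and B: "B \<subseteq> carrier R"
    and nil: "\<And>b c. \<lbrakk>b \<in> B; c \<in> carrier R\<rbrakk> \<Longrightarrow> \<exists>k::nat. c \<otimes> b [^] k \<in> C"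
  shows "\<exists>c\<in>carrier R. c \<notin> C \<and> (\<forall>b\<in>B. c \<otimes> b \<in> C)"
proof -
  let ?col = "\<lambda>c. {r \<in> carrier R. c \<otimes> r \<in> C}"
  have colI: "ideal (?col c) R" if "c \<in> carrier R" for c
    using ideal.helper_max_prime[OF C(1) is_cring that] .
  obtain I where I: "\<exists>c. c \<in> carrier R \<and> c \<notin> C \<and> I = ?col c"
    and maxI: "\<And>J. \<exists>c. c \<in> carrier R \<and> c \<notin> C \<and> J = ?col c \<Longrightarrow> I \<subseteq> J \<Longrightarrow> J = I"
    by (rule ex_maximal_ideal_with[of "\<lambda>I. \<exists>c. c \<in> carrier R \<and> c \<notin> C \<and> I = ?col c" "?col \<one>"])
      (use colI C(2) in blast)+
  from I obtain c where c: "c \<in> carrier R" "c \<notin> C" and Ic: "I = ?col c" by blast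
  have maxc: "?col d = ?col c" if "d \<in> carrier R" "d \<notin> C" "?col c \<subseteq> ?col d" for d
    using maxI[of "?col d"] that unfolding Ic by blast
  have "c \<otimes> b \<in> C" if b: "b \<in> B" for b
  proof (rule ccontr)
    assume nb: "c \<otimes> b \<notin> C"
    have bc: "b \<in> carrier R" using b B by auto
    have "?col c \<subseteq> ?col (c \<otimes> b)"
    proof
      fix r assume r: "r \<in> ?col c"
      then have "(c \<otimes> r) \<otimes> b \<in> C" using ideal_rmult[OF C(1) bc] by simp
      then show "r \<in> ?col (c \<otimes> b)" using r c bc by (simp add: m_ac)
    qed
    then have eq: "?col (c \<otimes> b) = ?col c" using maxc[OF _ nb] c bc by auto
    have "c \<otimes> b [^] k \<notin> C" for k :: nat
    proof (induction k)
      case 0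
      then show ?case using c by simp
    next
      case (Suc k)
      show ?case
      proof
        assume "c \<otimes> b [^] Suc k \<in> C"
        then have "b [^] k \<in> ?col (c \<otimes> b)" using c bc by (simp add: m_ac)
        then show False using eq Suc by auto
      qed
    qed
    then show False using nil[OF b c(1)] by simp
  qed
  then show ?thesis using c by (intro bexI[of _ c]) simp_all
qed

text \<open>An annihilator that is maximal among the annihilators of non-zero elements is prime. The maximality of
\<open>P\<close> is recorded because it makes the set of these primes finite.\<close>

lemma annihilator_subset_Ass:
  assumes x: "x \<in> carrier R" "x \<noteq> \<zero>"
  shows "\<exists>P\<in>Ass R. annihilator R x \<subseteq> P \<and>
    (\<forall>y\<in>carrier R. y \<noteq> \<zero> \<longrightarrow> P \<subseteq> annihilator R y \<longrightarrow> annihilator R y = P)"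
proof -
  obtain I where I: "\<exists>y. y \<in> carrier R \<and> y \<noteq> \<zero> \<and> I = annihilator R y \<and> annihilator R x \<subseteq> annihilator R y"
    and maxI: "\<And>J. \<exists>y. y \<in> carrier R \<and> y \<noteq> \<zero> \<and> J = annihilator R y \<and> annihilator R x \<subseteq> annihilator R y
      \<Longrightarrow> I \<subseteq> J \<Longrightarrow> J = I"
    by (rule ex_maximal_ideal_with[of "\<lambda>I. \<exists>y. y \<in> carrier R \<and> y \<noteq> \<zero> \<and> I = annihilator R y
        \<and> annihilator R x \<subseteq> annihilator R y" "annihilator R x"])
      (use x ideal_annihilator in blast)+
  from I obtain y where y: "y \<in> carrier R" "y \<noteq> \<zero>" "annihilator R x \<subseteq> annihilator R y"
    and Iy: "I = annihilator R y" by blast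
  have max: "annihilator R z = annihilator R y"
    if "z \<in> carrier R" "z \<noteq> \<zero>" "annihilator R y \<subseteq> annihilator R z" for z
    using maxI[of "annihilator R z"] that y(3) unfolding Iy by blast
  have "primeideal (annihilator R y) R"
  proof (rule primeidealI[OF ideal_annihilator[OF y(1)] is_cring])
    show "carrier R \<noteq> annihilator R y"
    proof
      assume "carrier R = annihilator R y"
      then have "\<one> \<in> annihilator R y" using one_closed by simp
      then show False using y by (simp add: annihilator_def)
    qed
    fix a b assume ab: "a \<in> carrier R" "b \<in> carrier R" "a \<otimes> b \<in> annihilator R y"
    show "a \<in> annihilator R y \<or> b \<in> annihilator R y"
    proof (cases "b \<otimes> y = \<zero>")
      case False
      have "annihilator R y \<subseteq> annihilator R (b \<otimes> y)"
      proof
        fix c assume "c \<in> annihilator R y"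
        then have c: "c \<in> carrier R" "c \<otimes> y = \<zero>" by (auto simp: annihilator_def)
        then have "c \<otimes> (b \<otimes> y) = b \<otimes> (c \<otimes> y)" using y ab by (simp add: m_lcomm)
        then show "c \<in> annihilator R (b \<otimes> y)" using c ab by (simp add: annihilator_def)
      qed
      then have "annihilator R (b \<otimes> y) = annihilator R y" using max[of "b \<otimes> y"] False ab y by auto
      moreover have "a \<in> annihilator R (b \<otimes> y)" using ab y by (auto simp: annihilator_def m_assoc)
      ultimately show ?thesis by auto
    qed (use ab in \<open>auto simp: annihilator_def\<close>)
  qed
  then have "annihilator R y \<in> Ass R" using y(1) unfolding Ass_iff by blast
  then show ?thesis
  proof (intro bexI[of _ "annihilator R y"] conjI ballI impI)
    show "annihilator R x \<subseteq> annihilator R y" by fact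
    show "annihilator R z = annihilator R y"
      if "z \<in> carrier R" "z \<noteq> \<zero>" "annihilator R y \<subseteq> annihilator R z" for z
      using that by (rule max)
  qed
qed

end

context noetherian_cring begin

text \<open>Kaplansky's argument: if infinitely many annihilators of elements \<open>y 0, y 1, \<dots>\<close> were maximal,
  some \<open>y n\<close> would lie in the ideal generated by the earlier ones, and its annihilator,
  containing the intersection of the earlier annihilators, would contain one of them.\<close>

lemma zero_divisors_finite_Ass:
  "\<exists>PP. finite PP \<and> PP \<subseteq> Ass R \<and>
    (\<forall>a\<in>carrier R. \<forall>b\<in>carrier R. a \<otimes> b = \<zero> \<longrightarrow> b \<noteq> \<zero> \<longrightarrow> a \<in> \<Union>PP)"
proof -
  define PP where "PP = {P\<in>Ass R. \<forall>y\<in>carrier R. y \<noteq> \<zero> \<longrightarrow> P \<subseteq> annihilator R y \<longrightarrow> annihilator R y = P}"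
  have fin: "finite PP"
  proof (rule ccontr)
    assume "infinite PP"
    then obtain p :: "nat \<Rightarrow> 'a set" where p: "inj p" "range p \<subseteq> PP"
      using infinite_countable_subset by blast
    have "\<exists>y\<in>carrier R. p n = annihilator R y" for n using p by (auto simp: PP_def Ass_iff)
    then obtain y where y: "\<And>n. y n \<in> carrier R" "\<And>n. p n = annihilator R (y n)" by metis
    have pprime: "primeideal (p n) R" for n using p by (auto simp: PP_def Ass_iff)
    have y0: "y n \<noteq> \<zero>" for n
    proof
      assume "y n = \<zero>"
      then have "annihilator R (y n) = carrier R" by (auto simp: annihilator_def)
      then show False using primeideal.I_notcarr[OF pprime[of n]] y(2)[of n] by metis
    qed
    have idl: "ideal (Idl (y ` {..<n})) R" for n using y(1) by (intro genideal_ideal) auto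
    obtain I where I: "\<exists>n. I = Idl (y ` {..<n})" "\<And>J. \<exists>n. J = Idl (y ` {..<n}) \<Longrightarrow> I \<subseteq> J \<Longrightarrow> J = I"
    proof (rule ex_maximal_ideal_with[of "\<lambda>I. \<exists>n. I = Idl (y ` {..<n})" "Idl (y ` {..<0})"])
      show "\<exists>n. Idl (y ` {..<0}) = Idl (y ` {..<n})" by (rule exI, rule refl)
      show "ideal I R" if "\<exists>n. I = Idl (y ` {..<n})" for I using that idl by (elim exE) simp
    qed blast
    from I(1) obtain N where IN: "I = Idl (y ` {..<N})" by (elim exE)
    have N: "Idl (y ` {..<n}) = Idl (y ` {..<N})" if "Idl (y ` {..<N}) \<subseteq> Idl (y ` {..<n})" for n
      using I(2)[of "Idl (y ` {..<n})"] that unfolding IN by (simp add: exI[of _ n])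
    have "Idl (y ` {..<N}) \<subseteq> Idl (y ` {..<Suc N})"
      by (rule subset_Idl_subset) (use y genideal_self in auto)
    from N[OF this] have "y N \<in> Idl (y ` {..<N})"
      using genideal_self[of "y ` {..<Suc N}"] y by auto
    moreover have "\<exists>s\<in>carrier R - p N. \<forall>q\<in>p ` {..<N}. s \<in> q"
    proof (rule prime_avoids_finite[OF pprime])
      fix q assume "q \<in> p ` {..<N}"
      then obtain k where k: "k < N" "q = p k" by auto
      show "ideal q R" using pprime[of k] k primeideal.axioms(1) by auto
      show "\<not> q \<subseteq> p N"
      proof
        assume "q \<subseteq> p N"
        then have "p k \<subseteq> annihilator R (y N)" using k y by auto
        moreover have "p k \<in> PP" using p by auto
        ultimately have "p N = p k" unfolding PP_def using y0 y by auto
        then show False using p(1) k by (auto dest: injD)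
      qed
    qed auto
    then obtain s where s: "s \<in> carrier R - p N" "\<And>k. k < N \<Longrightarrow> s \<in> p k" by auto
    have "Idl (y ` {..<N}) \<subseteq> annihilator R s"
    proof (rule genideal_minimal)
      show "ideal (annihilator R s) R" using s ideal_annihilator by auto
      show "y ` {..<N} \<subseteq> annihilator R s" using s y m_comm by (auto simp: annihilator_def)
    qed
    ultimately have "y N \<otimes> s = \<zero>" by (auto simp: annihilator_def)
    moreover have "s \<otimes> y N = y N \<otimes> s" using s(1) y(1) by (simp add: m_comm)
    ultimately have "s \<in> annihilator R (y N)" using s(1) by (simp add: annihilator_def)
    then show False using s(1) y(2)[of N] by simp
  qed
  have cover: "a \<in> \<Union>PP" if ab: "a \<in> carrier R" "b \<in> carrier R" "a \<otimes> b = \<zero>" "b \<noteq> \<zero>" for a b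
  proof -
    obtain P where P: "P \<in> PP" "annihilator R b \<subseteq> P"
      using annihilator_subset_Ass[OF ab(2,4)] unfolding PP_def by blast
    have "a \<in> annihilator R b" using ab by (simp add: annihilator_def)
    then show ?thesis using P by blast
  qed
  have sub: "PP \<subseteq> Ass R" by (auto simp: PP_def)
  show ?thesis
  proof (intro exI[of _ PP] conjI ballI impI)
    show "a \<in> \<Union>PP" if "a \<in> carrier R" "b \<in> carrier R" "a \<otimes> b = \<zero>" "b \<noteq> \<zero>" for a b
      by (rule cover[OF that])
  qed (fact fin sub)+
qed

end

definition regular_elem :: "('a, 'k) ring_scheme \<Rightarrow> 'a \<Rightarrow> bool" where
  "regular_elem R a \<longleftrightarrow> a \<in> carrier R \<and> (\<forall>b\<in>carrier R. a \<otimes>\<^bsub>R\<^esub> b = \<zero>\<^bsub>R\<^esub> \<longrightarrow> b = \<zero>\<^bsub>R\<^esub>)"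

context noetherian_cring
begin

lemma ideal_has_regular_elem_outside:
  assumes "ideal I R" "\<And>P. P \<in> Ass R \<Longrightarrow> \<not> I \<subseteq> P" "ideal J R" "\<not> I \<subseteq> J"
  shows "\<exists>a\<in>I. a \<notin> J \<and> regular_elem R a"
proof -
  obtain PP where PP: "finite PP" "PP \<subseteq> Ass R"
    "\<forall>a\<in>carrier R. \<forall>b\<in>carrier R. a \<otimes> b = \<zero> \<longrightarrow> b \<noteq> \<zero> \<longrightarrow> a \<in> \<Union>PP"
    using zero_divisors_finite_Ass by (elim exE conjE)
  have "\<exists>a\<in>I. a \<notin> J \<and> a \<notin> \<Union>PP"
  proof (rule prime_avoidance[OF PP(1) assms(1,3) _ assms(4)])
    fix P assume "P \<in> PP"
    then have P: "P \<in> Ass R" using PP(2) by auto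
    then show "primeideal P R" by (simp add: Ass_iff)
    show "\<not> I \<subseteq> P" by (rule assms(2)[OF P])
  qed
  then obtain a where a: "a \<in> I" "a \<notin> J" "a \<notin> \<Union>PP" by (elim bexE conjE)
  have ac: "a \<in> carrier R" using ideal_carrier[OF assms(1) a(1)] .
  have "b = \<zero>" if "b \<in> carrier R" "a \<otimes> b = \<zero>" for b
    using PP(3) ac a(3) that by metis
  then show ?thesis using a ac by (intro bexI[of _ a]) (simp_all add: regular_elem_def)
qed

lemma ideal_has_regular_elem:
  assumes "ideal I R" "\<And>P. P \<in> Ass R \<Longrightarrow> \<not> I \<subseteq> P"
  shows "\<exists>a\<in>I. regular_elem R a"
proof (cases "\<one> = \<zero>")
  case True
  \<comment> \<open>In the zero ring \<open>0\<close> is regular, while \<open>Ass R\<close> is empty.\<close>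
  then have "x = \<zero>" if "x \<in> carrier R" for x using that l_one[of x] l_null[of x] by auto
  then have "regular_elem R \<zero>" by (auto simp: regular_elem_def)
  then show ?thesis using ideal_zero[OF assms(1)] by auto
next
  case False
  show ?thesis
  proof (cases "I \<subseteq> {\<zero>}")
    case True
    obtain P where P: "P \<in> Ass R" using annihilator_subset_Ass[of \<one>] False by auto
    then have "ideal P R" using primeideal.axioms(1) unfolding Ass_iff by blast
    then have "\<zero> \<in> P" by (rule ideal_zero)
    then show ?thesis using True assms(2)[OF P] by auto
  next
    case False
    then show ?thesis using ideal_has_regular_elem_outside[OF assms zeroideal] by auto
  qed
qed

end

section \<open>Noetherian local rings\<close>

locale noetherian_local = noetherian_cring +
  assumes local: "\<exists>!I. maximalideal I R"
begin

abbreviation \<mm> where "\<mm> \<equiv> max_ideal R"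

lemma mm_maximal: "maximalideal \<mm> R"
  unfolding max_ideal_def using local by (rule theI')

lemma mm_unique: "maximalideal I R \<Longrightarrow> I = \<mm>"
  using local mm_maximal by auto

lemma mm_ideal: "ideal \<mm> R"
  using mm_maximal maximalideal.axioms(1) by auto

lemma mm_prime: "primeideal \<mm> R"
  using maximalideal_prime[OF mm_maximal] .

lemma mm_carrier: "x \<in> \<mm> \<Longrightarrow> x \<in> carrier R"
  using ideal_carrier[OF mm_ideal] .

lemma proper_ideal_subset_mm: "\<lbrakk>ideal I R; I \<noteq> carrier R\<rbrakk> \<Longrightarrow> I \<subseteq> \<mm>"
  using ex_maximalideal_above[of I] mm_unique by auto

lemma one_notin_mm: "\<one> \<notin> \<mm>"
  using prime_one_notin[OF mm_prime] by auto

lemma unit_if_notin_mm: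
  assumes "a \<in> carrier R" "a \<notin> \<mm>"
  shows "\<exists>b\<in>carrier R. b \<otimes> a = \<one>"
proof -
  have "PIdl a = carrier R"
    using proper_ideal_subset_mm[OF cgenideal_ideal[OF assms(1)]] cgenideal_self[OF assms(1)] assms by auto
  then have "\<one> \<in> PIdl a" by auto
  then show ?thesis by (auto simp: cgenideal_def)
qed

lemma one_plus_mm: "x \<in> \<mm> \<Longrightarrow> \<one> \<ominus> x \<notin> \<mm>"
proof
  assume x: "x \<in> \<mm>" "\<one> \<ominus> x \<in> \<mm>"
  then have "(\<one> \<ominus> x) \<oplus> x \<in> \<mm>" using ideal_add[OF mm_ideal] by auto
  then show False using mm_carrier[OF x(1)] one_notin_mm by (simp add: a_minus_def a_assoc l_neg)
qed

lemma mm_Ass_or_regular: "\<mm> \<in> Ass R \<or> (\<forall>P\<in>Ass R. \<not> \<mm> \<subseteq> P)"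
proof -
  have "P = \<mm>" if "P \<in> Ass R" "\<mm> \<subseteq> P" for P
    using that maximalideal.I_maximal[OF mm_maximal, of P] primeideal.I_notcarr[of P R]
      primeideal.axioms(1)[of P R] ideal_carrier[of P] by (auto simp: Ass_iff)
  then show ?thesis by auto
qed

text \<open>The elements of \<open>\<mm>\<close> are nilpotent. Let \<open>A\<close> be an ideal maximal among those above which
some descending chain \<open>I\<close> of ideals fails to stabilise, and let \<open>c \<notin> A\<close> with \<open>c\<mm> \<subseteq> A\<close>, so that
\<open>(A + Rc)/A\<close> is simple. The ideals \<open>I n + (A + Rc)\<close> stabilise because \<open>A + Rc\<close> is larger than \<open>A\<close>, and
whether \<open>c\<close> belongs to \<open>I n\<close> stabilises because the chain descends; together they determine \<open>I n\<close>.\<close>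

lemma artinian_if_mm_minimal:
  assumes "\<mm> \<in> MinPrimes R"
  shows "artinian_ring R"
proof -
  have nilp: "\<exists>k::nat. b [^] k = \<zero>" if b: "b \<in> \<mm>" for b
  proof -
    obtain s k where s: "s \<in> carrier R - \<mm>" "s \<otimes> b [^] (k::nat) = \<zero>"
      using minimal_prime_nilpotent[OF assms b] by auto
    then obtain u where u: "u \<in> carrier R" "u \<otimes> s = \<one>" using unit_if_notin_mm by auto
    have "b [^] k = (u \<otimes> s) \<otimes> b [^] k" using u mm_carrier[OF b] by simp
    also have "\<dots> = u \<otimes> (s \<otimes> b [^] k)" using u(1) s(1) mm_carrier[OF b] by (simp add: m_assoc)
    finally show ?thesis using s(2) u(1) by (intro exI[of _ k]) simp
  qed
  define stable where "stable = (\<lambda>A. \<forall>I :: nat \<Rightarrow> 'a set.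
     (\<forall>n. ideal (I n) R \<and> I (Suc n) \<subseteq> I n \<and> A \<subseteq> I n) \<longrightarrow> (\<exists>N. \<forall>n\<ge>N. I n = I N))"
  have all_stable: "stable A0" if A0: "ideal A0 R" for A0
  proof (rule ccontr)
    assume unst: "\<not> stable A0"
    obtain A where A: "ideal A R \<and> \<not> stable A"
      and maxA': "\<And>B. ideal B R \<and> \<not> stable B \<Longrightarrow> A \<subseteq> B \<Longrightarrow> B = A"
      by (rule ex_maximal_ideal_with[of "\<lambda>A. ideal A R \<and> \<not> stable A" A0]) (use A0 unst in blast)+
    note A = conjunct1[OF A] conjunct2[OF A]
    have maxA: "stable B" if B: "ideal B R" "A \<subseteq> B" "B \<noteq> A" for B
    proof (rule ccontr)
      assume ns: "\<not> stable B"
      have "B = A" by (rule maxA'[OF conjI[OF B(1) ns] B(2)])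
      with B(3) show False by (rule notE)
    qed
    have Ac: "A \<noteq> carrier R"
    proof
      assume carr: "A = carrier R"
      have "stable A" unfolding stable_def
      proof (intro allI impI exI[of _ 0])
        fix I :: "nat \<Rightarrow> 'a set" and n
        assume I: "\<forall>n. ideal (I n) R \<and> I (Suc n) \<subseteq> I n \<and> A \<subseteq> I n"
        then have "I k = carrier R" for k using carr ideal_carrier[of "I k"] by auto
        then show "I n = I 0" by simp
      qed
      then show False using A(2) by simp
    qed
    have oneA: "\<one> \<notin> A" using Ac ideal.one_imp_carrier[OF A(1)] by auto
    have "\<exists>k::nat. c \<otimes> b [^] k \<in> A" if bc: "b \<in> \<mm>" "c \<in> carrier R" for b c
    proof -
      obtain k where "b [^] (k::nat) = \<zero>" using nilp[OF bc(1)] by (elim exE)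
      then show ?thesis using bc(2) ideal_zero[OF A(1)] by (intro exI[of _ k]) simp
    qed
    from ex_absorbing_elem[OF A(1) oneA subsetI[OF mm_carrier] this]
    have "\<exists>c\<in>carrier R. c \<notin> A \<and> (\<forall>b\<in>\<mm>. c \<otimes> b \<in> A)" by simp
    then obtain c where c: "c \<in> carrier R" "c \<notin> A" and mc: "\<forall>b\<in>\<mm>. c \<otimes> b \<in> A"
      by (elim bexE conjE)
    define BB where "BB = {u \<oplus> r \<otimes> c | u r. u \<in> A \<and> r \<in> carrier R}"
    note Acar = ideal_carrier[OF A(1)]
    note BB = ideal_add_principal[OF A(1) c(1), folded BB_def]
    note B = BB(1) and AB = BB(2) and cB = BB(3)
    have "BB \<noteq> A"
    proof
      assume "BB = A"
      with cB c(2) show False by (simp only:)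
    qed
    then have stB: "stable BB" by (rule maxA[OF B AB])
    have "stable A" unfolding stable_def
    proof (intro allI impI)
      fix I :: "nat \<Rightarrow> 'a set"
      assume I: "\<forall>n. ideal (I n) R \<and> I (Suc n) \<subseteq> I n \<and> A \<subseteq> I n"
      have anti: "I n \<subseteq> I k" if "k \<le> n" for k n
        using lift_Suc_antimono_le[of I k n] I that by auto
      have id: "ideal (I n) R" for n using I by auto
      define J where "J n = set_add R (I n) BB" for n
      have Jeq: "J n = {x \<oplus> y | x y. x \<in> I n \<and> y \<in> BB}" for n by (auto simp: J_def set_add_def set_mult_def)
      have "\<exists>N. \<forall>n\<ge>N. J n = J N"
      proof (rule stB[unfolded stable_def, rule_format], intro allI conjI)
        fix n
        show "ideal (J n) R" unfolding J_def by (rule add_ideals[OF id B])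
        show "J (Suc n) \<subseteq> J n" unfolding Jeq using I by blast
        show "BB \<subseteq> J n"
        proof
          fix x assume x: "x \<in> BB"
          then have "x = \<zero> \<oplus> x" using ideal_carrier[OF B] by simp
          then show "x \<in> J n" unfolding Jeq using x ideal_zero[OF id[of n]] by blast
        qed
      qed
      then obtain N1 where N1: "\<And>n. n \<ge> N1 \<Longrightarrow> J n = J N1" by auto
      obtain N2 where N2: "\<And>n. n \<ge> N2 \<Longrightarrow> (c \<in> I n \<longleftrightarrow> c \<in> I N2)"
      proof (cases "\<forall>n. c \<in> I n")
        case True
        then show ?thesis using that[of 0] by auto
      next
        case False
        then obtain k where "c \<notin> I k" by auto
        then show ?thesis using that[of k] anti by blast
      qed
      define N where "N = max N1 N2"
      have "I n = I N" if n: "n \<ge> N" for n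
      proof
        show "I n \<subseteq> I N" using anti n by auto
        show "I N \<subseteq> I n"
        proof
          fix y assume y: "y \<in> I N"
          have yc: "y \<in> carrier R" using ideal_carrier[OF id] y by auto
          have "y = y \<oplus> \<zero>" using yc by auto
          then have "y \<in> J N" unfolding Jeq using y ideal_zero[OF B] by blast
          then have "y \<in> J n" using N1[of n] N1[of N] n by (auto simp: N_def)
          then obtain z u r where zur: "y = z \<oplus> (u \<oplus> r \<otimes> c)" "z \<in> I n" "u \<in> A" "r \<in> carrier R"
            unfolding Jeq BB_def by auto
          have uI: "u \<in> I n" using zur I by auto
          have car: "z \<in> carrier R" "u \<in> carrier R" using zur(2,3) Acar ideal_carrier[OF id] by auto
          have "r \<otimes> c \<in> I n"
          proof (cases "r \<in> \<mm>")
            case True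
            then show ?thesis using bspec[OF mc True] m_comm[OF zur(4) c(1)] I by auto
          next
            case False
            then obtain w where w: "w \<in> carrier R" "w \<otimes> r = \<one>" using unit_if_notin_mm zur by auto
            have "y = (z \<oplus> u) \<oplus> r \<otimes> c" using zur(1,4) car c(1) by (simp add: a_assoc)
            moreover have "z \<oplus> u \<in> I N"
              by (rule ideal_add[OF id]) (use zur(2) uI anti[OF n] in auto)
            ultimately have "r \<otimes> c \<in> I N"
              using ideal_add_cancel[OF id, of "z \<oplus> u" N "r \<otimes> c"] y zur(4) c(1) by simp
            then have "w \<otimes> (r \<otimes> c) \<in> I N" using ideal_lmult[OF id] w by auto
            then have "c \<in> I N" using w zur(4) c by (simp add: m_assoc[symmetric])
            then have "c \<in> I n" using N2[of n] N2[of N] n by (auto simp: N_def)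
            then show ?thesis using ideal_lmult[OF id] zur by auto
          qed
          then show "y \<in> I n" unfolding zur(1) using zur uI ideal_add[OF id] by auto
        qed
      qed
      then show "\<exists>N. \<forall>n\<ge>N. I n = I N" by auto
    qed
    then show False using A by auto
  qed
  from all_stable[OF zeroideal] show ?thesis
    unfolding artinian_ring_def stable_def using ring_axioms ideal_zero by auto
qed

text \<open>Every non-zero element is a unit times a power of \<open>a\<close>: dividing by \<open>a\<close> forever would give a strictly
ascending chain of principal ideals.\<close>

lemma principal_domain_if_mm_principal:
  assumes a: "regular_elem R a" and gen: "\<mm> = PIdl a"
  shows "principal_domain R"
proof -
  have ac: "a \<in> carrier R" and reg: "\<And>b. \<lbrakk>b \<in> carrier R; a \<otimes> b = \<zero>\<rbrakk> \<Longrightarrow> b = \<zero>"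
    using a by (auto simp: regular_elem_def)
  have am: "a \<in> \<mm>" using gen cgenideal_self[OF ac] by auto
  have powreg: "b = \<zero>" if "b \<in> carrier R" "a [^] k \<otimes> b = \<zero>" for b and k :: nat
    using that
  proof (induction k arbitrary: b)
    case (Suc k)
    have "a \<otimes> b = \<zero>" by (rule Suc.IH) (use Suc.prems ac in \<open>simp_all add: m_assoc\<close>)
    then show ?case using reg Suc.prems by auto
  qed auto
  have fac: "\<exists>k u. u \<in> carrier R - \<mm> \<and> y = a [^] (k::nat) \<otimes> u"
    if y: "y \<in> carrier R" "y \<noteq> \<zero>" for y
  proof (rule ccontr)
    assume no: "\<not> ?thesis"
    have div: "\<exists>z\<in>carrier R. y = a [^] k \<otimes> z" for k :: nat
    proof (induction k)
      case 0
      then show ?case using y by auto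
    next
      case (Suc k)
      then obtain z where z: "z \<in> carrier R" "y = a [^] k \<otimes> z" by auto
      then have "z \<in> \<mm>" using no by auto
      then obtain w where "w \<in> carrier R" "z = w \<otimes> a" using gen by (auto simp: cgenideal_def)
      then show ?case using z ac by (intro bexI[of _ w]) (auto simp: m_ac)
    qed
    then obtain z where z: "\<And>k::nat. z k \<in> carrier R" "\<And>k::nat. y = a [^] k \<otimes> z k" by metis
    have za: "z k = a \<otimes> z (Suc k)" for k
    proof -
      have "a [^] k \<otimes> (z k \<ominus> a \<otimes> z (Suc k)) = a [^] k \<otimes> z k \<ominus> a [^] Suc k \<otimes> z (Suc k)"
        using z(1) ac by (simp add: a_minus_def r_distr r_minus m_assoc)
      also have "\<dots> = \<zero>" using z(2)[of k] z(2)[of "Suc k"] y by (simp add: a_minus_def r_neg)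
      finally have "z k \<ominus> a \<otimes> z (Suc k) = \<zero>" using powreg z ac by simp
      then show ?thesis using z(1) ac
        by (simp add: a_minus_def) (metis add.inv_closed m_closed minus_equality minus_minus)
    qed
    obtain I where I: "\<exists>k. I = PIdl (z k)" "\<And>J. \<exists>k. J = PIdl (z k) \<Longrightarrow> I \<subseteq> J \<Longrightarrow> J = I"
      by (rule ex_maximal_ideal_with[of "\<lambda>I. \<exists>k. I = PIdl (z k)" "PIdl (z 0)"])
        (use z(1) cgenideal_ideal in blast)+
    from I(1) obtain k where Ik: "I = PIdl (z k)" by (elim exE)
    have k: "PIdl (z j) = PIdl (z k)" if "PIdl (z k) \<subseteq> PIdl (z j)" for j
      using I(2)[of "PIdl (z j)"] that unfolding Ik by (simp add: exI[of _ j])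
    have "z k \<in> PIdl (z (Suc k))" using za[of k] ac by (auto simp: cgenideal_def)
    then have "PIdl (z k) \<subseteq> PIdl (z (Suc k))" using cgenideal_minimal cgenideal_ideal z by auto
    from k[OF this] have "z (Suc k) \<in> PIdl (z k)" using cgenideal_self[OF z(1)] by auto
    then obtain r where r: "r \<in> carrier R" "z (Suc k) = r \<otimes> z k" by (auto simp: cgenideal_def)
    have "(\<one> \<ominus> r \<otimes> a) \<otimes> z (Suc k) = z (Suc k) \<ominus> r \<otimes> (a \<otimes> z (Suc k))"
      using r(1) ac z(1) by (simp add: a_minus_def l_distr l_minus m_assoc)
    also have "\<dots> = \<zero>" using r za[of k] z(1)[of k] z(1)[of "Suc k"] by (simp add: a_minus_def r_neg)
    finally have 0: "(\<one> \<ominus> r \<otimes> a) \<otimes> z (Suc k) = \<zero>" .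
    have "r \<otimes> a \<in> \<mm>" using am r ideal_lmult[OF mm_ideal] by auto
    then have nm: "\<one> \<ominus> r \<otimes> a \<notin> \<mm>" by (rule one_plus_mm)
    have c: "\<one> \<ominus> r \<otimes> a \<in> carrier R" using r(1) ac by simp
    obtain u where u: "u \<in> carrier R" "u \<otimes> (\<one> \<ominus> r \<otimes> a) = \<one>"
      using unit_if_notin_mm[OF c nm] by (elim bexE)
    have "z (Suc k) = (u \<otimes> (\<one> \<ominus> r \<otimes> a)) \<otimes> z (Suc k)" unfolding u(2) using z(1) by simp
    also have "\<dots> = u \<otimes> ((\<one> \<ominus> r \<otimes> a) \<otimes> z (Suc k))" using u(1) c z(1) by (simp add: m_assoc)
    finally have "z (Suc k) = \<zero>" unfolding 0 using u(1) by simp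
    then show False using z(2)[of "Suc k"] ac y by auto
  qed
  have ne: "\<one> \<noteq> \<zero>" using one_notin_mm ideal_zero[OF mm_ideal] by auto
  have "domain R"
  proof (rule domainI[OF is_cring ne])
    fix x y assume xy: "x \<otimes> y = \<zero>" "x \<in> carrier R" "y \<in> carrier R"
    show "x = \<zero> \<or> y = \<zero>"
    proof (rule ccontr)
      assume "\<not> (x = \<zero> \<or> y = \<zero>)"
      then obtain k u l v where *: "u \<in> carrier R - \<mm>" "v \<in> carrier R - \<mm>"
        "x = a [^] (k::nat) \<otimes> u" "y = a [^] (l::nat) \<otimes> v" using fac[of x] fac[of y] xy by auto
      then have "a [^] k \<otimes> (a [^] l \<otimes> (u \<otimes> v)) = \<zero>" using xy ac by (simp add: m_ac)
      then have "a [^] l \<otimes> (u \<otimes> v) = \<zero>" using powreg ac * by simp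
      then have "u \<otimes> v = \<zero>" using powreg ac * by simp
      then show False using prime_complement_mult[OF mm_prime *(1,2)] ideal_zero[OF mm_ideal] by auto
    qed
  qed
  moreover have "\<exists>x\<in>carrier R. I = PIdl x" if I: "ideal I R" for I
  proof (cases "I = {\<zero>}")
    case True
    then show ?thesis by (intro bexI[of _ \<zero>]) (auto simp: cgenideal_def intro!: exI[of _ \<zero>])
  next
    case False
    have inI: "a [^] k \<in> I" if ku: "a [^] (k::nat) \<otimes> u \<in> I" "u \<in> carrier R - \<mm>" for k u
    proof -
      obtain w where w: "w \<in> carrier R" "w \<otimes> u = \<one>" using ku(2) unit_if_notin_mm[of u] by auto
      have "w \<otimes> (a [^] k \<otimes> u) = a [^] k \<otimes> (w \<otimes> u)" using w(1) ku(2) ac by (simp add: m_lcomm)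
      then have "w \<otimes> (a [^] k \<otimes> u) = a [^] k" using w(2) ac by simp
      then show ?thesis using ideal_lmult[OF I w(1) ku(1)] by simp
    qed
    have "\<exists>k::nat. a [^] k \<in> I"
    proof -
      obtain y where y: "y \<in> I" "y \<noteq> \<zero>" using False ideal_zero[OF I] by auto
      obtain k u where "u \<in> carrier R - \<mm>" "y = a [^] (k::nat) \<otimes> u"
        using fac[OF ideal_carrier[OF I y(1)] y(2)] by (elim exE conjE)
      then show ?thesis using inI y(1) by (intro exI[of _ k]) simp
    qed
    then obtain k :: nat where k: "a [^] k \<in> I" and least: "\<And>j. j < k \<Longrightarrow> a [^] j \<notin> I"
      using exists_least_iff[of "\<lambda>k::nat. a [^] k \<in> I"] by auto
    have "I = PIdl (a [^] k)"
    proof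
      show "PIdl (a [^] k) \<subseteq> I" using cgenideal_minimal[OF I k] .
      show "I \<subseteq> PIdl (a [^] k)"
      proof
        fix y assume y: "y \<in> I"
        have yc: "y \<in> carrier R" using ideal_carrier[OF I] y by auto
        show "y \<in> PIdl (a [^] k)"
        proof (cases "y = \<zero>")
          case True
          then show ?thesis using ac by (auto simp: cgenideal_def intro!: exI[of _ \<zero>])
        next
          case False
          then obtain j u where ju: "u \<in> carrier R - \<mm>" "y = a [^] (j::nat) \<otimes> u" using fac[OF yc] by auto
          then have "a [^] j \<in> I" using inI y by auto
          then have "k \<le> j" using least not_le by blast
          then have "a [^] j = a [^] (j - k) \<otimes> a [^] k" using ac by (simp add: nat_pow_mult)
          then have "y = (a [^] (j - k) \<otimes> u) \<otimes> a [^] k" using ju ac by (simp add: m_ac)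
          then show ?thesis using ju ac by (auto simp: cgenideal_def)
        qed
      qed
    qed
    then show ?thesis using ac by auto
  qed
  ultimately show ?thesis by (simp add: principal_domain_def principal_domain_axioms_def)
qed

end

section \<open>Homomorphisms and submodules\<close>

lemma mod_homI:
  assumes "\<And>x. x \<in> carrier M \<Longrightarrow> f x \<in> carrier N"
    and "\<And>x y. \<lbrakk>x \<in> carrier M; y \<in> carrier M\<rbrakk> \<Longrightarrow> f (x \<oplus>\<^bsub>M\<^esub> y) = f x \<oplus>\<^bsub>N\<^esub> f y"
    and "\<And>a x. \<lbrakk>a \<in> carrier R; x \<in> carrier M\<rbrakk> \<Longrightarrow> f (a \<odot>\<^bsub>M\<^esub> x) = a \<odot>\<^bsub>N\<^esub> f x"
  shows "f \<in> mod_hom R M N"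
  using assms by (auto simp: mod_hom_def)

lemma mod_homD:
  assumes "f \<in> mod_hom R M N"
  shows mod_hom_closed: "x \<in> carrier M \<Longrightarrow> f x \<in> carrier N"
    and mod_hom_add: "\<lbrakk>x \<in> carrier M; y \<in> carrier M\<rbrakk> \<Longrightarrow> f (x \<oplus>\<^bsub>M\<^esub> y) = f x \<oplus>\<^bsub>N\<^esub> f y"
    and mod_hom_smult: "\<lbrakk>a \<in> carrier R; x \<in> carrier M\<rbrakk> \<Longrightarrow> f (a \<odot>\<^bsub>M\<^esub> x) = a \<odot>\<^bsub>N\<^esub> f x"
  using assms by (auto simp: mod_hom_def)

lemma mod_hom_comp:
  assumes "f \<in> mod_hom R M N" "g \<in> mod_hom R N P"
  shows "(\<lambda>x. g (f x)) \<in> mod_hom R M P"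
  using assms by (auto simp: mod_hom_def Pi_def)

lemma mod_hom_funpow: "h \<in> mod_hom R M M \<Longrightarrow> h ^^ k \<in> mod_hom R M M"
  by (induction k) (auto simp: mod_hom_def Pi_def)

lemma mod_hom_id: "(\<lambda>x. x) \<in> mod_hom R M M"
  by (auto simp: mod_hom_def)

lemma mod_hom_zero:
  assumes "module R M" "module R N" "f \<in> mod_hom R M N"
  shows "f \<zero>\<^bsub>M\<^esub> = \<zero>\<^bsub>N\<^esub>"
proof -
  interpret M: module R M by fact
  interpret N: module R N by fact
  have "f (\<zero>\<^bsub>R\<^esub> \<odot>\<^bsub>M\<^esub> \<zero>\<^bsub>M\<^esub>) = \<zero>\<^bsub>R\<^esub> \<odot>\<^bsub>N\<^esub> f \<zero>\<^bsub>M\<^esub>"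
    by (rule mod_hom_smult[OF assms(3)]) auto
  then show ?thesis using mod_hom_closed[OF assms(3), of "\<zero>\<^bsub>M\<^esub>"] by simp
qed

lemma mod_hom_uminus:
  assumes "module R M" "module R N" "f \<in> mod_hom R M N" "x \<in> carrier M"
  shows "f (\<ominus>\<^bsub>M\<^esub> x) = \<ominus>\<^bsub>N\<^esub> f x"
proof -
  interpret M: module R M by fact
  interpret N: module R N by fact
  have "f ((\<ominus>\<^bsub>R\<^esub> \<one>\<^bsub>R\<^esub>) \<odot>\<^bsub>M\<^esub> x) = (\<ominus>\<^bsub>R\<^esub> \<one>\<^bsub>R\<^esub>) \<odot>\<^bsub>N\<^esub> f x"
    by (rule mod_hom_smult[OF assms(3)]) (use assms(4) in auto)
  then show ?thesis using mod_hom_closed[OF assms(3,4)] assms(4)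
    by (simp add: M.smult_l_minus N.smult_l_minus)
qed

lemma mod_hom_minus:
  assumes "module R M" "module R N" "f \<in> mod_hom R M N" "x \<in> carrier M" "y \<in> carrier M"
  shows "f (x \<ominus>\<^bsub>M\<^esub> y) = f x \<ominus>\<^bsub>N\<^esub> f y"
proof -
  interpret M: module R M by fact
  show ?thesis using assms
    by (simp add: a_minus_def mod_hom_add[OF assms(3)] mod_hom_uminus[OF assms(1-3)])
qed

lemma mod_hom_finsum:
  assumes "module R M" "module R N" "f \<in> mod_hom R M N" "finite A" "g \<in> A \<rightarrow> carrier M"
  shows "f (finsum M g A) = finsum N (\<lambda>i. f (g i)) A"
proof -
  interpret M: module R M by fact
  interpret N: module R N by fact
  show ?thesis using assms(4,5)
  proof (induction A rule: finite_induct)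
    case empty
    then show ?case using mod_hom_zero[OF assms(1-3)] by simp
  next
    case (insert i A)
    have i: "g i \<in> carrier M" and A: "g \<in> A \<rightarrow> carrier M" using insert.prems by auto
    have fA: "(\<lambda>i. f (g i)) \<in> A \<rightarrow> carrier N" using A mod_hom_closed[OF assms(3)] by auto
    have "f (finsum M g (insert i A)) = f (g i \<oplus>\<^bsub>M\<^esub> finsum M g A)"
      using insert.hyps i A by (simp add: M.finsum_insert)
    also have "\<dots> = f (g i) \<oplus>\<^bsub>N\<^esub> finsum N (\<lambda>i. f (g i)) A"
      using mod_hom_add[OF assms(3) i M.finsum_closed[OF A]] insert.IH[OF A] by simp
    also have "\<dots> = finsum N (\<lambda>i. f (g i)) (insert i A)"
      using insert.hyps mod_hom_closed[OF assms(3) i] fA by (simp add: N.finsum_insert)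
    finally show ?case .
  qed
qed

context module
begin

lemma submodule_facts:
  assumes "submodule H R M"
  shows submodule_carrier: "x \<in> H \<Longrightarrow> x \<in> carrier M"
    and submodule_zero: "\<zero>\<^bsub>M\<^esub> \<in> H"
    and submodule_add: "\<lbrakk>x \<in> H; y \<in> H\<rbrakk> \<Longrightarrow> x \<oplus>\<^bsub>M\<^esub> y \<in> H"
    and submodule_smult: "\<lbrakk>a \<in> carrier R; x \<in> H\<rbrakk> \<Longrightarrow> a \<odot>\<^bsub>M\<^esub> x \<in> H"
    and submodule_uminus: "x \<in> H \<Longrightarrow> \<ominus>\<^bsub>M\<^esub> x \<in> H"
    and submodule_minus: "\<lbrakk>x \<in> H; y \<in> H\<rbrakk> \<Longrightarrow> x \<ominus>\<^bsub>M\<^esub> y \<in> H"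
proof -
  note E = submoduleE[OF assms]
  show "x \<in> H \<Longrightarrow> x \<in> carrier M" "\<lbrakk>x \<in> H; y \<in> H\<rbrakk> \<Longrightarrow> x \<oplus>\<^bsub>M\<^esub> y \<in> H"
    "\<lbrakk>a \<in> carrier R; x \<in> H\<rbrakk> \<Longrightarrow> a \<odot>\<^bsub>M\<^esub> x \<in> H" "x \<in> H \<Longrightarrow> \<ominus>\<^bsub>M\<^esub> x \<in> H"
    using E by auto
  show "\<lbrakk>x \<in> H; y \<in> H\<rbrakk> \<Longrightarrow> x \<ominus>\<^bsub>M\<^esub> y \<in> H" using E(3,5) by (auto simp: a_minus_def)
  obtain z where z: "z \<in> H" using E(2) by auto
  then have "\<zero> \<odot>\<^bsub>M\<^esub> z \<in> H" using E(4)[of \<zero> z] by auto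
  then show "\<zero>\<^bsub>M\<^esub> \<in> H" using z E(1) by auto
qed

lemma submoduleI':
  assumes "H \<subseteq> carrier M" "\<zero>\<^bsub>M\<^esub> \<in> H"
    and "\<And>x y. \<lbrakk>x \<in> H; y \<in> H\<rbrakk> \<Longrightarrow> x \<oplus>\<^bsub>M\<^esub> y \<in> H"
    and smult: "\<And>a x. \<lbrakk>a \<in> carrier R; x \<in> H\<rbrakk> \<Longrightarrow> a \<odot>\<^bsub>M\<^esub> x \<in> H"
  shows "submodule H R M"
proof (rule submoduleI)
  show "\<ominus>\<^bsub>M\<^esub> x \<in> H" if x: "x \<in> H" for x
    using smult[of "\<ominus> \<one>" x] x assms(1) by (auto simp: smult_l_minus)
qed (use assms in auto)

lemma submodule_add_cancel:
  assumes "submodule H R M" "x \<in> H" "x \<oplus>\<^bsub>M\<^esub> y \<in> H" "y \<in> carrier M"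
  shows "y \<in> H"
proof -
  have x: "x \<in> carrier M" by (rule submodule_carrier[OF assms(1,2)])
  have "\<ominus>\<^bsub>M\<^esub> x \<oplus>\<^bsub>M\<^esub> (x \<oplus>\<^bsub>M\<^esub> y) \<in> H"
    by (rule submodule_add[OF assms(1) submodule_uminus[OF assms(1,2)] assms(3)])
  then show ?thesis using x assms(4) by (simp add: M.r_neg1 M.r_neg2)
qed

lemma submodule_minus_cancel:
  assumes "submodule H R M" "x \<in> H" "y \<ominus>\<^bsub>M\<^esub> x \<in> H" "y \<in> carrier M"
  shows "y \<in> H"
proof -
  have x: "x \<in> carrier M" by (rule submodule_carrier[OF assms(1,2)])
  have "(y \<ominus>\<^bsub>M\<^esub> x) \<oplus>\<^bsub>M\<^esub> x \<in> H" by (rule submodule_add[OF assms(1,3,2)])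
  then show ?thesis using x assms(4) by (simp add: a_minus_def M.a_assoc M.l_neg)
qed

lemma submodule_finsum:
  assumes "submodule H R M" "finite A" "\<And>i. i \<in> A \<Longrightarrow> g i \<in> H"
  shows "finsum M g A \<in> H"
  using assms(2,3)
proof (induction A rule: finite_induct)
  case empty
  then show ?case using submodule_zero[OF assms(1)] by simp
next
  case (insert i A)
  have gA: "g \<in> A \<rightarrow> carrier M" "g i \<in> carrier M"
    using insert.prems submodule_carrier[OF assms(1)] by auto
  have "g i \<oplus>\<^bsub>M\<^esub> finsum M g A \<in> H"
    by (rule submodule_add[OF assms(1)]) (use insert in auto)
  then show ?case using insert.hyps gA by (simp add: M.finsum_insert)
qed

lemma minus_eq_zero_iff:
  assumes "x \<in> carrier M" "y \<in> carrier M"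
  shows "x \<ominus>\<^bsub>M\<^esub> y = \<zero>\<^bsub>M\<^esub> \<longleftrightarrow> x = y"
proof
  assume "x \<ominus>\<^bsub>M\<^esub> y = \<zero>\<^bsub>M\<^esub>"
  then have "(x \<ominus>\<^bsub>M\<^esub> y) \<oplus>\<^bsub>M\<^esub> y = y" using assms by simp
  then show "x = y" using assms by (simp add: a_minus_def M.a_assoc M.l_neg)
qed (use assms in \<open>simp add: a_minus_def M.r_neg\<close>)

lemma module_span_submodule:
  assumes "A \<subseteq> carrier M"
  shows "submodule (module_span R M A) R M"
proof (rule submoduleI')
  show "module_span R M A \<subseteq> carrier M"
    unfolding module_span_def using carrier_is_submodule assms by auto
qed (auto simp: module_span_def submodule_zero submodule_add submodule_smult)

lemma module_span_superset: "A \<subseteq> module_span R M A"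
  by (auto simp: module_span_def)

lemma module_span_minimal: "\<lbrakk>submodule H R M; A \<subseteq> H\<rbrakk> \<Longrightarrow> module_span R M A \<subseteq> H"
  by (auto simp: module_span_def)

lemma module_span_mono: "A \<subseteq> B \<Longrightarrow> module_span R M A \<subseteq> module_span R M B"
  by (auto simp: module_span_def)

lemma submodule_zero_set: "submodule {\<zero>\<^bsub>M\<^esub>} R M"
  by (rule submoduleI') auto

end

lemma submodule_preimage:
  assumes "module R M" "module R N" "f \<in> mod_hom R M N" "submodule K R M" "submodule H R N"
  shows "submodule {x \<in> K. f x \<in> H} R M"
proof -
  interpret M: module R M by fact
  interpret N: module R N by fact
  note K = M.submodule_facts[OF assms(4)] and H = N.submodule_facts[OF assms(5)]
  show ?thesis
  proof (rule M.submoduleI')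
    show "\<zero>\<^bsub>M\<^esub> \<in> {x \<in> K. f x \<in> H}" using K(2) H(2) mod_hom_zero[OF assms(1-3)] by simp
    show "x \<oplus>\<^bsub>M\<^esub> y \<in> {x \<in> K. f x \<in> H}" if "x \<in> {x \<in> K. f x \<in> H}" "y \<in> {x \<in> K. f x \<in> H}" for x y
      using that K(1,3) H(3) by (simp add: mod_hom_add[OF assms(3)])
    show "a \<odot>\<^bsub>M\<^esub> x \<in> {x \<in> K. f x \<in> H}" if "a \<in> carrier R" "x \<in> {x \<in> K. f x \<in> H}" for a x
      using that K(1,4) H(4) by (simp add: mod_hom_smult[OF assms(3)])
  qed (use K(1) in auto)
qed

lemma submodule_image:
  assumes "module R M" "module R N" "f \<in> mod_hom R M N" "submodule K R M"
  shows "submodule (f ` K) R N"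
proof -
  interpret M: module R M by fact
  interpret N: module R N by fact
  note K = M.submodule_facts[OF assms(4)]
  show ?thesis
  proof (rule N.submoduleI')
    show "f ` K \<subseteq> carrier N" using K(1) mod_hom_closed[OF assms(3)] by auto
    show "\<zero>\<^bsub>N\<^esub> \<in> f ` K" using K(2) mod_hom_zero[OF assms(1-3)] by (metis imageI)
    show "x \<oplus>\<^bsub>N\<^esub> y \<in> f ` K" if xy: "x \<in> f ` K" "y \<in> f ` K" for x y
    proof -
      obtain u v where "u \<in> K" "v \<in> K" "x = f u" "y = f v" using xy by auto
      then show ?thesis using K(1,3) mod_hom_add[OF assms(3), of u v] by (metis imageI)
    qed
    show "a \<odot>\<^bsub>N\<^esub> x \<in> f ` K" if ax: "a \<in> carrier R" "x \<in> f ` K" for a x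
    proof -
      obtain u where "u \<in> K" "x = f u" using ax by auto
      then show ?thesis using ax K(1,4) mod_hom_smult[OF assms(3), of a u] by (metis imageI)
    qed
  qed
qed

lemma submodule_equalizer:
  assumes "module R M" "module R N" "f \<in> mod_hom R M N" "g \<in> mod_hom R M N"
  shows "submodule {x \<in> carrier M. f x = g x} R M"
proof -
  interpret M: module R M by fact
  show ?thesis
    by (rule M.submoduleI')
      (use mod_hom_zero[OF assms(1,2,3)] mod_hom_zero[OF assms(1,2,4)] in
        \<open>auto simp: mod_hom_add[OF assms(3)] mod_hom_add[OF assms(4)]
          mod_hom_smult[OF assms(3)] mod_hom_smult[OF assms(4)]\<close>)
qed

lemma submodule_kernel:
  assumes "module R M" "module R N" "f \<in> mod_hom R M N"
  shows "submodule {x \<in> carrier M. f x = \<zero>\<^bsub>N\<^esub>} R M"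
proof -
  interpret M: module R M by fact
  interpret N: module R N by fact
  show ?thesis
    using submodule_preimage[OF assms M.carrier_is_submodule N.submodule_zero_set] by simp
qed

lemma module_span_image_subset:
  assumes "module R M" "module R N" "f \<in> mod_hom R M N" "A \<subseteq> carrier M"
  shows "module_span R N (f ` A) = f ` module_span R M A"
proof
  interpret M: module R M by fact
  interpret N: module R N by fact
  show "module_span R N (f ` A) \<subseteq> f ` module_span R M A"
    by (rule N.module_span_minimal[OF submodule_image[OF assms(1-3) M.module_span_submodule[OF assms(4)]]])
      (use M.module_span_superset in auto)
  have fA: "f ` A \<subseteq> carrier N" using assms(4) mod_hom_closed[OF assms(3)] by auto
  have "module_span R M A \<subseteq> {x \<in> carrier M. f x \<in> module_span R N (f ` A)}"
    by (rule M.module_span_minimal[OF submodule_preimage[OF assms(1-3) M.carrier_is_submodule N.module_span_submodule[OF fA]]])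
      (use assms(4) N.module_span_superset[of "f ` A"] in auto)
  then show "f ` module_span R M A \<subseteq> module_span R N (f ` A)" by auto
qed

lemma mod_hom_factor:
  assumes "module R F" "module R M" "module R N"
    and e: "e \<in> mod_hom R F M" "e ` carrier F = carrier M" and H: "H \<in> mod_hom R F N"
    and ker: "\<And>v. \<lbrakk>v \<in> carrier F; e v = \<zero>\<^bsub>M\<^esub>\<rbrakk> \<Longrightarrow> H v = \<zero>\<^bsub>N\<^esub>"
  obtains h where "h \<in> mod_hom R M N" "\<And>v. v \<in> carrier F \<Longrightarrow> h (e v) = H v"
proof -
  interpret F: module R F by fact
  interpret M: module R M by fact
  interpret N: module R N by fact
  define s where "s y = (SOME v. v \<in> carrier F \<and> e v = y)" for y
  have s: "s y \<in> carrier F" "e (s y) = y" if y: "y \<in> carrier M" for y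
  proof -
    have "\<exists>v. v \<in> carrier F \<and> e v = y" using y e(2) by (metis imageE)
    from someI_ex[OF this] show "s y \<in> carrier F" "e (s y) = y" by (auto simp: s_def)
  qed
  have eq: "H v = H w" if vw: "v \<in> carrier F" "w \<in> carrier F" "e v = e w" for v w
  proof -
    have "e (v \<ominus>\<^bsub>F\<^esub> w) = \<zero>\<^bsub>M\<^esub>"
      using vw mod_hom_minus[OF assms(1,2) e(1)] mod_hom_closed[OF e(1)] M.minus_eq_zero_iff by simp
    then have "H v \<ominus>\<^bsub>N\<^esub> H w = \<zero>\<^bsub>N\<^esub>"
      using ker[of "v \<ominus>\<^bsub>F\<^esub> w"] vw mod_hom_minus[OF assms(1,3) H] by simp
    then show ?thesis using N.minus_eq_zero_iff vw mod_hom_closed[OF H] by simp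
  qed
  have hom: "(\<lambda>y. H (s y)) \<in> mod_hom R M N"
  proof (rule mod_homI)
    show "H (s y) \<in> carrier N" if "y \<in> carrier M" for y using that s mod_hom_closed[OF H] by simp
    show "H (s (y \<oplus>\<^bsub>M\<^esub> z)) = H (s y) \<oplus>\<^bsub>N\<^esub> H (s z)" if yz: "y \<in> carrier M" "z \<in> carrier M" for y z
    proof -
      have "H (s (y \<oplus>\<^bsub>M\<^esub> z)) = H (s y \<oplus>\<^bsub>F\<^esub> s z)"
        by (rule eq) (use yz s mod_hom_add[OF e(1)] in auto)
      then show ?thesis using mod_hom_add[OF H] s yz by simp
    qed
    show "H (s (a \<odot>\<^bsub>M\<^esub> y)) = a \<odot>\<^bsub>N\<^esub> H (s y)" if ay: "a \<in> carrier R" "y \<in> carrier M" for a y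
    proof -
      have "H (s (a \<odot>\<^bsub>M\<^esub> y)) = H (a \<odot>\<^bsub>F\<^esub> s y)"
        by (rule eq) (use ay s mod_hom_smult[OF e(1)] in auto)
      then show ?thesis using mod_hom_smult[OF H] s ay by simp
    qed
  qed
  have "H (s (e v)) = H v" if "v \<in> carrier F" for v
    by (rule eq) (use that s mod_hom_closed[OF e(1)] in auto)
  with hom show thesis by (rule that)
qed

section \<open>Powers, free modules and modules of homomorphisms\<close>

lemma self_module_simps [simp]:
  "carrier (self_module R) = carrier R" "\<zero>\<^bsub>self_module R\<^esub> = \<zero>\<^bsub>R\<^esub>"
  "x \<oplus>\<^bsub>self_module R\<^esub> y = x \<oplus>\<^bsub>R\<^esub> y" "a \<odot>\<^bsub>self_module R\<^esub> x = a \<otimes>\<^bsub>R\<^esub> x"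
  by (simp_all add: self_module_def)

lemma (in cring) module_self: "module R (self_module R)"
proof (rule moduleI[OF is_cring])
  show "abelian_group (self_module R)"
  proof (rule abelian_groupI)
    show "\<exists>y\<in>carrier (self_module R). y \<oplus>\<^bsub>self_module R\<^esub> x = \<zero>\<^bsub>self_module R\<^esub>"
      if "x \<in> carrier (self_module R)" for x using that by (auto intro!: bexI[of _ "\<ominus> x"] l_neg)
  qed (auto simp: a_ac)
qed (auto simp: l_distr r_distr m_assoc)

definition fun_mod :: "'i set \<Rightarrow> ('a, 'm, 'l) module_scheme \<Rightarrow> ('a, 'i \<Rightarrow> 'm) module" where
  "fun_mod I M = \<lparr>carrier = I \<rightarrow>\<^sub>E carrier M,
     monoid.mult = undefined, one = undefined,
     ring.zero = (\<lambda>i\<in>I. \<zero>\<^bsub>M\<^esub>),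
     ring.add = (\<lambda>x y. \<lambda>i\<in>I. x i \<oplus>\<^bsub>M\<^esub> y i),
     smult = (\<lambda>a x. \<lambda>i\<in>I. a \<odot>\<^bsub>M\<^esub> x i)\<rparr>"

lemma fun_mod_simps [simp]:
  "carrier (fun_mod I M) = I \<rightarrow>\<^sub>E carrier M" "\<zero>\<^bsub>fun_mod I M\<^esub> = (\<lambda>i\<in>I. \<zero>\<^bsub>M\<^esub>)"
  "x \<oplus>\<^bsub>fun_mod I M\<^esub> y = (\<lambda>i\<in>I. x i \<oplus>\<^bsub>M\<^esub> y i)" "a \<odot>\<^bsub>fun_mod I M\<^esub> x = (\<lambda>i\<in>I. a \<odot>\<^bsub>M\<^esub> x i)"
  by (simp_all add: fun_mod_def)

lemma free_mod_eq: "free_mod R n = fun_mod {..<n} (self_module R)"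
  by (simp add: free_mod_def fun_mod_def)

lemma module_fun_mod:
  assumes "module R M"
  shows "module R (fun_mod I M)"
proof -
  interpret M: module R M by fact
  have mem: "x i \<in> carrier M" if "x \<in> I \<rightarrow>\<^sub>E carrier M" "i \<in> I" for x i using that by auto
  show ?thesis
  proof (rule moduleI[OF M.is_cring])
    show "abelian_group (fun_mod I M)"
    proof (rule abelian_groupI)
      fix x assume x: "x \<in> carrier (fun_mod I M)"
      have xi: "x i \<in> carrier M" if "i \<in> I" for i using x that by auto
      show "\<exists>y\<in>carrier (fun_mod I M). y \<oplus>\<^bsub>fun_mod I M\<^esub> x = \<zero>\<^bsub>fun_mod I M\<^esub>"
        by (rule bexI[of _ "\<lambda>i\<in>I. \<ominus>\<^bsub>M\<^esub> x i"])
          (auto simp: M.l_neg[OF xi] xi intro!: restrict_ext)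
      show "\<zero>\<^bsub>fun_mod I M\<^esub> \<oplus>\<^bsub>fun_mod I M\<^esub> x = x"
        using x by (auto simp: mem PiE_iff extensional_def fun_eq_iff)
    qed (auto simp: M.a_ac mem intro!: restrict_ext)
    show "\<one>\<^bsub>R\<^esub> \<odot>\<^bsub>fun_mod I M\<^esub> x = x" if x: "x \<in> carrier (fun_mod I M)" for x
      using x by (auto simp: mem PiE_iff extensional_def fun_eq_iff)
  qed (auto simp: M.smult_l_distr M.smult_r_distr M.smult_assoc1 mem intro!: restrict_ext)
qed

lemma (in cring) module_free_mod: "module R (free_mod R n)"
  unfolding free_mod_eq by (rule module_fun_mod[OF module_self])

lemma eval_mod_hom: "i \<in> I \<Longrightarrow> (\<lambda>x. x i) \<in> mod_hom R (fun_mod I M) M"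
  by (rule mod_homI) auto

lemma coord_mod_hom: "i < n \<Longrightarrow> (\<lambda>x. x i) \<in> mod_hom R (free_mod R n) (self_module R)"
  unfolding free_mod_eq by (rule eval_mod_hom) simp

lemma mod_hom_into_fun:
  assumes "\<And>i. i \<in> I \<Longrightarrow> g i \<in> mod_hom R M N"
  shows "(\<lambda>x. \<lambda>i\<in>I. g i x) \<in> mod_hom R M (fun_mod I N)"
  by (rule mod_homI)
    (auto simp: mod_hom_closed[OF assms] mod_hom_add[OF assms] mod_hom_smult[OF assms] intro!: restrict_ext)

lemma Hom_mod_eq:
  "Hom_mod R M N = (fun_mod (carrier M) N)\<lparr>carrier := mod_hom R M N \<inter> extensional (carrier M)\<rparr>"
  by (simp add: Hom_mod_def fun_mod_def)

lemma Hom_mod_simps [simp]: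
  "carrier (Hom_mod R M N) = mod_hom R M N \<inter> extensional (carrier M)"
  "\<zero>\<^bsub>Hom_mod R M N\<^esub> = (\<lambda>x\<in>carrier M. \<zero>\<^bsub>N\<^esub>)"
  "f \<oplus>\<^bsub>Hom_mod R M N\<^esub> g = (\<lambda>x\<in>carrier M. f x \<oplus>\<^bsub>N\<^esub> g x)"
  "a \<odot>\<^bsub>Hom_mod R M N\<^esub> f = (\<lambda>x\<in>carrier M. a \<odot>\<^bsub>N\<^esub> f x)"
  by (simp_all add: Hom_mod_def)

lemma mod_hom_restrict:
  assumes "module R M" "f \<in> mod_hom R M N"
  shows "restrict f (carrier M) \<in> mod_hom R M N \<inter> extensional (carrier M)"
proof -
  interpret M: module R M by fact
  show ?thesis
    by (auto intro!: mod_homI simp: mod_homD[OF assms(2)])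
qed

lemma module_Hom_mod:
  assumes "module R M" "module R N"
  shows "module R (Hom_mod R M N)"
proof -
  interpret M: module R M by fact
  interpret N: module R N by fact
  interpret F: module R "fun_mod (carrier M) N" by (rule module_fun_mod[OF assms(2)])
  have "submodule (mod_hom R M N \<inter> extensional (carrier M)) R (fun_mod (carrier M) N)"
  proof (rule F.submoduleI')
    show "mod_hom R M N \<inter> extensional (carrier M) \<subseteq> carrier (fun_mod (carrier M) N)"
      by (auto simp: mod_hom_def PiE_def)
    show "\<zero>\<^bsub>fun_mod (carrier M) N\<^esub> \<in> mod_hom R M N \<inter> extensional (carrier M)"
      by (auto intro!: mod_homI)
    show "f \<oplus>\<^bsub>fun_mod (carrier M) N\<^esub> g \<in> mod_hom R M N \<inter> extensional (carrier M)"
      if "f \<in> mod_hom R M N \<inter> extensional (carrier M)" "g \<in> mod_hom R M N \<inter> extensional (carrier M)" for f g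
    proof -
      have f: "f \<in> mod_hom R M N" and g: "g \<in> mod_hom R M N" using that by auto
      show ?thesis
        by (auto intro!: mod_homI simp: mod_homD[OF f] mod_homD[OF g] N.a_ac N.smult_r_distr)
    qed
    show "a \<odot>\<^bsub>fun_mod (carrier M) N\<^esub> f \<in> mod_hom R M N \<inter> extensional (carrier M)"
      if a: "a \<in> carrier R" and "f \<in> mod_hom R M N \<inter> extensional (carrier M)" for a f
    proof -
      have f: "f \<in> mod_hom R M N" using that by auto
      show ?thesis using a
        by (auto intro!: mod_homI simp: mod_homD[OF f] N.smult_r_distr N.smult_assoc1[symmetric] M.m_comm)
    qed
  qed
  then show ?thesis unfolding Hom_mod_eq by (rule submodule.submodule_is_module) (rule F.module_axioms)
qed

text \<open>\<open>lincomb N n b v\<close> is the value at \<open>v\<close> of the homomorphism from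
  \<open>R\<^sup>n\<close> to \<open>N\<close> that sends the \<open>j\<close>-th basis vector to \<open>b j\<close>.\<close>

definition lincomb :: "('a, 'm, 'l) module_scheme \<Rightarrow> nat \<Rightarrow> (nat \<Rightarrow> 'm) \<Rightarrow> (nat \<Rightarrow> 'a) \<Rightarrow> 'm" where
  "lincomb N n b v = (\<Oplus>\<^bsub>N\<^esub>j\<in>{..<n}. v j \<odot>\<^bsub>N\<^esub> b j)"

definition basis_vec :: "('a, 'k) ring_scheme \<Rightarrow> nat \<Rightarrow> nat \<Rightarrow> (nat \<Rightarrow> 'a)" where
  "basis_vec R n j = (\<lambda>i\<in>{..<n}. if i = j then \<one>\<^bsub>R\<^esub> else \<zero>\<^bsub>R\<^esub>)"

lemma free_carrier_iff: "v \<in> carrier (free_mod R n) \<longleftrightarrow> v \<in> {..<n} \<rightarrow>\<^sub>E carrier R"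
  by (simp add: free_mod_eq)

lemma free_coord: "\<lbrakk>v \<in> carrier (free_mod R n); j < n\<rbrakk> \<Longrightarrow> v j \<in> carrier R"
  by (auto simp: free_mod_eq)

lemma free_eqI:
  assumes "v \<in> carrier (free_mod R n)" "w \<in> carrier (free_mod R n)" "\<And>j. j < n \<Longrightarrow> v j = w j"
  shows "v = w"
  using assms unfolding free_carrier_iff by (auto intro: PiE_ext)

lemma free_coord_simps [simp]:
  "j < n \<Longrightarrow> (v \<oplus>\<^bsub>free_mod R n\<^esub> w) j = v j \<oplus>\<^bsub>R\<^esub> w j"
  "j < n \<Longrightarrow> (a \<odot>\<^bsub>free_mod R n\<^esub> v) j = a \<otimes>\<^bsub>R\<^esub> v j"
  "j < n \<Longrightarrow> \<zero>\<^bsub>free_mod R n\<^esub> j = \<zero>\<^bsub>R\<^esub>"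
  by (auto simp: free_mod_eq)

lemma (in cring) basis_vec_carrier [simp]: "basis_vec R n j \<in> carrier (free_mod R n)"
  by (auto simp: basis_vec_def free_mod_eq)

context module
begin

lemma lincomb_closed:
  "\<lbrakk>\<And>j. j < n \<Longrightarrow> b j \<in> carrier M; \<And>j. j < n \<Longrightarrow> v j \<in> carrier R\<rbrakk> \<Longrightarrow> lincomb M n b v \<in> carrier M"
  unfolding lincomb_def by (rule M.finsum_closed) auto

lemma lincomb_cong:
  assumes "\<And>j. j < n \<Longrightarrow> b j = b' j" "\<And>j. j < n \<Longrightarrow> v j = v' j"
    "\<And>j. j < n \<Longrightarrow> b j \<in> carrier M" "\<And>j. j < n \<Longrightarrow> v j \<in> carrier R"
  shows "lincomb M n b v = lincomb M n b' v'"
  unfolding lincomb_def by (rule M.finsum_cong') (use assms in auto)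

lemma lincomb_mod_hom:
  assumes b: "\<And>j. j < n \<Longrightarrow> b j \<in> carrier M"
  shows "lincomb M n b \<in> mod_hom R (free_mod R n) M"
proof (rule mod_homI)
  fix v w assume v: "v \<in> carrier (free_mod R n)" and w: "w \<in> carrier (free_mod R n)"
  note cv = free_coord[OF v] and cw = free_coord[OF w]
  show "lincomb M n b v \<in> carrier M" by (rule lincomb_closed) (auto simp: b cv)
  have "lincomb M n b (v \<oplus>\<^bsub>free_mod R n\<^esub> w) = (\<Oplus>\<^bsub>M\<^esub>j\<in>{..<n}. v j \<odot>\<^bsub>M\<^esub> b j \<oplus>\<^bsub>M\<^esub> w j \<odot>\<^bsub>M\<^esub> b j)"
    unfolding lincomb_def by (rule M.finsum_cong') (auto simp: b cv cw smult_l_distr)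
  also have "\<dots> = lincomb M n b v \<oplus>\<^bsub>M\<^esub> lincomb M n b w"
    unfolding lincomb_def by (rule M.finsum_addf) (auto simp: b cv cw)
  finally show "lincomb M n b (v \<oplus>\<^bsub>free_mod R n\<^esub> w) = lincomb M n b v \<oplus>\<^bsub>M\<^esub> lincomb M n b w" .
next
  fix a v assume a: "a \<in> carrier R" and v: "v \<in> carrier (free_mod R n)"
  note cv = free_coord[OF v]
  have "a \<odot>\<^bsub>M\<^esub> lincomb M n b v = (\<Oplus>\<^bsub>M\<^esub>j\<in>{..<n}. a \<odot>\<^bsub>M\<^esub> (v j \<odot>\<^bsub>M\<^esub> b j))"
    unfolding lincomb_def by (rule finsum_smult_ldistr) (auto simp: a b cv)
  also have "\<dots> = lincomb M n b (a \<odot>\<^bsub>free_mod R n\<^esub> v)"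
    unfolding lincomb_def by (rule M.finsum_cong') (auto simp: a b cv smult_assoc1)
  finally show "lincomb M n b (a \<odot>\<^bsub>free_mod R n\<^esub> v) = a \<odot>\<^bsub>M\<^esub> lincomb M n b v" by simp
qed

lemma lincomb_basis_vec:
  assumes b: "\<And>j. j < n \<Longrightarrow> b j \<in> carrier M" and i: "i < n"
  shows "lincomb M n b (basis_vec R n i) = b i"
proof -
  have "lincomb M n b (basis_vec R n i) = (\<Oplus>\<^bsub>M\<^esub>j\<in>{..<n}. if i = j then b j else \<zero>\<^bsub>M\<^esub>)"
    unfolding lincomb_def by (rule M.finsum_cong') (auto simp: b basis_vec_def)
  also have "\<dots> = b i" by (rule M.finsum_singleton) (use i b in auto)
  finally show ?thesis .
qed

lemma lincomb_hom:
  assumes "module R N" "f \<in> mod_hom R M N"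
    and b: "\<And>j. j < n \<Longrightarrow> b j \<in> carrier M" and v: "\<And>j. j < n \<Longrightarrow> v j \<in> carrier R"
  shows "f (lincomb M n b v) = lincomb N n (\<lambda>j. f (b j)) v"
proof -
  interpret N: module R N by fact
  have "f (lincomb M n b v) = (\<Oplus>\<^bsub>N\<^esub>j\<in>{..<n}. f (v j \<odot>\<^bsub>M\<^esub> b j))"
    unfolding lincomb_def by (rule mod_hom_finsum[OF module_axioms assms(1,2)]) (auto simp: b v)
  also have "\<dots> = lincomb N n (\<lambda>j. f (b j)) v"
    unfolding lincomb_def
    by (rule N.finsum_cong') (auto simp: mod_hom_smult[OF assms(2)] mod_hom_closed[OF assms(2)] b v)
  finally show ?thesis .
qed

lemma lincomb_in_submodule:
  assumes "submodule H R M" "\<And>j. j < n \<Longrightarrow> v j \<odot>\<^bsub>M\<^esub> b j \<in> H"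
  shows "lincomb M n b v \<in> H"
  unfolding lincomb_def by (rule submodule_finsum[OF assms(1)]) (use assms(2) in auto)

lemma free_expand:
  assumes v: "v \<in> carrier (free_mod R n)"
  shows "v = lincomb (free_mod R n) n (basis_vec R n) v"
proof -
  interpret F: module R "free_mod R n" by (rule module_free_mod)
  interpret S: module R "self_module R" by (rule module_self)
  note cv = free_coord[OF v]
  show ?thesis
  proof (rule free_eqI[OF v])
    show "lincomb (free_mod R n) n (basis_vec R n) v \<in> carrier (free_mod R n)"
      by (rule F.lincomb_closed) (auto simp: cv)
    fix i assume i: "i < n"
    have "lincomb (free_mod R n) n (basis_vec R n) v i = lincomb (self_module R) n (\<lambda>j. basis_vec R n j i) v"
      by (rule F.lincomb_hom[OF module_self coord_mod_hom[OF i]]) (auto simp: cv)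
    also have "\<dots> = (\<Oplus>\<^bsub>self_module R\<^esub>j\<in>{..<n}. if i = j then v j else \<zero>\<^bsub>self_module R\<^esub>)"
      unfolding lincomb_def by (rule S.finsum_cong') (auto simp: cv basis_vec_def i)
    also have "\<dots> = v i" by (rule S.M.finsum_singleton) (use i cv in auto)
    finally show "v i = lincomb (free_mod R n) n (basis_vec R n) v i" by simp
  qed
qed

lemma hom_from_free:
  assumes f: "f \<in> mod_hom R (free_mod R n) M" and v: "v \<in> carrier (free_mod R n)"
  shows "f v = lincomb M n (\<lambda>j. f (basis_vec R n j)) v"
proof -
  interpret F: module R "free_mod R n" by (rule module_free_mod)
  have "f v = f (lincomb (free_mod R n) n (basis_vec R n) v)" using free_expand[OF v] by simp
  also have "\<dots> = lincomb M n (\<lambda>j. f (basis_vec R n j)) v"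
    by (rule F.lincomb_hom[OF module_axioms f]) (auto simp: free_coord[OF v])
  finally show ?thesis .
qed

lemma module_span_lincomb:
  assumes b: "\<And>j. j < n \<Longrightarrow> b j \<in> carrier M"
  shows "module_span R M (b ` {..<n}) = lincomb M n b ` carrier (free_mod R n)"
proof
  interpret F: module R "free_mod R n" by (rule module_free_mod)
  show "module_span R M (b ` {..<n}) \<subseteq> lincomb M n b ` carrier (free_mod R n)"
  proof (rule module_span_minimal)
    show "submodule (lincomb M n b ` carrier (free_mod R n)) R M"
      by (rule submodule_image[OF F.module_axioms module_axioms lincomb_mod_hom[OF b] F.carrier_is_submodule])
    show "b ` {..<n} \<subseteq> lincomb M n b ` carrier (free_mod R n)"
    proof
      fix y assume "y \<in> b ` {..<n}"
      then obtain i where i: "i < n" "y = b i" by auto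
      show "y \<in> lincomb M n b ` carrier (free_mod R n)"
        by (rule image_eqI[of _ _ "basis_vec R n i"]) (simp_all add: lincomb_basis_vec[OF b i(1)] i(2))
    qed
  qed
  have sub: "submodule (module_span R M (b ` {..<n})) R M"
    by (rule module_span_submodule) (use b in auto)
  show "lincomb M n b ` carrier (free_mod R n) \<subseteq> module_span R M (b ` {..<n})"
  proof
    fix y assume "y \<in> lincomb M n b ` carrier (free_mod R n)"
    then obtain v where v: "v \<in> carrier (free_mod R n)" "y = lincomb M n b v" by auto
    show "y \<in> module_span R M (b ` {..<n})" unfolding v(2)
    proof (rule lincomb_in_submodule[OF sub])
      fix j assume j: "j < n"
      have "b j \<in> module_span R M (b ` {..<n})" by (rule subsetD[OF module_span_superset]) (use j in simp)
      then show "v j \<odot>\<^bsub>M\<^esub> b j \<in> module_span R M (b ` {..<n})"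
        by (rule submodule_smult[OF sub free_coord[OF v(1) j]])
    qed
  qed
qed

lemma fin_gen_lincomb:
  assumes "fin_gen R M"
  shows "\<exists>n b. (\<forall>j<n. b j \<in> carrier M) \<and> lincomb M n b ` carrier (free_mod R n) = carrier M"
proof -
  obtain A where A: "finite A" "A \<subseteq> carrier M" "module_span R M A = carrier M"
    using assms by (auto simp: fin_gen_def)
  obtain n and b :: "nat \<Rightarrow> 'c" where nb: "A = b ` {i. i < n}"
    using finite_imp_nat_seg_image_inj_on[OF A(1)] by auto
  then have A': "A = b ` {..<n}" by auto
  have b: "b j \<in> carrier M" if "j < n" for j using that A(2) A' by auto
  show ?thesis using b module_span_lincomb[OF b] A(3) A' by (intro exI[of _ n] exI[of _ b]) simp
qed

end

section \<open>Ascending chain condition\<close>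

text \<open>The ascending chain condition for submodules spanned by elements of \<open>H\<close>, phrased with sequences. In this form
it passes to extensions, images and powers without any quotient module being formed.\<close>

definition acc_on :: "('a, 'k) ring_scheme \<Rightarrow> ('a, 'm, 'l) module_scheme \<Rightarrow> 'm set \<Rightarrow> bool" where
  "acc_on R M H \<longleftrightarrow> (\<forall>y. (\<forall>k::nat. y k \<in> H) \<longrightarrow> (\<exists>K. \<forall>k. y k \<in> module_span R M (y ` {..<K})))"

lemma acc_onD:
  "\<lbrakk>acc_on R M H; \<And>k::nat. y k \<in> H\<rbrakk> \<Longrightarrow> \<exists>K. \<forall>k. y k \<in> module_span R M (y ` {..<K})"
  unfolding acc_on_def by simp

lemma acc_on_subset: "\<lbrakk>acc_on R M H; H' \<subseteq> H\<rbrakk> \<Longrightarrow> acc_on R M H'"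
  unfolding acc_on_def by (metis subsetD)

lemma (in module) acc_on_zero: "acc_on R M {\<zero>\<^bsub>M\<^esub>}"
proof -
  have sub: "submodule (module_span R M {}) R M" by (rule module_span_submodule) simp
  show ?thesis unfolding acc_on_def
    by (intro allI impI exI[of _ 0]) (use submodule_zero[OF sub] in simp)
qed

text \<open>Subtract from each term a combination of finitely many terms with the same image; the differences lie in the
kernel.\<close>

lemma acc_on_extension:
  assumes M: "module R M" and N: "module R N" and f: "f \<in> mod_hom R M N" and H: "submodule H R M"
    and im: "acc_on R N (f ` H)" and ker: "acc_on R M {x \<in> H. f x = \<zero>\<^bsub>N\<^esub>}"
  shows "acc_on R M H"
  unfolding acc_on_def
proof (intro allI impI)
  interpret M: module R M by fact
  interpret N: module R N by fact
  fix y :: "nat \<Rightarrow> _" assume "\<forall>k. y k \<in> H"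
  then have yH: "y k \<in> H" for k by simp
  have yM: "y k \<in> carrier M" for k using M.submodule_carrier[OF H yH] .
  have ysub: "y ` {..<K} \<subseteq> carrier M" for K using yM by auto
  note span = M.module_span_submodule[OF ysub]
  have "\<exists>K1. \<forall>k. f (y k) \<in> module_span R N ((\<lambda>k. f (y k)) ` {..<K1})"
    by (rule acc_onD[OF im]) (use yH in auto)
  then obtain K1 where "\<forall>k. f (y k) \<in> module_span R N ((\<lambda>k. f (y k)) ` {..<K1})" by (rule exE)
  then have "f (y k) \<in> f ` module_span R M (y ` {..<K1})" for k
    using module_span_image_subset[OF M N f ysub, of K1] by (simp add: image_image)
  then have "\<exists>u. u \<in> module_span R M (y ` {..<K1}) \<and> f (y k) = f u" for k by (metis imageE)
  then obtain u where u: "\<And>k. u k \<in> module_span R M (y ` {..<K1})" "\<And>k. f (y k) = f (u k)" by metis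
  have uM: "u k \<in> carrier M" for k using M.submodule_carrier[OF span u(1)] .
  have "module_span R M (y ` {..<K1}) \<subseteq> H"
    by (rule M.module_span_minimal[OF H]) (use yH in auto)
  then have uH: "u k \<in> H" for k using u(1) by auto
  define z where "z k = y k \<ominus>\<^bsub>M\<^esub> u k" for k
  have zk: "z k \<in> {x \<in> H. f x = \<zero>\<^bsub>N\<^esub>}" for k
    unfolding z_def using M.submodule_minus[OF H yH uH] mod_hom_minus[OF M N f yM uM]
      N.minus_eq_zero_iff mod_hom_closed[OF f] yM uM u(2) by simp
  obtain K2 where K2: "\<forall>k. z k \<in> module_span R M (z ` {..<K2})"
    using acc_onD[of R M _ z, OF ker zk] by (rule exE)
  define K where "K = max K1 K2"
  have uS: "u k \<in> module_span R M (y ` {..<K})" for k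
    by (rule subsetD[OF M.module_span_mono[OF image_mono] u(1)]) (simp add: K_def)
  have "z ` {..<K2} \<subseteq> module_span R M (y ` {..<K})"
  proof
    fix x assume "x \<in> z ` {..<K2}"
    then obtain l where l: "l < K2" "x = y l \<ominus>\<^bsub>M\<^esub> u l" by (auto simp: z_def)
    have "y l \<in> module_span R M (y ` {..<K})"
      by (rule subsetD[OF M.module_span_superset]) (use l in \<open>auto simp: K_def\<close>)
    then show "x \<in> module_span R M (y ` {..<K})" unfolding l(2) by (rule M.submodule_minus[OF span _ uS])
  qed
  from M.module_span_minimal[OF span this] K2
  have zS: "z k \<in> module_span R M (y ` {..<K})" for k by auto
  have "y k \<in> module_span R M (y ` {..<K})" for k
    by (rule M.submodule_minus_cancel[OF span uS _ yM]) (use zS in \<open>simp add: z_def\<close>)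
  then show "\<exists>K. \<forall>k. y k \<in> module_span R M (y ` {..<K})" by (intro exI allI)
qed

lemma acc_on_injective:
  assumes M: "module R M" and N: "module R N" and f: "f \<in> mod_hom R M N" "acc_on R N (carrier N)"
    and inj: "\<And>x. \<lbrakk>x \<in> carrier M; f x = \<zero>\<^bsub>N\<^esub>\<rbrakk> \<Longrightarrow> x = \<zero>\<^bsub>M\<^esub>"
  shows "acc_on R M (carrier M)"
proof (rule acc_on_extension[OF M N f(1) module.carrier_is_submodule[OF M]])
  show "acc_on R N (f ` carrier M)"
    by (rule acc_on_subset[OF f(2)]) (use mod_hom_closed[OF f(1)] in auto)
  show "acc_on R M {x \<in> carrier M. f x = \<zero>\<^bsub>N\<^esub>}"
    by (rule acc_on_subset[OF module.acc_on_zero[OF M]]) (use inj in auto)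
qed

lemma acc_on_surjective:
  assumes M: "module R M" and N: "module R N" and f: "f \<in> mod_hom R M N" "f ` carrier M = carrier N"
    and acc: "acc_on R M (carrier M)"
  shows "acc_on R N (carrier N)"
  unfolding acc_on_def
proof (intro allI impI)
  interpret M: module R M by fact
  fix y :: "nat \<Rightarrow> _" assume "\<forall>k. y k \<in> carrier N"
  then have "\<exists>z. z \<in> carrier M \<and> y k = f z" for k using f(2) by (metis imageE)
  then obtain z where z: "\<And>k. z k \<in> carrier M" "\<And>k. y k = f (z k)" by metis
  obtain K where K: "\<forall>k. z k \<in> module_span R M (z ` {..<K})"
    using acc_onD[of R M _ z, OF acc z(1)] by (rule exE)
  have "module_span R N (f ` z ` {..<K}) = f ` module_span R M (z ` {..<K})"
    by (rule module_span_image_subset[OF M N f(1)]) (use z(1) in auto)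
  moreover have "f ` z ` {..<K} = y ` {..<K}" by (auto simp: z(2))
  ultimately have "y k \<in> module_span R N (y ` {..<K})" for k using spec[OF K, of k] z(2)[of k] by auto
  then show "\<exists>K. \<forall>k. y k \<in> module_span R N (y ` {..<K})" by (intro exI allI)
qed

text \<open>Extend by one coordinate at a time: \<open>H J\<close> consists of the functions supported in \<open>J\<close>, and evaluation at a
new point has a kernel supported in \<open>J\<close>.\<close>

lemma acc_fun_mod:
  assumes M: "module R M" and acc: "acc_on R M (carrier M)" and I: "finite I"
  shows "acc_on R (fun_mod I M) (carrier (fun_mod I M))"
proof -
  interpret M: module R M by fact
  interpret F: module R "fun_mod I M" by (rule module_fun_mod[OF M])
  define H where "H J = {x \<in> carrier (fun_mod I M). \<forall>i\<in>I - J. x i = \<zero>\<^bsub>M\<^esub>}" for J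
  have Hsub: "submodule (H J) R (fun_mod I M)" for J
  proof (rule F.submoduleI')
    show "x \<oplus>\<^bsub>fun_mod I M\<^esub> y \<in> H J" if "x \<in> H J" "y \<in> H J" for x y
      using that F.add.m_closed[of x y] by (auto simp: H_def)
    show "a \<odot>\<^bsub>fun_mod I M\<^esub> x \<in> H J" if "a \<in> carrier R" "x \<in> H J" for a x
      using that F.smult_closed[of a x] by (auto simp: H_def)
  qed (auto simp: H_def)
  have "acc_on R (fun_mod I M) (H J)" if "J \<subseteq> I" for J
    using finite_subset[OF that I] that
  proof (induction J rule: finite_induct)
    case empty
    have "H {} \<subseteq> {\<zero>\<^bsub>fun_mod I M\<^esub>}"
    proof
      fix x assume "x \<in> H {}"
      then have "x \<in> I \<rightarrow>\<^sub>E carrier M" "\<forall>i\<in>I. x i = \<zero>\<^bsub>M\<^esub>" by (auto simp: H_def)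
      then have "x = (\<lambda>i\<in>I. \<zero>\<^bsub>M\<^esub>)" by (auto intro!: PiE_ext[of x I "\<lambda>_. carrier M"])
      then show "x \<in> {\<zero>\<^bsub>fun_mod I M\<^esub>}" by simp
    qed
    then show ?case by (rule acc_on_subset[OF F.acc_on_zero])
  next
    case (insert j J)
    have j: "j \<in> I" and J: "J \<subseteq> I" using insert.prems by auto
    show ?case
    proof (rule acc_on_extension[OF F.module_axioms M eval_mod_hom[OF j] Hsub])
      show "acc_on R M ((\<lambda>x. x j) ` H (insert j J))"
        by (rule acc_on_subset[OF acc]) (use j in \<open>auto simp: H_def\<close>)
      show "acc_on R (fun_mod I M) {x \<in> H (insert j J). x j = \<zero>\<^bsub>M\<^esub>}"
        by (rule acc_on_subset[OF insert.IH[OF J]]) (auto simp: H_def)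
    qed
  qed
  from this[of I] show ?thesis by (simp add: H_def)
qed

lemma (in noetherian_cring) acc_self: "acc_on R (self_module R) (carrier R)"
  unfolding acc_on_def
proof (intro allI impI)
  interpret S: module R "self_module R" by (rule module_self)
  fix y :: "nat \<Rightarrow> _" assume "\<forall>k. y k \<in> carrier R"
  then have y: "y ` {..<n} \<subseteq> carrier (self_module R)" for n by auto
  define I where "I n = module_span R (self_module R) (y ` {..<n})" for n
  have sub: "submodule (I n) R (self_module R)" for n
    unfolding I_def by (rule S.module_span_submodule[OF y])
  have id: "ideal (I n) R" for n
  proof (rule cring_idealI)
    show "I n \<subseteq> carrier R" using S.submodule_carrier[OF sub, of _ n] by auto
  qed (use S.submodule_zero[OF sub] S.submodule_add[OF sub] S.submodule_smult[OF sub] in auto)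
  obtain J where J: "\<exists>n. J = I n" "\<And>J'. \<exists>n. J' = I n \<Longrightarrow> J \<subseteq> J' \<Longrightarrow> J' = J"
  proof (rule ex_maximal_ideal_with[of "\<lambda>J. \<exists>n. J = I n" "I 0"])
    show "ideal J R" if "\<exists>n. J = I n" for J using that id by (elim exE) simp
  qed blast+
  from J(1) obtain K where JK: "J = I K" by (elim exE)
  have "y k \<in> I K" for k
  proof -
    have "I K \<subseteq> I (max K (Suc k))" unfolding I_def by (rule S.module_span_mono) auto
    then have "I (max K (Suc k)) = I K" using J(2)[of "I (max K (Suc k))"] unfolding JK by (simp add: exI[of _ "max K (Suc k)"])
    moreover have "y k \<in> I (max K (Suc k))"
      unfolding I_def by (rule subsetD[OF S.module_span_superset]) auto
    ultimately show ?thesis by simp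
  qed
  then show "\<exists>K. \<forall>k. y k \<in> module_span R (self_module R) (y ` {..<K})" unfolding I_def by (intro exI allI)
qed

lemma (in noetherian_cring) acc_free: "acc_on R (free_mod R n) (carrier (free_mod R n))"
  unfolding free_mod_eq by (rule acc_fun_mod[OF module_self]) (simp_all add: acc_self)

lemma acc_fin_gen:
  assumes "noetherian_cring R" "module R M" "fin_gen R M"
  shows "acc_on R M (carrier M)"
proof -
  interpret R: noetherian_cring R by fact
  interpret M: module R M by fact
  obtain n b where b': "\<forall>j<n. b j \<in> carrier M" and b2: "lincomb M n b ` carrier (free_mod R n) = carrier M"
    using M.fin_gen_lincomb[OF assms(3)] by (elim exE conjE)
  have b: "b j \<in> carrier M" if "j < n" for j using b' that by simp
  show ?thesis
    by (rule acc_on_surjective[OF R.module_free_mod assms(2) M.lincomb_mod_hom[OF b] b2 R.acc_free])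
qed

lemma acc_Hom_mod:
  assumes M: "module R M" and N: "module R N" and A: "finite A" "A \<subseteq> carrier M" "module_span R M A = carrier M"
    and acc: "acc_on R N (carrier N)"
  shows "acc_on R (Hom_mod R M N) (carrier (Hom_mod R M N))"
proof (rule acc_on_injective)
  interpret M: module R M by fact
  interpret N: module R N by fact
  interpret V: module R "Hom_mod R M N" by (rule module_Hom_mod[OF M N])
  show "module R (Hom_mod R M N)" by (rule V.module_axioms)
  show "module R (fun_mod A N)" by (rule module_fun_mod[OF N])
  show "acc_on R (fun_mod A N) (carrier (fun_mod A N))" by (rule acc_fun_mod[OF N acc A(1)])
  show "(\<lambda>f. \<lambda>x\<in>A. f x) \<in> mod_hom R (Hom_mod R M N) (fun_mod A N)"
  proof (rule mod_hom_into_fun)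
    fix x assume "x \<in> A"
    then show "(\<lambda>f. f x) \<in> mod_hom R (Hom_mod R M N) N"
      using A(2) by (intro mod_homI) (auto dest: mod_hom_closed)
  qed
  fix f assume "f \<in> carrier (Hom_mod R M N)" and f0: "(\<lambda>x\<in>A. f x) = \<zero>\<^bsub>fun_mod A N\<^esub>"
  then have f: "f \<in> mod_hom R M N" "f \<in> extensional (carrier M)" by auto
  have "f x = \<zero>\<^bsub>N\<^esub>" if "x \<in> A" for x using fun_cong[OF f0, of x] that by simp
  then have "A \<subseteq> {x \<in> carrier M. f x = \<zero>\<^bsub>N\<^esub>}" using A(2) by auto
  from M.module_span_minimal[OF submodule_kernel[OF M N f(1)] this]
  have "f x = \<zero>\<^bsub>N\<^esub>" if "x \<in> carrier M" for x using A(3) that by auto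
  then show "f = \<zero>\<^bsub>Hom_mod R M N\<^esub>"
    unfolding Hom_mod_simps by (intro extensionalityI[OF f(2)]) simp_all
qed

lemma acc_finite_span:
  assumes acc: "acc_on R M H" and V: "V \<subseteq> H"
  shows "\<exists>Y. finite Y \<and> Y \<subseteq> V \<and> V \<subseteq> module_span R M Y"
proof (rule ccontr)
  assume no: "\<not> ?thesis"
  have "\<exists>x. x \<in> V \<and> x \<notin> module_span R M Y" if "finite Y" "Y \<subseteq> V" for Y
    using no that by blast
  then obtain g where g: "\<And>Y. \<lbrakk>finite Y; Y \<subseteq> V\<rbrakk> \<Longrightarrow> g Y \<in> V \<and> g Y \<notin> module_span R M Y" by metis
  define Z where "Z = rec_nat {} (\<lambda>_ Y. insert (g Y) Y)"
  have Zs: "Z 0 = {}" "Z (Suc k) = insert (g (Z k)) (Z k)" for k by (simp_all add: Z_def)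
  have fin: "finite (Z k) \<and> Z k \<subseteq> V" for k by (induction k) (use g Zs in auto)
  define y where "y k = g (Z k)" for k
  have Zy: "Z k = y ` {..<k}" for k
    by (induction k) (simp_all add: Zs y_def lessThan_Suc)
  have yH: "y k \<in> H" for k using g[of "Z k"] fin[of k] V by (auto simp: y_def)
  obtain K where "\<forall>k. y k \<in> module_span R M (y ` {..<K})"
    using acc_onD[of R M _ y, OF acc yH] by (rule exE)
  then have "y K \<in> module_span R M (Z K)" by (simp add: Zy)
  then show False using g[of "Z K"] fin[of K] by (simp add: y_def)
qed

section \<open>An integrality argument\<close>

lemma lincomb_of_homs:
  assumes M: "module R M" and N: "module R N" and g: "\<And>k. k < K \<Longrightarrow> g k \<in> mod_hom R M N"
    and d: "\<And>k. k < K \<Longrightarrow> d k \<in> carrier R"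
  shows "(\<lambda>x. lincomb N K (\<lambda>k. g k x) d) \<in> mod_hom R M N"
proof (rule mod_homI)
  interpret M: module R M by fact
  interpret N: module R N by fact
  note gc = mod_hom_closed[OF g]
  fix x y assume x: "x \<in> carrier M"
  show "lincomb N K (\<lambda>k. g k x) d \<in> carrier N" by (rule N.lincomb_closed) (use gc d x in auto)
  {
    assume y: "y \<in> carrier M"
    have "lincomb N K (\<lambda>k. g k (x \<oplus>\<^bsub>M\<^esub> y)) d
        = (\<Oplus>\<^bsub>N\<^esub>k\<in>{..<K}. d k \<odot>\<^bsub>N\<^esub> g k x \<oplus>\<^bsub>N\<^esub> d k \<odot>\<^bsub>N\<^esub> g k y)"
      unfolding lincomb_def
      by (rule N.finsum_cong') (auto simp: d gc x y mod_hom_add[OF g] N.smult_r_distr)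
    also have "\<dots> = lincomb N K (\<lambda>k. g k x) d \<oplus>\<^bsub>N\<^esub> lincomb N K (\<lambda>k. g k y) d"
      unfolding lincomb_def by (rule N.finsum_addf) (auto simp: d gc x y)
    finally show "lincomb N K (\<lambda>k. g k (x \<oplus>\<^bsub>M\<^esub> y)) d
      = lincomb N K (\<lambda>k. g k x) d \<oplus>\<^bsub>N\<^esub> lincomb N K (\<lambda>k. g k y) d" .
  }
  fix a assume a: "a \<in> carrier R"
  have "a \<odot>\<^bsub>N\<^esub> lincomb N K (\<lambda>k. g k x) d = (\<Oplus>\<^bsub>N\<^esub>k\<in>{..<K}. a \<odot>\<^bsub>N\<^esub> (d k \<odot>\<^bsub>N\<^esub> g k x))"
    unfolding lincomb_def by (rule N.finsum_smult_ldistr) (auto simp: a d gc x)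
  also have "\<dots> = lincomb N K (\<lambda>k. g k (a \<odot>\<^bsub>M\<^esub> x)) d"
    unfolding lincomb_def
    by (rule N.finsum_cong')
      (auto simp: d gc x a mod_hom_smult[OF g] N.smult_assoc1[symmetric] M.m_comm)
  finally show "lincomb N K (\<lambda>k. g k (a \<odot>\<^bsub>M\<^esub> x)) d = a \<odot>\<^bsub>N\<^esub> lincomb N K (\<lambda>k. g k x) d" by simp
qed

text \<open>A Cayley--Hamilton relation for \<open>h = a \<cdot> s\<close>: dividing by \<open>a\<close> repeatedly, \<open>h\<^sup>k f = a\<^sup>k s\<^sup>k f\<close>. By the ascending chain
condition for families indexed by a finite generating set \<open>Y\<close>, one power \<open>s\<^sup>K\<close> is on \<open>Y\<close> a combination of
the lower ones with coefficients \<open>c k\<close>; multiply by \<open>a\<^sup>K\<close>. The map \<open>s\<close> is a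
choice of quotients; linearity enters through \<open>h\<close>.\<close>

lemma integral_relation:
  assumes V: "module R V" and acc: "acc_on R V (carrier V)" and h: "h \<in> mod_hom R V V"
    and a: "a \<in> carrier R"
    and div: "\<And>f. f \<in> carrier V \<Longrightarrow> \<exists>g\<in>carrier V. h f = a \<odot>\<^bsub>V\<^esub> g"
  shows "\<exists>K c. (\<forall>k<K. c k \<in> carrier R) \<and> (\<forall>f\<in>carrier V. (h ^^ K) f =
      lincomb V K (\<lambda>k. (h ^^ k) f) (\<lambda>k. c k \<otimes>\<^bsub>R\<^esub> a [^]\<^bsub>R\<^esub> (K - k)))"
proof -
  interpret V: module R V by fact
  obtain Y where Y: "finite Y" "Y \<subseteq> carrier V" "carrier V \<subseteq> module_span R V Y"
    using acc_finite_span[OF acc order_refl] by (elim exE conjE)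
  obtain s where s: "\<And>f. f \<in> carrier V \<Longrightarrow> s f \<in> carrier V" "\<And>f. f \<in> carrier V \<Longrightarrow> h f = a \<odot>\<^bsub>V\<^esub> s f"
    using div by metis
  have sk: "(s ^^ k) f \<in> carrier V" if "f \<in> carrier V" for f k
    using that by (induction k) (auto simp: s(1))
  have hk: "(h ^^ k) f = (a [^]\<^bsub>R\<^esub> k) \<odot>\<^bsub>V\<^esub> (s ^^ k) f" if f: "f \<in> carrier V" for f k
  proof (induction k)
    case (Suc k)
    have "(h ^^ Suc k) f = (a [^]\<^bsub>R\<^esub> k) \<odot>\<^bsub>V\<^esub> h ((s ^^ k) f)"
      using Suc mod_hom_smult[OF h V.nat_pow_closed[OF a] sk[OF f]] by simp
    also have "\<dots> = (a [^]\<^bsub>R\<^esub> Suc k) \<odot>\<^bsub>V\<^esub> (s ^^ Suc k) f"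
      using s(2)[OF sk[OF f]] s(1)[OF sk[OF f]] a by (simp add: V.smult_assoc1)
    finally show ?case .
  qed (use f in simp)
  interpret T: module R "fun_mod Y V" by (rule module_fun_mod[OF V])
  define y where "y k = (\<lambda>f\<in>Y. (s ^^ k) f)" for k
  have yT: "y k \<in> carrier (fun_mod Y V)" for k using Y(2) sk by (auto simp: y_def)
  obtain K where K: "\<forall>k. y k \<in> module_span R (fun_mod Y V) (y ` {..<K})"
    using acc_onD[of R _ _ y, OF acc_fun_mod[OF V acc Y(1)] yT] by (rule exE)
  have "y K \<in> lincomb (fun_mod Y V) K y ` carrier (free_mod R K)"
    using spec[OF K, of K] T.module_span_lincomb[of K y, OF yT] by simp
  then obtain c where c: "c \<in> carrier (free_mod R K)" "y K = lincomb (fun_mod Y V) K y c" by (rule imageE)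
  note cc = free_coord[OF c(1)]
  let ?d = "\<lambda>k. c k \<otimes>\<^bsub>R\<^esub> a [^]\<^bsub>R\<^esub> (K - k)"
  let ?r = "\<lambda>f. lincomb V K (\<lambda>k. (h ^^ k) f) ?d"
  have hom: "?r \<in> mod_hom R V V"
    by (rule lincomb_of_homs[OF V V mod_hom_funpow[OF h]]) (use cc a in auto)
  have "Y \<subseteq> {f \<in> carrier V. (h ^^ K) f = ?r f}"
  proof
    fix f assume fY: "f \<in> Y"
    then have f: "f \<in> carrier V" using Y(2) by auto
    have "(s ^^ K) f = lincomb (fun_mod Y V) K y c f" using fun_cong[OF c(2), of f] fY by (simp add: y_def)
    also have "\<dots> = lincomb V K (\<lambda>k. y k f) c"
      by (rule T.lincomb_hom[OF V eval_mod_hom[OF fY]]) (use yT cc in auto)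
    also have "\<dots> = lincomb V K (\<lambda>k. (s ^^ k) f) c"
      by (rule V.lincomb_cong) (use fY sk[OF f] cc in \<open>auto simp: y_def\<close>)
    finally have "(h ^^ K) f = (a [^]\<^bsub>R\<^esub> K) \<odot>\<^bsub>V\<^esub> lincomb V K (\<lambda>k. (s ^^ k) f) c"
      using hk[OF f] by simp
    also have "\<dots> = (\<Oplus>\<^bsub>V\<^esub>k\<in>{..<K}. (a [^]\<^bsub>R\<^esub> K) \<odot>\<^bsub>V\<^esub> (c k \<odot>\<^bsub>V\<^esub> (s ^^ k) f))"
      unfolding lincomb_def by (rule V.finsum_smult_ldistr) (use a cc sk[OF f] in auto)
    also have "\<dots> = ?r f"
      unfolding lincomb_def
    proof (rule V.finsum_cong')
      fix k assume "k \<in> {..<K}"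
      then have k: "k < K" by simp
      have pw: "a [^]\<^bsub>R\<^esub> K = a [^]\<^bsub>R\<^esub> (K - k) \<otimes>\<^bsub>R\<^esub> a [^]\<^bsub>R\<^esub> k"
        using k a by (simp add: V.nat_pow_mult)
      have "a [^]\<^bsub>R\<^esub> K \<otimes>\<^bsub>R\<^esub> c k = ?d k \<otimes>\<^bsub>R\<^esub> a [^]\<^bsub>R\<^esub> k"
        unfolding pw using a cc[OF k] by (simp add: V.m_ac)
      then show "(a [^]\<^bsub>R\<^esub> K) \<odot>\<^bsub>V\<^esub> (c k \<odot>\<^bsub>V\<^esub> (s ^^ k) f) = ?d k \<odot>\<^bsub>V\<^esub> (h ^^ k) f"
        using a cc[OF k] sk[OF f] hk[OF f, of k] by (simp add: V.smult_assoc1[symmetric])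
    qed (use a cc hk[OF f] sk[OF f] in auto)
    finally show "f \<in> {f \<in> carrier V. (h ^^ K) f = ?r f}" using f by simp
  qed
  from V.module_span_minimal[OF submodule_equalizer[OF V V mod_hom_funpow[OF h] hom] this] Y(3)
  have "(h ^^ K) f = ?r f" if "f \<in> carrier V" for f using that by auto
  then show ?thesis using cc by (intro exI[of _ K] exI[of _ c]) simp
qed

text \<open>The polynomial \<open>t\<^sup>K - \<Sum> c\<^sub>k a\<^bsup>K-k\<^esup> t\<^sup>k\<close> evaluated at the endomorphism \<open>h\<close>.\<close>

definition poly_op ::
  "('a, 'k) ring_scheme \<Rightarrow> ('a, 'm, 'l) module_scheme \<Rightarrow> ('m \<Rightarrow> 'm) \<Rightarrow> nat \<Rightarrow> (nat \<Rightarrow> 'a) \<Rightarrow> 'a \<Rightarrow> 'm \<Rightarrow> 'm" where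
  "poly_op R M h K c a x = (h ^^ K) x \<ominus>\<^bsub>M\<^esub>
     lincomb M K (\<lambda>k. (h ^^ k) x) (\<lambda>k. c k \<otimes>\<^bsub>R\<^esub> a [^]\<^bsub>R\<^esub> (K - k))"

context module
begin

lemma poly_op_mod_hom:
  assumes h: "h \<in> mod_hom R M M" and c: "\<And>k. k < K \<Longrightarrow> c k \<in> carrier R" and a: "a \<in> carrier R"
  shows "poly_op R M h K c a \<in> mod_hom R M M"
proof -
  let ?r = "\<lambda>x. lincomb M K (\<lambda>k. (h ^^ k) x) (\<lambda>k. c k \<otimes> a [^] (K - k))"
  have r: "?r \<in> mod_hom R M M"
    by (rule lincomb_of_homs[OF module_axioms module_axioms mod_hom_funpow[OF h]]) (use a c in auto)
  note H = mod_homD[OF mod_hom_funpow[OF h, of K]] and R = mod_homD[OF r]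
  show ?thesis
  proof (rule mod_homI)
    fix x assume x: "x \<in> carrier M"
    show "poly_op R M h K c a x \<in> carrier M" unfolding poly_op_def using H(1)[OF x] R(1)[OF x] by simp
    show "poly_op R M h K c a (x \<oplus>\<^bsub>M\<^esub> y) = poly_op R M h K c a x \<oplus>\<^bsub>M\<^esub> poly_op R M h K c a y"
      if y: "y \<in> carrier M" for y
      unfolding poly_op_def H(2)[OF x y] R(2)[OF x y]
      using H(1)[OF x] R(1)[OF x] H(1)[OF y] R(1)[OF y]
      by (simp add: a_minus_def M.minus_add M.a_ac)
    show "poly_op R M h K c a (b \<odot>\<^bsub>M\<^esub> x) = b \<odot>\<^bsub>M\<^esub> poly_op R M h K c a x" if b: "b \<in> carrier R" for b
      unfolding poly_op_def H(3)[OF b x] R(3)[OF b x]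
      using H(1)[OF x] R(1)[OF x] b by (simp add: a_minus_def smult_r_distr smult_r_minus)
  qed
qed

lemma funpow_fixes:
  assumes h: "h \<in> mod_hom R M M" and D: "submodule D R M"
    and hD: "\<And>y. y \<in> D \<Longrightarrow> h y \<in> D" and x: "x \<in> carrier M" "h x \<ominus>\<^bsub>M\<^esub> x \<in> D"
  shows "(h ^^ k) x \<ominus>\<^bsub>M\<^esub> x \<in> D"
proof -
  note hc = mod_hom_closed[OF mod_hom_funpow[OF h]]
  show ?thesis
  proof (induction k)
    case 0
    then show ?case using x(1) submodule_zero[OF D] by (simp add: a_minus_def M.r_neg)
  next
    case (Suc k)
    have "h ((h ^^ k) x \<ominus>\<^bsub>M\<^esub> x) = (h ^^ Suc k) x \<ominus>\<^bsub>M\<^esub> h x"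
      using mod_hom_minus[OF module_axioms module_axioms h hc[OF x(1)] x(1)] by simp
    then have 1: "(h ^^ Suc k) x \<ominus>\<^bsub>M\<^esub> h x \<in> D" using hD[OF Suc] by simp
    have "((h ^^ Suc k) x \<ominus>\<^bsub>M\<^esub> h x) \<oplus>\<^bsub>M\<^esub> (h x \<ominus>\<^bsub>M\<^esub> x) \<in> D" by (rule submodule_add[OF D 1 x(2)])
    moreover have "((h ^^ Suc k) x \<ominus>\<^bsub>M\<^esub> h x) \<oplus>\<^bsub>M\<^esub> (h x \<ominus>\<^bsub>M\<^esub> x) = (h ^^ Suc k) x \<ominus>\<^bsub>M\<^esub> x"
      using hc[OF x(1), of "Suc k"] mod_hom_closed[OF h x(1)] x(1)
      by (simp add: a_minus_def M.a_assoc M.r_neg1 M.r_neg2)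
    ultimately show ?case by simp
  qed
qed

text \<open>Modulo a stable submodule containing \<open>aM\<close> only the leading term survives, so a vector fixed
  by \<open>h\<close> is fixed by the polynomial.\<close>

lemma poly_op_fixes:
  assumes h: "h \<in> mod_hom R M M" and c: "\<And>k. k < K \<Longrightarrow> c k \<in> carrier R" and a: "a \<in> carrier R"
    and D: "submodule D R M" and aD: "\<And>y. y \<in> carrier M \<Longrightarrow> a \<odot>\<^bsub>M\<^esub> y \<in> D"
    and hD: "\<And>y. y \<in> D \<Longrightarrow> h y \<in> D" and x: "x \<in> carrier M" "h x \<ominus>\<^bsub>M\<^esub> x \<in> D"
  shows "poly_op R M h K c a x \<ominus>\<^bsub>M\<^esub> x \<in> D"
proof -
  note hc = mod_hom_closed[OF mod_hom_funpow[OF h]]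
  have hk: "(h ^^ k) x \<ominus>\<^bsub>M\<^esub> x \<in> D" for k by (rule funpow_fixes[OF h D hD x])
  let ?l = "lincomb M K (\<lambda>k. (h ^^ k) x) (\<lambda>k. c k \<otimes> a [^] (K - k))"
  have "?l \<in> D"
  proof (rule lincomb_in_submodule[OF D])
    fix k assume k: "k < K"
    then obtain j where j: "K - k = Suc j" by (metis Suc_diff_Suc)
    have "(c k \<otimes> a [^] (K - k)) \<odot>\<^bsub>M\<^esub> (h ^^ k) x = (c k \<otimes> a [^] j) \<odot>\<^bsub>M\<^esub> (a \<odot>\<^bsub>M\<^esub> (h ^^ k) x)"
      unfolding j using a c[OF k] hc[OF x(1)] by (simp add: smult_assoc1)
    then show "(c k \<otimes> a [^] (K - k)) \<odot>\<^bsub>M\<^esub> (h ^^ k) x \<in> D"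
      using submodule_smult[OF D, of "c k \<otimes> a [^] j"] aD[OF hc[OF x(1)]] a c[OF k] by simp
  qed
  then have "((h ^^ K) x \<ominus>\<^bsub>M\<^esub> x) \<ominus>\<^bsub>M\<^esub> ?l \<in> D" by (rule submodule_minus[OF D hk])
  moreover have "?l \<in> carrier M" by (rule submodule_carrier[OF D]) fact
  ultimately show ?thesis unfolding poly_op_def using hc[OF x(1), of K] x(1)
    by (simp add: a_minus_def M.a_ac)
qed

end

text \<open>The relation of \<open>integral_relation\<close> for the action of \<open>h\<close> on a module of homomorphisms, by composition
on the left here and on the right in the next lemma, evaluated at an element.\<close>

lemma poly_op_kills_postcompose:
  assumes M: "module R M" and N: "module R N" and acc: "acc_on R (Hom_mod R M N) (carrier (Hom_mod R M N))"
    and h: "h \<in> mod_hom R N N" and a: "a \<in> carrier R"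
    and div: "\<And>f. f \<in> mod_hom R M N \<inter> extensional (carrier M) \<Longrightarrow>
      \<exists>g\<in>mod_hom R M N \<inter> extensional (carrier M). \<forall>x\<in>carrier M. h (f x) = a \<odot>\<^bsub>N\<^esub> g x"
  shows "\<exists>K c. (\<forall>k<K. c k \<in> carrier R) \<and>
    (\<forall>f\<in>mod_hom R M N. \<forall>x\<in>carrier M. poly_op R N h K c a (f x) = \<zero>\<^bsub>N\<^esub>)"
proof -
  interpret M: module R M by fact
  interpret N: module R N by fact
  let ?Hom = "Hom_mod R M N"
  interpret V: module R ?Hom by (rule module_Hom_mod[OF M N])
  define H where "H f = (\<lambda>x\<in>carrier M. h (f x))" for f
  have Hhom: "H \<in> mod_hom R ?Hom ?Hom"
  proof (rule mod_homI)
    show "H f \<in> carrier ?Hom" if "f \<in> carrier ?Hom" for f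
      unfolding H_def using mod_hom_restrict[OF M mod_hom_comp[OF _ h]] that by simp
    show "H (f \<oplus>\<^bsub>?Hom\<^esub> g) = H f \<oplus>\<^bsub>?Hom\<^esub> H g" if "f \<in> carrier ?Hom" "g \<in> carrier ?Hom" for f g
      using that by (auto simp: H_def mod_hom_add[OF h] mod_hom_closed intro!: restrict_ext)
    show "H (b \<odot>\<^bsub>?Hom\<^esub> f) = b \<odot>\<^bsub>?Hom\<^esub> H f" if "b \<in> carrier R" "f \<in> carrier ?Hom" for b f
      using that by (auto simp: H_def mod_hom_smult[OF h] mod_hom_closed intro!: restrict_ext)
  qed
  have Hk: "(H ^^ k) f x = (h ^^ k) (f x)" if "x \<in> carrier M" for f k x
    using that by (induction k) (auto simp: H_def)
  have Hdiv: "\<exists>g\<in>carrier ?Hom. H f = a \<odot>\<^bsub>?Hom\<^esub> g" if fH: "f \<in> carrier ?Hom" for f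
  proof -
    obtain g where g: "g \<in> carrier ?Hom" "\<forall>x\<in>carrier M. h (f x) = a \<odot>\<^bsub>N\<^esub> g x"
      using div[of f] fH by auto
    then show ?thesis by (intro bexI[of _ g]) (auto simp: H_def intro!: restrict_ext)
  qed
  have "\<exists>K c. (\<forall>k<K. c k \<in> carrier R) \<and> (\<forall>f\<in>carrier ?Hom. (H ^^ K) f =
      lincomb ?Hom K (\<lambda>k. (H ^^ k) f) (\<lambda>k. c k \<otimes>\<^bsub>R\<^esub> a [^]\<^bsub>R\<^esub> (K - k)))"
    by (rule integral_relation[OF V.module_axioms acc Hhom a]) (rule Hdiv)
  then obtain K c where Kc: "\<forall>k<K. c k \<in> carrier R" "\<forall>f\<in>carrier ?Hom. (H ^^ K) f =
      lincomb ?Hom K (\<lambda>k. (H ^^ k) f) (\<lambda>k. c k \<otimes>\<^bsub>R\<^esub> a [^]\<^bsub>R\<^esub> (K - k))"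
    by (elim exE conjE)
  note rel = bspec[OF Kc(2)]
  have c: "c k \<in> carrier R" if "k < K" for k using Kc(1) that by simp
  have "poly_op R N h K c a (f x) = \<zero>\<^bsub>N\<^esub>" if f: "f \<in> mod_hom R M N" and x: "x \<in> carrier M" for f x
  proof -
    let ?f = "restrict f (carrier M)"
    have fX: "?f \<in> carrier ?Hom" using mod_hom_restrict[OF M f] by simp
    have ev: "(\<lambda>f. f x) \<in> mod_hom R ?Hom N"
      using x by (intro mod_homI) (auto dest: mod_hom_closed)
    have "(h ^^ K) (f x) = (H ^^ K) ?f x" using Hk[OF x] x by simp
    also have "\<dots> = lincomb N K (\<lambda>k. (H ^^ k) ?f x) (\<lambda>k. c k \<otimes>\<^bsub>R\<^esub> a [^]\<^bsub>R\<^esub> (K - k))"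
      unfolding rel[OF fX]
      by (rule V.lincomb_hom[OF N ev]) (use mod_hom_closed[OF mod_hom_funpow[OF Hhom] fX] c a in auto)
    also have "\<dots> = lincomb N K (\<lambda>k. (h ^^ k) (f x)) (\<lambda>k. c k \<otimes>\<^bsub>R\<^esub> a [^]\<^bsub>R\<^esub> (K - k))"
      using Hk[OF x] x by simp
    finally have eq: "(h ^^ K) (f x) = lincomb N K (\<lambda>k. (h ^^ k) (f x)) (\<lambda>k. c k \<otimes>\<^bsub>R\<^esub> a [^]\<^bsub>R\<^esub> (K - k))" .
    have "(h ^^ K) (f x) \<in> carrier N"
      by (rule mod_hom_closed[OF mod_hom_funpow[OF h] mod_hom_closed[OF f x]])
    then show ?thesis unfolding poly_op_def eq[symmetric] by (simp add: a_minus_def N.r_neg)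
  qed
  with Kc(1) show ?thesis by (intro exI[of _ K] exI[of _ c]) simp
qed

lemma poly_op_kills_precompose:
  fixes M :: "('a, 'm, 'l) module_scheme" and N :: "('a, 'n, 'j) module_scheme"
  assumes M: "module R M" and N: "module R N" and acc: "acc_on R (Hom_mod R M N) (carrier (Hom_mod R M N))"
    and h: "h \<in> mod_hom R M M" and a: "a \<in> carrier R"
    and div: "\<And>f. f \<in> mod_hom R M N \<inter> extensional (carrier M) \<Longrightarrow>
      \<exists>g\<in>mod_hom R M N \<inter> extensional (carrier M). \<forall>x\<in>carrier M. f (h x) = a \<odot>\<^bsub>N\<^esub> g x"
  shows "\<exists>K c. (\<forall>k<K. c k \<in> carrier R) \<and>
    (\<forall>f\<in>mod_hom R M N. \<forall>x\<in>carrier M. f (poly_op R M h K c a x) = \<zero>\<^bsub>N\<^esub>)"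
proof -
  interpret M: module R M by fact
  interpret N: module R N by fact
  let ?Hom = "Hom_mod R M N"
  interpret V: module R ?Hom by (rule module_Hom_mod[OF M N])
  define H where "H f = (\<lambda>x\<in>carrier M. f (h x))" for f :: "'m \<Rightarrow> 'n"
  note hc = mod_hom_closed[OF h]
  have Hhom: "H \<in> mod_hom R ?Hom ?Hom"
  proof (rule mod_homI)
    show "H f \<in> carrier ?Hom" if "f \<in> carrier ?Hom" for f
    proof -
      have f: "f \<in> mod_hom R M N" using that by simp
      show ?thesis unfolding H_def using mod_hom_restrict[OF M mod_hom_comp[OF h f]] by simp
    qed
    show "H (f \<oplus>\<^bsub>?Hom\<^esub> g) = H f \<oplus>\<^bsub>?Hom\<^esub> H g" for f g
      by (auto simp: H_def hc intro!: restrict_ext)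
    show "H (b \<odot>\<^bsub>?Hom\<^esub> f) = b \<odot>\<^bsub>?Hom\<^esub> H f" for b f
      by (auto simp: H_def hc intro!: restrict_ext)
  qed
  have Hk: "(H ^^ k) f x = f ((h ^^ k) x)" if "x \<in> carrier M" for f k x
    using that
  proof (induction k arbitrary: x)
    case (Suc k)
    have "(H ^^ Suc k) f x = (H ^^ k) f (h x)" using Suc.prems by (simp add: H_def)
    also have "\<dots> = f ((h ^^ k) (h x))" using Suc.IH[OF hc[OF Suc.prems]] .
    finally show ?case by (simp add: funpow_swap1)
  qed simp
  have Hdiv: "\<exists>g\<in>carrier ?Hom. H f = a \<odot>\<^bsub>?Hom\<^esub> g" if fH: "f \<in> carrier ?Hom" for f
  proof -
    obtain g where g: "g \<in> carrier ?Hom" "\<forall>x\<in>carrier M. f (h x) = a \<odot>\<^bsub>N\<^esub> g x"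
      using div[of f] fH by auto
    then show ?thesis by (intro bexI[of _ g]) (auto simp: H_def intro!: restrict_ext)
  qed
  have "\<exists>K c. (\<forall>k<K. c k \<in> carrier R) \<and> (\<forall>f\<in>carrier ?Hom. (H ^^ K) f =
      lincomb ?Hom K (\<lambda>k. (H ^^ k) f) (\<lambda>k. c k \<otimes>\<^bsub>R\<^esub> a [^]\<^bsub>R\<^esub> (K - k)))"
    by (rule integral_relation[OF V.module_axioms acc Hhom a]) (rule Hdiv)
  then obtain K c where Kc: "\<forall>k<K. c k \<in> carrier R" "\<forall>f\<in>carrier ?Hom. (H ^^ K) f =
      lincomb ?Hom K (\<lambda>k. (H ^^ k) f) (\<lambda>k. c k \<otimes>\<^bsub>R\<^esub> a [^]\<^bsub>R\<^esub> (K - k))"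
    by (elim exE conjE)
  note rel = bspec[OF Kc(2)]
  have c: "c k \<in> carrier R" if "k < K" for k using Kc(1) that by simp
  have "f (poly_op R M h K c a x) = \<zero>\<^bsub>N\<^esub>" if f: "f \<in> mod_hom R M N" and x: "x \<in> carrier M" for f x
  proof -
    let ?f = "restrict f (carrier M)" and ?d = "\<lambda>k. c k \<otimes>\<^bsub>R\<^esub> a [^]\<^bsub>R\<^esub> (K - k)"
    note hkc = mod_hom_closed[OF mod_hom_funpow[OF h] x]
    have dc: "?d k \<in> carrier R" if "k < K" for k using c that a by simp
    have fX: "?f \<in> carrier ?Hom" using mod_hom_restrict[OF M f] by simp
    have ev: "(\<lambda>f. f x) \<in> mod_hom R ?Hom N"
      using x by (intro mod_homI) (auto dest: mod_hom_closed)
    have "f ((h ^^ K) x) = (H ^^ K) ?f x" using Hk[OF x] hkc by simp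
    also have "\<dots> = lincomb N K (\<lambda>k. (H ^^ k) ?f x) ?d"
      unfolding rel[OF fX]
      by (rule V.lincomb_hom[OF N ev]) (use mod_hom_closed[OF mod_hom_funpow[OF Hhom] fX] dc in auto)
    also have "\<dots> = lincomb N K (\<lambda>k. f ((h ^^ k) x)) ?d"
      using Hk[OF x] hkc by simp
    also have "\<dots> = f (lincomb M K (\<lambda>k. (h ^^ k) x) ?d)"
      by (rule M.lincomb_hom[OF N f, symmetric]) (use hkc dc in auto)
    finally have eq: "f ((h ^^ K) x) = f (lincomb M K (\<lambda>k. (h ^^ k) x) ?d)" .
    have lc: "lincomb M K (\<lambda>k. (h ^^ k) x) ?d \<in> carrier M" by (rule M.lincomb_closed) (use hkc dc in auto)
    show ?thesis unfolding poly_op_def mod_hom_minus[OF M N f hkc lc] eq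
      using mod_hom_closed[OF f lc] by (simp add: a_minus_def N.r_neg)
  qed
  with Kc(1) show ?thesis by (intro exI[of _ K] exI[of _ c]) simp
qed

lemma mod_hom_divide:
  assumes M: "module R M" and N: "module R N" and f: "f \<in> mod_hom R M N" and a: "a \<in> carrier R"
    and reg: "\<And>y. \<lbrakk>y \<in> carrier N; a \<odot>\<^bsub>N\<^esub> y = \<zero>\<^bsub>N\<^esub>\<rbrakk> \<Longrightarrow> y = \<zero>\<^bsub>N\<^esub>"
    and div: "\<And>x. x \<in> carrier M \<Longrightarrow> \<exists>y\<in>carrier N. f x = a \<odot>\<^bsub>N\<^esub> y"
  shows "\<exists>g\<in>mod_hom R M N \<inter> extensional (carrier M). \<forall>x\<in>carrier M. f x = a \<odot>\<^bsub>N\<^esub> g x"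
proof -
  interpret M: module R M by fact
  interpret N: module R N by fact
  have cancel: "y = z" if yz: "y \<in> carrier N" "z \<in> carrier N" "a \<odot>\<^bsub>N\<^esub> y = a \<odot>\<^bsub>N\<^esub> z" for y z
  proof -
    have "a \<odot>\<^bsub>N\<^esub> (y \<ominus>\<^bsub>N\<^esub> z) = a \<odot>\<^bsub>N\<^esub> y \<ominus>\<^bsub>N\<^esub> a \<odot>\<^bsub>N\<^esub> z"
      using yz(1,2) a by (simp add: a_minus_def N.smult_r_distr N.smult_r_minus)
    then have "a \<odot>\<^bsub>N\<^esub> (y \<ominus>\<^bsub>N\<^esub> z) = \<zero>\<^bsub>N\<^esub>" using yz a by (simp add: a_minus_def N.r_neg)
    then show ?thesis using reg[of "y \<ominus>\<^bsub>N\<^esub> z"] N.minus_eq_zero_iff yz by simp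
  qed
  obtain g where g: "\<And>x. x \<in> carrier M \<Longrightarrow> g x \<in> carrier N" "\<And>x. x \<in> carrier M \<Longrightarrow> f x = a \<odot>\<^bsub>N\<^esub> g x"
    using div by metis
  have "g \<in> mod_hom R M N"
  proof (rule mod_homI)
    show "g x \<in> carrier N" if "x \<in> carrier M" for x using g(1) that .
    show "g (x \<oplus>\<^bsub>M\<^esub> y) = g x \<oplus>\<^bsub>N\<^esub> g y" if "x \<in> carrier M" "y \<in> carrier M" for x y
      by (rule cancel) (use that g mod_hom_add[OF f] a in \<open>auto simp: g(2)[symmetric] N.smult_r_distr\<close>)
    show "g (b \<odot>\<^bsub>M\<^esub> x) = b \<odot>\<^bsub>N\<^esub> g x" if bx: "b \<in> carrier R" "x \<in> carrier M" for b x
    proof (rule cancel)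
      have "a \<odot>\<^bsub>N\<^esub> g (b \<odot>\<^bsub>M\<^esub> x) = b \<odot>\<^bsub>N\<^esub> (a \<odot>\<^bsub>N\<^esub> g x)"
        using bx g(2)[of "b \<odot>\<^bsub>M\<^esub> x"] g(2)[of x] mod_hom_smult[OF f bx] by simp
      then show "a \<odot>\<^bsub>N\<^esub> g (b \<odot>\<^bsub>M\<^esub> x) = a \<odot>\<^bsub>N\<^esub> (b \<odot>\<^bsub>N\<^esub> g x)"
        using bx a g(1) by (simp add: N.smult_assoc1[symmetric] M.m_comm)
    qed (use bx g in auto)
  qed
  then show ?thesis using mod_hom_restrict[OF M] g(2)
    by (intro bexI[of _ "restrict g (carrier M)"]) auto
qed

section \<open>Localization and local bases\<close>

locale localization = module R M for R (structure) and M (structure) +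
  fixes S :: "'a set"
  assumes S_carrier: "S \<subseteq> carrier R" and S_one: "\<one> \<in> S"
    and S_mult: "\<lbrakk>s \<in> S; t \<in> S\<rbrakk> \<Longrightarrow> s \<otimes> t \<in> S"
begin

abbreviation fr where "fr \<equiv> fraction R M S"
abbreviation frR where "frR \<equiv> fraction R (self_module R) S"

lemma S_carrier' [simp]: "s \<in> S \<Longrightarrow> s \<in> carrier R"
  using S_carrier by auto

lemma fr_mem:
  "\<lbrakk>x \<in> carrier M; s \<in> S\<rbrakk> \<Longrightarrow> (y, t) \<in> fr x s \<longleftrightarrow>
    y \<in> carrier M \<and> t \<in> S \<and> (\<exists>u\<in>S. (u \<otimes> t) \<odot>\<^bsub>M\<^esub> x = (u \<otimes> s) \<odot>\<^bsub>M\<^esub> y)"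
  by (auto simp: fraction_def smult_assoc1)

lemma fr_self: "\<lbrakk>x \<in> carrier M; s \<in> S\<rbrakk> \<Longrightarrow> (x, s) \<in> fr x s"
  using S_one by (auto simp: fr_mem)

lemma fr_subset:
  assumes "x \<in> carrier M" "y \<in> carrier M" "s \<in> S" "t \<in> S" "u \<in> S" "(u \<otimes> t) \<odot>\<^bsub>M\<^esub> x = (u \<otimes> s) \<odot>\<^bsub>M\<^esub> y"
  shows "fr x s \<subseteq> fr y t"
proof (rule subsetI, clarify)
  fix z r assume "(z, r) \<in> fr x s"
  then obtain v where v: "v \<in> S" "(v \<otimes> r) \<odot>\<^bsub>M\<^esub> x = (v \<otimes> s) \<odot>\<^bsub>M\<^esub> z" and z: "z \<in> carrier M" "r \<in> S"
    using fr_mem[OF assms(1,3)] by auto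
  have "((u \<otimes> v \<otimes> s) \<otimes> r) \<odot>\<^bsub>M\<^esub> y = (v \<otimes> r) \<odot>\<^bsub>M\<^esub> ((u \<otimes> s) \<odot>\<^bsub>M\<^esub> y)"
    using assms(2,3,5) v(1) z by (simp add: smult_assoc1[symmetric] m_ac)
  also have "\<dots> = (u \<otimes> t) \<odot>\<^bsub>M\<^esub> ((v \<otimes> r) \<odot>\<^bsub>M\<^esub> x)"
    unfolding assms(6)[symmetric] using assms(1,4,5) v(1) z by (simp add: smult_assoc1[symmetric] m_ac)
  also have "\<dots> = ((u \<otimes> v \<otimes> s) \<otimes> t) \<odot>\<^bsub>M\<^esub> z"
    unfolding v(2) using assms(3-5) v(1) z by (simp add: smult_assoc1[symmetric] m_ac)
  finally show "(z, r) \<in> fr y t"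
    unfolding fr_mem[OF assms(2,4)] using z S_mult[OF S_mult[OF assms(5) v(1)] assms(3)] by blast
qed

lemma fr_eqI:
  assumes "x \<in> carrier M" "y \<in> carrier M" "s \<in> S" "t \<in> S" "u \<in> S" "(u \<otimes> t) \<odot>\<^bsub>M\<^esub> x = (u \<otimes> s) \<odot>\<^bsub>M\<^esub> y"
  shows "fr x s = fr y t"
  using fr_subset[OF assms] fr_subset[OF assms(2,1,4,3,5) assms(6)[symmetric]] by (rule equalityI)

lemma fr_eqD:
  assumes "x \<in> carrier M" "y \<in> carrier M" "s \<in> S" "t \<in> S" "fr x s = fr y t"
  shows "\<exists>u\<in>S. (u \<otimes> t) \<odot>\<^bsub>M\<^esub> x = (u \<otimes> s) \<odot>\<^bsub>M\<^esub> y"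
  using fr_self[OF assms(2,4)] unfolding assms(5)[symmetric] fr_mem[OF assms(1,3)] by blast

lemma fr_add:
  assumes x: "x \<in> carrier M" "s \<in> S" and y: "y \<in> carrier M" "t \<in> S"
  shows "fr x s \<oplus>\<^bsub>loc_module R M S\<^esub> fr y t = fr (t \<odot>\<^bsub>M\<^esub> x \<oplus>\<^bsub>M\<^esub> s \<odot>\<^bsub>M\<^esub> y) (s \<otimes> t)"
proof -
  let ?A = "{fr (t' \<odot>\<^bsub>M\<^esub> x' \<oplus>\<^bsub>M\<^esub> s' \<odot>\<^bsub>M\<^esub> y') (s' \<otimes> t') | x' s' y' t'.
      (x', s') \<in> fr x s \<and> (y', t') \<in> fr y t}"
  have eq: "fr (t' \<odot>\<^bsub>M\<^esub> x' \<oplus>\<^bsub>M\<^esub> s' \<odot>\<^bsub>M\<^esub> y') (s' \<otimes> t') = fr (t \<odot>\<^bsub>M\<^esub> x \<oplus>\<^bsub>M\<^esub> s \<odot>\<^bsub>M\<^esub> y) (s \<otimes> t)"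
    if mem: "(x', s') \<in> fr x s" "(y', t') \<in> fr y t" for x' s' y' t'
  proof -
    obtain u where u: "u \<in> S" "(u \<otimes> s') \<odot>\<^bsub>M\<^esub> x = (u \<otimes> s) \<odot>\<^bsub>M\<^esub> x'" and x': "x' \<in> carrier M" "s' \<in> S"
      using mem(1) fr_mem[OF x] by auto
    obtain v where v: "v \<in> S" "(v \<otimes> t') \<odot>\<^bsub>M\<^esub> y = (v \<otimes> t) \<odot>\<^bsub>M\<^esub> y'" and y': "y' \<in> carrier M" "t' \<in> S"
      using mem(2) fr_mem[OF y] by auto
    have "((u \<otimes> v) \<otimes> (s \<otimes> t)) \<odot>\<^bsub>M\<^esub> (t' \<odot>\<^bsub>M\<^esub> x' \<oplus>\<^bsub>M\<^esub> s' \<odot>\<^bsub>M\<^esub> y') =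
        (v \<otimes> t \<otimes> t') \<odot>\<^bsub>M\<^esub> ((u \<otimes> s) \<odot>\<^bsub>M\<^esub> x') \<oplus>\<^bsub>M\<^esub> (u \<otimes> s \<otimes> s') \<odot>\<^bsub>M\<^esub> ((v \<otimes> t) \<odot>\<^bsub>M\<^esub> y')"
      using x y x' y' u(1) v(1) by (simp add: smult_r_distr smult_assoc1[symmetric] m_ac)
    also have "\<dots> = (v \<otimes> t \<otimes> t') \<odot>\<^bsub>M\<^esub> ((u \<otimes> s') \<odot>\<^bsub>M\<^esub> x) \<oplus>\<^bsub>M\<^esub> (u \<otimes> s \<otimes> s') \<odot>\<^bsub>M\<^esub> ((v \<otimes> t') \<odot>\<^bsub>M\<^esub> y)"
      unfolding u(2) v(2) ..
    also have "\<dots> = ((u \<otimes> v) \<otimes> (s' \<otimes> t')) \<odot>\<^bsub>M\<^esub> (t \<odot>\<^bsub>M\<^esub> x \<oplus>\<^bsub>M\<^esub> s \<odot>\<^bsub>M\<^esub> y)"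
      using x y x' y' u(1) v(1) by (simp add: smult_r_distr smult_assoc1[symmetric] m_ac)
    finally show ?thesis
      using x y x' y' u(1) v(1) by (intro fr_eqI[of _ _ _ _ "u \<otimes> v"]) (simp_all add: S_mult)
  qed
  have "?A = {fr (t \<odot>\<^bsub>M\<^esub> x \<oplus>\<^bsub>M\<^esub> s \<odot>\<^bsub>M\<^esub> y) (s \<otimes> t)}"
  proof
    show "?A \<subseteq> {fr (t \<odot>\<^bsub>M\<^esub> x \<oplus>\<^bsub>M\<^esub> s \<odot>\<^bsub>M\<^esub> y) (s \<otimes> t)}" using eq by auto
    show "{fr (t \<odot>\<^bsub>M\<^esub> x \<oplus>\<^bsub>M\<^esub> s \<odot>\<^bsub>M\<^esub> y) (s \<otimes> t)} \<subseteq> ?A"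
      using fr_self[OF x] fr_self[OF y] by blast
  qed
  then show ?thesis by (simp add: loc_module_def)
qed

lemma fr_smult:
  assumes a: "a \<in> carrier R" "s \<in> S" and x: "x \<in> carrier M" "t \<in> S"
  shows "frR a s \<odot>\<^bsub>loc_module R M S\<^esub> fr x t = fr (a \<odot>\<^bsub>M\<^esub> x) (s \<otimes> t)"
proof -
  let ?A = "{fr (a' \<odot>\<^bsub>M\<^esub> x') (s' \<otimes> t') | a' s' x' t'. (a', s') \<in> frR a s \<and> (x', t') \<in> fr x t}"
  have eq: "fr (a' \<odot>\<^bsub>M\<^esub> x') (s' \<otimes> t') = fr (a \<odot>\<^bsub>M\<^esub> x) (s \<otimes> t)"
    if mem: "(a', s') \<in> frR a s" "(x', t') \<in> fr x t" for a' s' x' t'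
  proof -
    obtain u where u: "u \<in> S" "u \<otimes> (s' \<otimes> a) = u \<otimes> (s \<otimes> a')" and a': "a' \<in> carrier R" "s' \<in> S"
      using mem(1) by (auto simp: fraction_def)
    obtain v where v: "v \<in> S" "(v \<otimes> t') \<odot>\<^bsub>M\<^esub> x = (v \<otimes> t) \<odot>\<^bsub>M\<^esub> x'" and x': "x' \<in> carrier M" "t' \<in> S"
      using mem(2) fr_mem[OF x] by auto
    have "((u \<otimes> v) \<otimes> (s \<otimes> t)) \<odot>\<^bsub>M\<^esub> (a' \<odot>\<^bsub>M\<^esub> x') = (u \<otimes> (s \<otimes> a')) \<odot>\<^bsub>M\<^esub> ((v \<otimes> t) \<odot>\<^bsub>M\<^esub> x')"
      using a x a' x' u(1) v(1) by (simp add: smult_assoc1[symmetric] m_ac)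
    also have "\<dots> = (u \<otimes> (s' \<otimes> a)) \<odot>\<^bsub>M\<^esub> ((v \<otimes> t') \<odot>\<^bsub>M\<^esub> x)"
      unfolding u(2) v(2) ..
    also have "\<dots> = ((u \<otimes> v) \<otimes> (s' \<otimes> t')) \<odot>\<^bsub>M\<^esub> (a \<odot>\<^bsub>M\<^esub> x)"
      using a x a' x' u(1) v(1) by (simp add: smult_assoc1[symmetric] m_ac)
    finally show ?thesis
      using a x a' x' u(1) v(1) by (intro fr_eqI[of _ _ _ _ "u \<otimes> v"]) (simp_all add: S_mult)
  qed
  have one: "(a, s) \<in> frR a s" using a S_one by (auto simp: fraction_def)
  have "?A = {fr (a \<odot>\<^bsub>M\<^esub> x) (s \<otimes> t)}"
  proof
    show "?A \<subseteq> {fr (a \<odot>\<^bsub>M\<^esub> x) (s \<otimes> t)}" using eq by auto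
    show "{fr (a \<odot>\<^bsub>M\<^esub> x) (s \<otimes> t)} \<subseteq> ?A"
      using one fr_self[OF x] by blast
  qed
  then show ?thesis by (simp add: loc_module_def)
qed

lemma fr_carrier: "\<lbrakk>x \<in> carrier M; s \<in> S\<rbrakk> \<Longrightarrow> fr x s \<in> carrier (loc_module R M S)"
  by (auto simp: loc_module_def)

end

lemma loc_ring_eq_loc_module:
  "carrier (loc_ring R S) = carrier (loc_module R (self_module R) S)"
  "x \<oplus>\<^bsub>loc_ring R S\<^esub> y = x \<oplus>\<^bsub>loc_module R (self_module R) S\<^esub> y"
  "x \<otimes>\<^bsub>loc_ring R S\<^esub> y = x \<odot>\<^bsub>loc_module R (self_module R) S\<^esub> y"
  by (simp_all add: loc_ring_def loc_module_def)

text \<open>The basis vectors \<open>e i\<close> are numerators of preimages of the standard basis, so the given isomorphism sends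
\<open>e i\<close> to the unit \<open>q i\<close> times the \<open>i\<close>-th standard vector. Injectivity and surjectivity of the isomorphism turn into
independence and spanning after multiplication by a common denominator.\<close>

lemma (in localization) local_basis:
  assumes P: "primeideal P R" and S: "S = carrier R - P"
    and iso: "mod_iso (loc_ring R S) (loc_module R M S) (free_mod (loc_ring R S) r)"
  shows "\<exists>e. (\<forall>i<r. e i \<in> carrier M) \<and>
    (\<forall>y\<in>carrier M. \<exists>s\<in>S. \<exists>c\<in>carrier (free_mod R r). s \<odot>\<^bsub>M\<^esub> y = lincomb M r e c) \<and>
    (\<forall>c\<in>carrier (free_mod R r). lincomb M r e c = \<zero>\<^bsub>M\<^esub> \<longrightarrow> (\<exists>s\<in>S. \<forall>i<r. s \<otimes> c i = \<zero>))"
proof -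
  interpret S: localization R "self_module R" S
    by (rule localization.intro[OF module_self]) (unfold_locales, use S_carrier S_one S_mult in auto)
  define L where "L = loc_ring R S"
  obtain f where f: "f \<in> mod_hom L (loc_module R M S) (free_mod L r)"
    and bij: "bij_betw f (carrier (loc_module R M S)) (carrier (free_mod L r))"
    using iso unfolding mod_iso_def L_def by blast
  have Lcar: "frR a s \<in> carrier L" if "a \<in> carrier R" "s \<in> S" for a s
    unfolding L_def loc_ring_eq_loc_module(1) using S.fr_carrier[of a s] that by simp
  have Ladd: "frR a s \<oplus>\<^bsub>L\<^esub> frR b t = frR (t \<otimes> a \<oplus> s \<otimes> b) (s \<otimes> t)"
    if "a \<in> carrier R" "b \<in> carrier R" "s \<in> S" "t \<in> S" for a b s t
    unfolding L_def loc_ring_eq_loc_module(2) using S.fr_add[of a s b t] that by simp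
  have Lmult: "frR a s \<otimes>\<^bsub>L\<^esub> frR b t = frR (a \<otimes> b) (s \<otimes> t)"
    if "a \<in> carrier R" "b \<in> carrier R" "s \<in> S" "t \<in> S" for a b s t
    unfolding L_def loc_ring_eq_loc_module(3) using S.fr_smult[of a s b t] that by simp
  have Leq: "frR a s = frR b t" if "a \<in> carrier R" "b \<in> carrier R" "s \<in> S" "t \<in> S" "t \<otimes> a = s \<otimes> b" for a b s t
    using S.fr_eqI[of a b s t \<one>] that S_one by simp
  have Lrep: "\<exists>a\<in>carrier R. \<exists>s\<in>S. w = frR a s" if "w \<in> carrier L" for w
    using that unfolding L_def loc_ring_def by auto
  define G where "G x = f (fr x \<one>)" for x
  have frc: "fr x \<one> \<in> carrier (loc_module R M S)" if "x \<in> carrier M" for x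
    using fr_carrier[OF that S_one] .
  have Gcar: "G x \<in> carrier (free_mod L r)" if "x \<in> carrier M" for x
    unfolding G_def by (rule mod_hom_closed[OF f frc[OF that]])
  have Gc: "G x i \<in> carrier L" if "x \<in> carrier M" "i < r" for x i
    by (rule free_coord[OF Gcar[OF that(1)] that(2)])
  have Gadd: "G (x \<oplus>\<^bsub>M\<^esub> y) i = G x i \<oplus>\<^bsub>L\<^esub> G y i" if "x \<in> carrier M" "y \<in> carrier M" "i < r" for x y i
  proof -
    have "fr (x \<oplus>\<^bsub>M\<^esub> y) \<one> = fr x \<one> \<oplus>\<^bsub>loc_module R M S\<^esub> fr y \<one>"
      using fr_add[OF that(1) S_one that(2) S_one] that by simp
    then have "G (x \<oplus>\<^bsub>M\<^esub> y) = G x \<oplus>\<^bsub>free_mod L r\<^esub> G y"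
      unfolding G_def using mod_hom_add[OF f frc frc] that by simp
    then show ?thesis using that(3) by simp
  qed
  have Gsmult: "f (fr (c \<odot>\<^bsub>M\<^esub> x) s) i = frR c \<one> \<otimes>\<^bsub>L\<^esub> f (fr x s) i"
    if "c \<in> carrier R" "x \<in> carrier M" "s \<in> S" "i < r" for c x s i
  proof -
    have "fr (c \<odot>\<^bsub>M\<^esub> x) s = frR c \<one> \<odot>\<^bsub>loc_module R M S\<^esub> fr x s"
      using fr_smult[OF that(1) S_one that(2,3)] that by simp
    then have "f (fr (c \<odot>\<^bsub>M\<^esub> x) s) = frR c \<one> \<odot>\<^bsub>free_mod L r\<^esub> f (fr x s)"
      using mod_hom_smult[OF f Lcar[OF that(1) S_one] fr_carrier[OF that(2,3)]] by simp
    then show ?thesis using that(4) by simp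
  qed
  have Gs: "G (c \<odot>\<^bsub>M\<^esub> x) i = frR c \<one> \<otimes>\<^bsub>L\<^esub> G x i"
    if "c \<in> carrier R" "x \<in> carrier M" "i < r" for c x i
    unfolding G_def by (rule Gsmult[OF that(1,2) S_one that(3)])
  have G0: "G \<zero>\<^bsub>M\<^esub> i = frR \<zero> \<one>" if i: "i < r" for i
  proof -
    obtain a s where as: "a \<in> carrier R" "s \<in> S" "G \<zero>\<^bsub>M\<^esub> i = frR a s" using Lrep[OF Gc[OF M.zero_closed i]] by blast
    have "G (\<zero> \<odot>\<^bsub>M\<^esub> \<zero>\<^bsub>M\<^esub>) i = frR \<zero> \<one> \<otimes>\<^bsub>L\<^esub> frR a s" unfolding Gs[OF R.zero_closed M.zero_closed i] as(3) ..
    also have "\<dots> = frR \<zero> \<one>" using Lmult[OF R.zero_closed as(1) S_one as(2)] as S_one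
      by (simp add: Leq[of \<zero> \<zero> s \<one>])
    finally show ?thesis by simp
  qed
  have "\<exists>y s. y \<in> carrier M \<and> s \<in> S \<and> (\<forall>j<r. G y j = frR (if j = i then s else \<zero>) \<one>)" if i: "i < r" for i
  proof -
    define v where "v = (\<lambda>j\<in>{..<r}. frR (if j = i then \<one> else \<zero>) \<one>)"
    have "v \<in> carrier (free_mod L r)" unfolding free_carrier_iff v_def using S_one by (auto intro!: Lcar)
    then have "v \<in> f ` carrier (loc_module R M S)" using bij by (simp add: bij_betw_def)
    then obtain y s where y: "y \<in> carrier M" "s \<in> S" "v = f (fr y s)" by (auto simp: loc_module_def)
    have "fr y \<one> = fr (s \<odot>\<^bsub>M\<^esub> y) s"
      by (rule fr_eqI[of _ _ _ _ \<one>]) (use y S_one in simp_all)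
    then have "G y j = frR s \<one> \<otimes>\<^bsub>L\<^esub> v j" if "j < r" for j
      unfolding G_def using Gsmult[OF S_carrier'[OF y(2)] y(1,2) that] y(3) by simp
    then have "G y j = frR (if j = i then s else \<zero>) \<one>" if "j < r" for j
      using that Lmult[of s _ \<one> \<one>] y(2) S_one by (simp add: v_def)
    then show ?thesis using y(1,2) by blast
  qed
  then obtain e q where e: "\<And>i. i < r \<Longrightarrow> e i \<in> carrier M" "\<And>i. i < r \<Longrightarrow> q i \<in> S"
    and Ge: "\<And>i j. \<lbrakk>i < r; j < r\<rbrakk> \<Longrightarrow> G (e i) j = frR (if j = i then q i else \<zero>) \<one>"
    by metis
  have Glin: "G (lincomb M n e c) j = (if j < n then frR (c j \<otimes> q j) \<one> else frR \<zero> \<one>)"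
    if "n \<le> r" "c \<in> carrier (free_mod R r)" "j < r" for n c j
    using that
  proof (induction n)
    case 0
    then show ?case using G0 by (simp add: lincomb_def)
  next
    case (Suc n)
    have n: "n < r" using Suc.prems by simp
    note cc = free_coord[OF Suc.prems(2)]
    have lc: "lincomb M n e c \<in> carrier M" by (rule lincomb_closed) (use n e cc in auto)
    have qc: "q k \<in> carrier R" if "k < r" for k using e(2)[OF that] by simp
    have "lincomb M (Suc n) e c = c n \<odot>\<^bsub>M\<^esub> e n \<oplus>\<^bsub>M\<^esub> lincomb M n e c"
      unfolding lincomb_def lessThan_Suc using n e(1) cc by (subst M.finsum_insert) auto
    then have "G (lincomb M (Suc n) e c) j = frR (c n) \<one> \<otimes>\<^bsub>L\<^esub> G (e n) j \<oplus>\<^bsub>L\<^esub> G (lincomb M n e c) j"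
      using Gadd[OF smult_closed[OF cc[OF n] e(1)[OF n]] lc Suc.prems(3)] Gs[OF cc[OF n] e(1)[OF n] Suc.prems(3)]
      by simp
    also have "\<dots> = frR (c n \<otimes> (if j = n then q n else \<zero>)) \<one> \<oplus>\<^bsub>L\<^esub> (if j < n then frR (c j \<otimes> q j) \<one> else frR \<zero> \<one>)"
      using Suc.IH[OF _ Suc.prems(2,3)] n Ge[OF n Suc.prems(3)] Lmult[of "c n" _ \<one> \<one>] cc[OF n] qc[OF n] S_one by simp
    also have "\<dots> = (if j < Suc n then frR (c j \<otimes> q j) \<one> else frR \<zero> \<one>)"
      using Ladd[of _ _ \<one> \<one>] S_one cc[OF n] cc[OF Suc.prems(3)] qc[OF n] qc[OF Suc.prems(3)] by (simp add: less_Suc_eq)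
    finally show ?case .
  qed
  have indep: "\<exists>s\<in>S. \<forall>i<r. s \<otimes> c i = \<zero>"
    if c: "c \<in> carrier (free_mod R r)" and 0: "lincomb M r e c = \<zero>\<^bsub>M\<^esub>" for c
  proof -
    note cc = free_coord[OF c]
    have ex: "\<exists>s\<in>S. s \<otimes> c i = \<zero>" if i: "i < r" for i
    proof -
      have "frR (c i \<otimes> q i) \<one> = frR \<zero> \<one>" using Glin[OF order_refl c i] i G0[OF i] unfolding 0 by simp
      then obtain u where u: "u \<in> S" "u \<otimes> (c i \<otimes> q i) = \<zero>"
        using S.fr_eqD[of "c i \<otimes> q i" \<zero> \<one> \<one>] S_one cc[OF i] e(2)[OF i] by auto
      then have "(u \<otimes> q i) \<otimes> c i = \<zero>" using cc[OF i] e(2)[OF i] by (simp add: m_ac)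
      then show ?thesis using S_mult[OF u(1) e(2)[OF i]] by blast
    qed
    have "\<exists>s\<in>carrier R - P. \<forall>Q\<in>(\<lambda>i. annihilator R (c i)) ` {..<r}. s \<in> Q"
    proof (rule prime_avoids_finite[OF P])
      fix Q assume "Q \<in> (\<lambda>i. annihilator R (c i)) ` {..<r}"
      then obtain i where i: "i < r" "Q = annihilator R (c i)" by auto
      show "ideal Q R" unfolding i(2) by (rule ideal_annihilator[OF cc[OF i(1)]])
      obtain s where s: "s \<in> S" "s \<otimes> c i = \<zero>" using ex[OF i(1)] by (elim bexE)
      have "s \<in> Q" "s \<notin> P" using s i(2) unfolding S annihilator_def by simp_all
      then show "\<not> Q \<subseteq> P" by auto
    qed simp
    then show ?thesis unfolding S by (auto simp: annihilator_def)
  qed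
  have span: "\<exists>s\<in>S. \<exists>c\<in>carrier (free_mod R r). s \<odot>\<^bsub>M\<^esub> y = lincomb M r e c" if y: "y \<in> carrier M" for y
  proof -
    define I where "I i = {a \<in> carrier R. \<exists>b\<in>carrier R. G (a \<odot>\<^bsub>M\<^esub> y) i = frR (b \<otimes> q i) \<one>}" for i
    have qc: "q k \<in> carrier R" if "k < r" for k using e(2)[OF that] by simp
    have "\<exists>s\<in>carrier R - P. \<forall>Q\<in>I ` {..<r}. s \<in> Q"
    proof (rule prime_avoids_finite[OF P])
      fix Q assume "Q \<in> I ` {..<r}"
      then obtain i where i: "i < r" "Q = I i" by auto
      show "ideal Q R" unfolding i(2)
      proof (rule cring_idealI)
        show "I i \<subseteq> carrier R" by (auto simp: I_def)
        have "G (\<zero> \<odot>\<^bsub>M\<^esub> y) i = frR (\<zero> \<otimes> q i) \<one>" using y qc[OF i(1)] G0[OF i(1)] by simp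
        then show "\<zero> \<in> I i" unfolding I_def using R.zero_closed by blast
        fix u v assume "u \<in> I i" "v \<in> I i"
        then obtain b b' where *: "u \<in> carrier R" "v \<in> carrier R" "b \<in> carrier R" "b' \<in> carrier R"
          "G (u \<odot>\<^bsub>M\<^esub> y) i = frR (b \<otimes> q i) \<one>" "G (v \<odot>\<^bsub>M\<^esub> y) i = frR (b' \<otimes> q i) \<one>"
          by (auto simp: I_def)
        have "G ((u \<oplus> v) \<odot>\<^bsub>M\<^esub> y) i = frR ((b \<oplus> b') \<otimes> q i) \<one>"
          using * y Gadd[of "u \<odot>\<^bsub>M\<^esub> y" "v \<odot>\<^bsub>M\<^esub> y" i] i(1) Ladd[of "b \<otimes> q i" "b' \<otimes> q i" \<one> \<one>] S_one qc[OF i(1)]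
          by (simp add: smult_l_distr l_distr)
        then show "u \<oplus> v \<in> I i" unfolding I_def using * by blast
      next
        fix a u assume a: "a \<in> carrier R" and "u \<in> I i"
        then obtain b where *: "u \<in> carrier R" "b \<in> carrier R" "G (u \<odot>\<^bsub>M\<^esub> y) i = frR (b \<otimes> q i) \<one>"
          by (auto simp: I_def)
        have "G ((a \<otimes> u) \<odot>\<^bsub>M\<^esub> y) i = frR ((a \<otimes> b) \<otimes> q i) \<one>"
          using * a y Gs[of a "u \<odot>\<^bsub>M\<^esub> y" i] i(1) Lmult[of a "b \<otimes> q i" \<one> \<one>] S_one qc[OF i(1)]
          by (simp add: smult_assoc1 m_assoc)
        then show "a \<otimes> u \<in> I i" unfolding I_def using * a by blast
      qed
      obtain d t where dt: "d \<in> carrier R" "t \<in> S" "G y i = frR d t" using Lrep[OF Gc[OF y i(1)]] by blast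
      have "G ((t \<otimes> q i) \<odot>\<^bsub>M\<^esub> y) i = frR (d \<otimes> q i) \<one>"
        using Gs[of "t \<otimes> q i" y i] dt y i(1) qc[OF i(1)] Lmult[of "t \<otimes> q i" d \<one> t] S_one
          Leq[of "t \<otimes> q i \<otimes> d" "d \<otimes> q i" t \<one>] by (simp add: m_ac)
      then have "t \<otimes> q i \<in> I i" unfolding I_def using dt qc[OF i(1)] by auto
      moreover have "t \<otimes> q i \<notin> P" using S_mult[OF dt(2) e(2)[OF i(1)]] unfolding S by simp
      ultimately show "\<not> Q \<subseteq> P" unfolding i(2) by blast
    qed simp
    then obtain s where s: "s \<in> S" "\<And>i. i < r \<Longrightarrow> s \<in> I i" unfolding S by auto
    then have "\<exists>b\<in>carrier R. G (s \<odot>\<^bsub>M\<^esub> y) i = frR (b \<otimes> q i) \<one>" if "i < r" for i using that by (auto simp: I_def)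
    then obtain b where b: "\<And>i. i < r \<Longrightarrow> b i \<in> carrier R" "\<And>i. i < r \<Longrightarrow> G (s \<odot>\<^bsub>M\<^esub> y) i = frR (b i \<otimes> q i) \<one>" by metis
    define c where "c = restrict b {..<r}"
    have c: "c \<in> carrier (free_mod R r)" unfolding free_carrier_iff c_def using b(1) by auto
    note cc = free_coord[OF c]
    have lc: "lincomb M r e c \<in> carrier M" by (rule lincomb_closed) (use e cc in auto)
    have sy: "s \<odot>\<^bsub>M\<^esub> y \<in> carrier M" using s(1) y by simp
    have "G (s \<odot>\<^bsub>M\<^esub> y) = G (lincomb M r e c)"
    proof (rule free_eqI[OF Gcar[OF sy] Gcar[OF lc]])
      show "G (s \<odot>\<^bsub>M\<^esub> y) j = G (lincomb M r e c) j" if "j < r" for j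
        using b(2)[OF that] Glin[OF order_refl c that] that by (simp add: c_def)
    qed
    then have "fr (s \<odot>\<^bsub>M\<^esub> y) \<one> = fr (lincomb M r e c) \<one>"
      unfolding G_def using bij frc[OF sy] frc[OF lc] by (simp add: bij_betw_def inj_on_def)
    from fr_eqD[OF sy lc S_one S_one this]
    obtain u where u: "u \<in> S" "u \<odot>\<^bsub>M\<^esub> (s \<odot>\<^bsub>M\<^esub> y) = u \<odot>\<^bsub>M\<^esub> lincomb M r e c" by auto
    have "(u \<otimes> s) \<odot>\<^bsub>M\<^esub> y = lincomb M r e (u \<odot>\<^bsub>free_mod R r\<^esub> c)"
      using u s(1) y mod_hom_smult[OF lincomb_mod_hom[of r e, OF e(1)] S_carrier'[OF u(1)] c] by (simp add: smult_assoc1)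
    moreover have "u \<odot>\<^bsub>free_mod R r\<^esub> c \<in> carrier (free_mod R r)"
      by (rule module.smult_closed[OF module_free_mod]) (use u(1) c in auto)
    ultimately show ?thesis using S_mult[OF u(1) s(1)] by blast
  qed
  show ?thesis using e(1) span indep by (intro exI[of _ e]) simp
qed

section \<open>Rigidity as an extension property\<close>

lemma free_lift:
  assumes "module R N" "module R M" and f: "f \<in> mod_hom R N M" "f ` carrier N = carrier M"
    and e: "e \<in> mod_hom R (free_mod R n) M"
  shows "\<exists>l\<in>mod_hom R (free_mod R n) N. \<forall>v\<in>carrier (free_mod R n). f (l v) = e v"
proof -
  interpret N: module R N by fact
  interpret M: module R M by fact
  have "\<exists>y. y \<in> carrier N \<and> f y = e (basis_vec R n j)" for j
    using mod_hom_closed[OF e N.basis_vec_carrier[of n j]] f(2) by (metis imageE)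
  then obtain b where b: "\<And>j. b j \<in> carrier N" "\<And>j. f (b j) = e (basis_vec R n j)" by metis
  have "f (lincomb N n b v) = e v" if v: "v \<in> carrier (free_mod R n)" for v
  proof -
    have "f (lincomb N n b v) = lincomb M n (\<lambda>j. f (b j)) v"
      by (rule N.lincomb_hom[OF assms(2) f(1)]) (use b free_coord[OF v] in auto)
    then show ?thesis using M.hom_from_free[OF e v] b(2) by simp
  qed
  then show ?thesis using N.lincomb_mod_hom[of n b, OF b(1)] by blast
qed

text \<open>Vanishing of \<open>Ext\<^sup>1(M, M)\<close>, computed from some resolution, says that homomorphisms from the first
  syzygy of that resolution to \<open>M\<close> extend. Comparing resolutions in the lowest degree transfers this to
  the syzygy of any presentation by a free module.\<close>

lemma rigid_extension:
  assumes R: "cring R" and M: "module R M" and rig: "rigid R M"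
    and e: "e \<in> mod_hom R (free_mod R m) M" "e ` carrier (free_mod R m) = carrier M"
    and Om: "Om = {v \<in> carrier (free_mod R m). e v = \<zero>\<^bsub>M\<^esub>}"
    and phi: "\<phi> \<in> mod_hom R ((free_mod R m)\<lparr>carrier := Om\<rparr>) M"
  shows "\<exists>\<Phi>\<in>mod_hom R (free_mod R m) M. \<forall>v\<in>Om. \<Phi> v = \<phi> v"
proof -
  interpret M: module R M by fact
  obtain n d e0 where res: "free_resolution R M n d e0" and ext: "trivial_group (Ext_group R M n d 1)"
    using rig unfolding rigid_def by blast
  define F0 F1 F2 where F: "F0 = free_mod R (n 0)" "F1 = free_mod R (n 1)" "F2 = free_mod R (n 2)"
  define F where "F = free_mod R m"
  note eF = e[folded F_def] and OmF = Om[folded F_def] and phiF = phi[folded F_def]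
  interpret F0: module R F0 unfolding F by (rule M.module_free_mod)
  interpret F1: module R F1 unfolding F by (rule M.module_free_mod)
  interpret F2: module R F2 unfolding F by (rule M.module_free_mod)
  interpret F: module R F unfolding F_def by (rule M.module_free_mod)
  have e0: "e0 \<in> mod_hom R F0 M" "e0 ` carrier F0 = carrier M"
    and d0: "d 0 \<in> mod_hom R F1 F0"
    and ex0: "d 0 ` carrier F1 = {x \<in> carrier F0. e0 x = \<zero>\<^bsub>M\<^esub>}"
    and ex1: "d 1 ` carrier F2 = {x \<in> carrier F1. d 0 x = \<zero>\<^bsub>F0\<^esub>}"
    using res unfolding free_resolution_def F by (auto simp: numeral_2_eq_2)
  have subOm: "submodule Om R F"
    unfolding OmF by (rule submodule_kernel[OF F.module_axioms M eF(1)])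
  have modOm: "module R (F\<lparr>carrier := Om\<rparr>)"
    by (rule submodule.submodule_is_module[OF subOm F.module_axioms])
  note phic = mod_hom_closed[OF phiF, simplified]
    and phia = mod_hom_add[OF phiF, simplified] and phis = mod_hom_smult[OF phiF, simplified]
  obtain l where l: "l \<in> mod_hom R F F0" "\<And>v. v \<in> carrier F \<Longrightarrow> e0 (l v) = e v"
    using free_lift[OF F0.module_axioms M e0 e(1)] unfolding F_def by blast
  obtain u where u: "u \<in> mod_hom R F0 F" "\<And>v. v \<in> carrier F0 \<Longrightarrow> e (u v) = e0 v"
    using free_lift[OF F.module_axioms M eF e0(1)[unfolded F]] unfolding F by blast
  have ud0: "u (d 0 w) \<in> Om" if w: "w \<in> carrier F1" for w
  proof -
    have "d 0 w \<in> {x \<in> carrier F0. e0 x = \<zero>\<^bsub>M\<^esub>}" using ex0 w by blast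
    then show ?thesis unfolding OmF using u(2)[of "d 0 w"] mod_hom_closed[OF u(1)] by simp
  qed
  have ud0hom: "(\<lambda>w. \<phi> (u (d 0 w))) \<in> mod_hom R F1 M"
  proof (rule mod_homI)
    note hom = mod_hom_comp[OF d0 u(1)]
    show "\<phi> (u (d 0 w)) \<in> carrier M" if "w \<in> carrier F1" for w by (rule phic[OF ud0[OF that]])
    show "\<phi> (u (d 0 (w \<oplus>\<^bsub>F1\<^esub> w'))) = \<phi> (u (d 0 w)) \<oplus>\<^bsub>M\<^esub> \<phi> (u (d 0 w'))"
      if "w \<in> carrier F1" "w' \<in> carrier F1" for w w'
      using mod_hom_add[OF hom that] phia[OF ud0[OF that(1)] ud0[OF that(2)]] by simp
    show "\<phi> (u (d 0 (a \<odot>\<^bsub>F1\<^esub> w))) = a \<odot>\<^bsub>M\<^esub> \<phi> (u (d 0 w))" if "a \<in> carrier R" "w \<in> carrier F1" for a w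
      using mod_hom_smult[OF hom that] phis[OF that(1) ud0[OF that(2)]] by simp
  qed
  let ?H = "Hom_mod R F1 M" and ?Z = "Ext_cocycles R M n d 1" and ?B = "Ext_coboundaries R M n d 1"
  define f where "f = (\<lambda>w\<in>carrier F1. \<phi> (u (d 0 w)))"
  have fH: "f \<in> carrier ?H" unfolding f_def using mod_hom_restrict[OF F1.module_axioms ud0hom] by simp
  have fZ: "f \<in> ?Z"
  proof -
    have "Hom_diff R n d 1 f = \<zero>\<^bsub>Hom_mod R F2 M\<^esub>"
    proof -
      have "f (d 1 w) = \<zero>\<^bsub>M\<^esub>" if w: "w \<in> carrier F2" for w
      proof -
        have "d 1 w \<in> {x \<in> carrier F1. d 0 x = \<zero>\<^bsub>F0\<^esub>}" using ex1 w by blast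
        then have "f (d 1 w) = \<phi> \<zero>\<^bsub>F\<^esub>"
          unfolding f_def using mod_hom_zero[OF F0.module_axioms F.module_axioms u(1)] by simp
        then show ?thesis using mod_hom_zero[OF modOm M phiF] by simp
      qed
      then show ?thesis by (auto simp: Hom_diff_def compose_def F numeral_2_eq_2 intro!: restrict_ext)
    qed
    then show ?thesis unfolding Ext_cocycles_def using fH by (simp add: F numeral_2_eq_2)
  qed
  have zeroB: "\<zero>\<^bsub>?H\<^esub> \<in> ?B"
  proof -
    have z: "\<zero>\<^bsub>Hom_mod R F0 M\<^esub> \<in> carrier (Hom_mod R F0 M)"
      by (rule abelian_monoid.zero_closed[OF abelian_group.axioms(1)[OF module.axioms(2)[OF module_Hom_mod[OF F0.module_axioms M]]]])
    have "Hom_diff R n d 0 \<zero>\<^bsub>Hom_mod R F0 M\<^esub> = \<zero>\<^bsub>?H\<^esub>"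
      using mod_hom_closed[OF d0] by (auto simp: Hom_diff_def compose_def F intro!: restrict_ext)
    then show ?thesis using z by (auto simp: F intro!: image_eqI[of _ _ "\<zero>\<^bsub>Hom_mod R F0 M\<^esub>"])
  qed
  have "?B #>\<^bsub>(add_monoid ?H)\<lparr>carrier := ?Z\<rparr>\<^esub> f \<in> carrier (Ext_group R M n d 1)"
    unfolding Ext_group_def FactGroup_def RCOSETS_def using fZ by (auto simp: F)
  then have "?B #>\<^bsub>(add_monoid ?H)\<lparr>carrier := ?Z\<rparr>\<^esub> f = ?B"
    using ext unfolding trivial_group_def by (simp add: Ext_group_def FactGroup_def)
  moreover have "\<zero>\<^bsub>?H\<^esub> \<oplus>\<^bsub>?H\<^esub> f \<in> ?B #>\<^bsub>(add_monoid ?H)\<lparr>carrier := ?Z\<rparr>\<^esub> f"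
    unfolding r_coset_def by (rule UN_I[OF zeroB]) simp
  moreover have "\<zero>\<^bsub>?H\<^esub> \<oplus>\<^bsub>?H\<^esub> f = f"
    by (rule abelian_monoid.l_zero[OF abelian_group.axioms(1)[OF module.axioms(2)[OF module_Hom_mod[OF F1.module_axioms M]]] fH])
  ultimately have "f \<in> ?B" by simp
  then obtain g where g: "g \<in> mod_hom R F0 M" "f = Hom_diff R n d 0 g" by (auto simp: F)
  have gd: "g x = \<phi> (u x)" if x: "x \<in> carrier F0" "e0 x = \<zero>\<^bsub>M\<^esub>" for x
  proof -
    have "x \<in> d 0 ` carrier F1" using x ex0 by simp
    then obtain w where w: "w \<in> carrier F1" "x = d 0 w" by (rule imageE)
    have "\<phi> (u (d 0 w)) = Hom_diff R n d 0 g w" using fun_cong[OF g(2), of w] w by (simp add: f_def)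
    then show ?thesis using w by (simp add: Hom_diff_def compose_def F)
  qed
  have diff: "v \<ominus>\<^bsub>F\<^esub> u (l v) \<in> Om" if v: "v \<in> carrier F" for v
  proof -
    have ul: "u (l v) \<in> carrier F" by (rule mod_hom_closed[OF u(1) mod_hom_closed[OF l(1) v]])
    have "e (v \<ominus>\<^bsub>F\<^esub> u (l v)) = e v \<ominus>\<^bsub>M\<^esub> e v"
      using mod_hom_minus[OF F.module_axioms M eF(1) v ul] u(2)[OF mod_hom_closed[OF l(1) v]] l(2)[OF v] by simp
    then show ?thesis unfolding OmF using ul v mod_hom_closed[OF eF(1) v] by (simp add: a_minus_def M.M.r_neg)
  qed
  \<comment> \<open>\<open>l\<close> and \<open>u\<close> compare the two presentations, and \<open>v - u (l v)\<close> is always a relation, on which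
    \<open>\<phi>\<close> is defined.\<close>
  define \<Phi> where "\<Phi> v = g (l v) \<oplus>\<^bsub>M\<^esub> \<phi> (v \<ominus>\<^bsub>F\<^esub> u (l v))" for v
  note lg = mod_hom_comp[OF l(1) g(1)] and lu = mod_hom_comp[OF l(1) u(1)]
  note lgc = mod_hom_closed[OF lg] and luc = mod_hom_closed[OF lu]
  have "\<Phi> \<in> mod_hom R F M"
  proof (rule mod_homI)
    fix v assume v: "v \<in> carrier F"
    show "\<Phi> v \<in> carrier M" unfolding \<Phi>_def using lgc[OF v] phic[OF diff[OF v]] by simp
    show "\<Phi> (v \<oplus>\<^bsub>F\<^esub> w) = \<Phi> v \<oplus>\<^bsub>M\<^esub> \<Phi> w" if w: "w \<in> carrier F" for w
    proof -
      have "(v \<oplus>\<^bsub>F\<^esub> w) \<ominus>\<^bsub>F\<^esub> u (l (v \<oplus>\<^bsub>F\<^esub> w)) = (v \<ominus>\<^bsub>F\<^esub> u (l v)) \<oplus>\<^bsub>F\<^esub> (w \<ominus>\<^bsub>F\<^esub> u (l w))"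
        using mod_hom_add[OF lu v w] v w luc[OF v] luc[OF w] by (simp add: a_minus_def F.minus_add F.M.a_ac)
      then show ?thesis unfolding \<Phi>_def
        using mod_hom_add[OF lg v w] phia[OF diff[OF v] diff[OF w]] lgc[OF v] lgc[OF w]
          phic[OF diff[OF v]] phic[OF diff[OF w]] by (simp add: M.M.a_ac)
    qed
    show "\<Phi> (a \<odot>\<^bsub>F\<^esub> v) = a \<odot>\<^bsub>M\<^esub> \<Phi> v" if a: "a \<in> carrier R" for a
    proof -
      have "(a \<odot>\<^bsub>F\<^esub> v) \<ominus>\<^bsub>F\<^esub> u (l (a \<odot>\<^bsub>F\<^esub> v)) = a \<odot>\<^bsub>F\<^esub> (v \<ominus>\<^bsub>F\<^esub> u (l v))"
        using mod_hom_smult[OF lu a v] v a luc[OF v] by (simp add: a_minus_def F.smult_r_distr F.smult_r_minus)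
      then show ?thesis unfolding \<Phi>_def
        using mod_hom_smult[OF lg a v] phis[OF a diff[OF v]] lgc[OF v] phic[OF diff[OF v]] a
        by (simp add: M.smult_r_distr)
    qed
  qed
  moreover have "\<Phi> v = \<phi> v" if v: "v \<in> Om" for v
  proof -
    have vF: "v \<in> carrier F" and ev: "e v = \<zero>\<^bsub>M\<^esub>" using v unfolding OmF by auto
    have lv: "l v \<in> carrier F0" by (rule mod_hom_closed[OF l(1) vF])
    have "e0 (l v) = \<zero>\<^bsub>M\<^esub>" using l(2)[OF vF] ev by simp
    then have 1: "g (l v) = \<phi> (u (l v))" by (rule gd[OF lv])
    have ulv: "u (l v) \<in> Om" unfolding OmF using luc[OF vF] u(2)[OF lv] \<open>e0 (l v) = _\<close> by simp
    have "\<phi> (u (l v) \<oplus>\<^bsub>F\<^esub> (v \<ominus>\<^bsub>F\<^esub> u (l v))) = \<Phi> v"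
      unfolding \<Phi>_def 1 by (rule phia[OF ulv diff[OF vF]])
    moreover have "u (l v) \<oplus>\<^bsub>F\<^esub> (v \<ominus>\<^bsub>F\<^esub> u (l v)) = v"
      using vF luc[OF vF] by (simp add: a_minus_def F.M.a_lcomm F.M.r_neg)
    ultimately show ?thesis by simp
  qed
  ultimately show ?thesis unfolding F_def by blast
qed

section \<open>Burch modules and minimal presentations\<close>

lemma (in module) ideal_smult_submodule:
  "\<lbrakk>I \<subseteq> carrier R; N \<subseteq> carrier M\<rbrakk> \<Longrightarrow> submodule (ideal_smult R M I N) R M"
  unfolding ideal_smult_def by (rule module_span_submodule) auto

lemma (in module) ideal_smultI: "\<lbrakk>a \<in> I; x \<in> N\<rbrakk> \<Longrightarrow> a \<odot>\<^bsub>M\<^esub> x \<in> ideal_smult R M I N"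
  unfolding ideal_smult_def by (rule subsetD[OF module_span_superset]) auto

lemma ideal_smult_hom:
  assumes M: "module R M" and N: "module R N" and f: "f \<in> mod_hom R M N" and I: "I \<subseteq> carrier R"
    and x: "x \<in> ideal_smult R M I (carrier M)"
  shows "f x \<in> ideal_smult R N I (f ` carrier M)"
proof -
  interpret M: module R M by fact
  interpret N: module R N by fact
  have sub: "submodule (ideal_smult R N I (f ` carrier M)) R N"
    by (rule N.ideal_smult_submodule[OF I]) (use mod_hom_closed[OF f] in auto)
  have "ideal_smult R M I (carrier M) \<subseteq> {x \<in> carrier M. f x \<in> ideal_smult R N I (f ` carrier M)}"
    unfolding ideal_smult_def[of R M]
  proof (rule M.module_span_minimal[OF submodule_preimage[OF M N f M.carrier_is_submodule sub]], clarify)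
    fix a y assume ay: "a \<in> I" "y \<in> carrier M"
    then have "a \<odot>\<^bsub>N\<^esub> f y \<in> ideal_smult R N I (f ` carrier M)" by (intro N.ideal_smultI) auto
    then show "a \<odot>\<^bsub>M\<^esub> y \<in> carrier M \<and> f (a \<odot>\<^bsub>M\<^esub> y) \<in> ideal_smult R N I (f ` carrier M)"
      using mod_hom_smult[OF f, of a y] ay I by auto
  qed
  then show ?thesis using x by auto
qed

text \<open>Multiplication by an element \<open>t\<close> of the overmodule with \<open>\<mm>t \<subseteq> M\<close> is a homomorphism
\<open>\<mm> \<rightarrow> M\<close>. From here on the overmodule is replaced by this homomorphism.\<close>

lemma (in noetherian_local) burch_hom:
  fixes M :: "('a, 'm, 'l) module_scheme"
  assumes M: "module R M" and b: "burch TYPE('t) R M"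
  shows "\<exists>\<tau>\<in>mod_hom R ((self_module R)\<lparr>carrier := \<mm>\<rparr>) M.
    \<exists>a\<in>\<mm>. \<tau> a \<notin> ideal_smult R M \<mm> (carrier M)"
proof -
  interpret M: module R M by fact
  obtain T :: "('a, 't) module" and f where T: "module R T" and f: "f \<in> mod_hom R M T" "inj_on f (carrier M)"
    and nsub: "\<not> ideal_smult R T \<mm> (module_colon T (f ` carrier M) \<mm>) \<subseteq> ideal_smult R T \<mm> (f ` carrier M)"
    using b unfolding burch_def by blast
  interpret T: module R T by fact
  have mc: "\<mm> \<subseteq> carrier R" using mm_carrier by auto
  let ?J = "ideal_smult R T \<mm> (f ` carrier M)"
  have sub: "submodule ?J R T" by (rule T.ideal_smult_submodule[OF mc]) (use mod_hom_closed[OF f(1)] in auto)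
  have "\<exists>a t. a \<in> \<mm> \<and> t \<in> module_colon T (f ` carrier M) \<mm> \<and> a \<odot>\<^bsub>T\<^esub> t \<notin> ?J"
  proof (rule ccontr)
    assume no: "\<not> ?thesis"
    have "ideal_smult R T \<mm> (module_colon T (f ` carrier M) \<mm>) \<subseteq> ?J"
      unfolding ideal_smult_def[of R T \<mm> "module_colon T (f ` carrier M) \<mm>"]
      by (rule T.module_span_minimal[OF sub]) (use no in blast)
    then show False using nsub by simp
  qed
  then obtain a t where a: "a \<in> \<mm>" and t: "t \<in> module_colon T (f ` carrier M) \<mm>" and at: "a \<odot>\<^bsub>T\<^esub> t \<notin> ?J"
    by (elim exE conjE)
  have tT: "t \<in> carrier T" and tm: "\<And>b. b \<in> \<mm> \<Longrightarrow> b \<odot>\<^bsub>T\<^esub> t \<in> f ` carrier M"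
    using t unfolding module_colon_def by auto
  define \<tau> where "\<tau> b = inv_into (carrier M) f (b \<odot>\<^bsub>T\<^esub> t)" for b
  have \<tau>: "\<tau> b \<in> carrier M" "f (\<tau> b) = b \<odot>\<^bsub>T\<^esub> t" if "b \<in> \<mm>" for b
    using tm[OF that] unfolding \<tau>_def by (auto intro: inv_into_into f_inv_into_f)
  note inj = inj_onD[OF f(2)]
  have "\<tau> \<in> mod_hom R ((self_module R)\<lparr>carrier := \<mm>\<rparr>) M"
  proof (rule mod_homI; simp)
    fix b c assume b: "b \<in> \<mm>" and c: "c \<in> \<mm>"
    have bc: "b \<oplus> c \<in> \<mm>" by (rule ideal_add[OF mm_ideal b c])
    show "\<tau> (b \<oplus> c) = \<tau> b \<oplus>\<^bsub>M\<^esub> \<tau> c"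
      by (rule inj) (use \<tau>[OF b] \<tau>[OF c] \<tau>[OF bc] mm_carrier b c tT mod_hom_add[OF f(1)] in
        \<open>auto simp: T.smult_l_distr\<close>)
  next
    fix r b assume r: "r \<in> carrier R" and b: "b \<in> \<mm>"
    have rb: "r \<otimes> b \<in> \<mm>" by (rule ideal_lmult[OF mm_ideal r b])
    show "\<tau> (r \<otimes> b) = r \<odot>\<^bsub>M\<^esub> \<tau> b"
      by (rule inj) (use \<tau>[OF b] \<tau>[OF rb] mm_carrier r b tT mod_hom_smult[OF f(1)] in
        \<open>auto simp: T.smult_assoc1\<close>)
  qed (use \<tau> in auto)
  moreover have "\<tau> a \<notin> ideal_smult R M \<mm> (carrier M)"
  proof
    assume "\<tau> a \<in> ideal_smult R M \<mm> (carrier M)"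
    from ideal_smult_hom[OF M T f(1) mc this] show False using \<tau>(2)[OF a] at by simp
  qed
  ultimately show ?thesis using a by blast
qed

text \<open>In a generating family of least length starting with \<open>x\<close>, no relation has a unit coefficient:
  such a coefficient at a later place makes that generator redundant, and a unit coefficient at the
  first place only would put \<open>x\<close> into \<open>\<mm>M\<close>.\<close>

lemma (in noetherian_local) minimal_presentation:
  assumes M: "module R M" and fg: "fin_gen R M"
    and x: "x \<in> carrier M" "x \<notin> ideal_smult R M \<mm> (carrier M)"
  shows "\<exists>n e. 0 < n \<and> e \<in> mod_hom R (free_mod R n) M \<and> e ` carrier (free_mod R n) = carrier M \<and>
    e (basis_vec R n 0) = x \<and> (\<forall>v\<in>carrier (free_mod R n). e v = \<zero>\<^bsub>M\<^esub> \<longrightarrow> (\<forall>j<n. v j \<in> \<mm>))"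
proof -
  interpret M: module R M by fact
  \<comment> \<open>\<open>gen n b\<close>: the \<open>n + 1\<close> elements \<open>b 0 = x, b 1, \<dots>, b n\<close> generate \<open>M\<close>\<close>
  define gen where "gen n b \<longleftrightarrow> b 0 = x \<and> (\<forall>j. b j \<in> carrier M) \<and>
    (\<forall>H. submodule H R M \<longrightarrow> b ` {..n} \<subseteq> H \<longrightarrow> H = carrier M)" for n :: nat and b
  have "\<exists>n b. gen n b"
  proof -
    obtain A where A: "finite A" "A \<subseteq> carrier M" "module_span R M A = carrier M"
      using fg by (auto simp: fin_gen_def)
    obtain k :: nat and c where kc: "A = c ` {i. i < k}"
      using finite_imp_nat_seg_image_inj_on[OF A(1)] by blast
    define b where "b j = (if j = 0 then x else if j \<le> k then c (j - 1) else x)" for j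
    have ck: "c i \<in> carrier M" if "i < k" for i using that kc A(2) by auto
    have bM: "b j \<in> carrier M" for j unfolding b_def using x(1) ck[of "j - 1"] by auto
    have "H = carrier M" if H: "submodule H R M" "b ` {..k} \<subseteq> H" for H
    proof -
      have "A \<subseteq> H"
      proof
        fix y assume "y \<in> A"
        then obtain i where "i < k" "y = c i" using kc by auto
        then have "y = b (Suc i)" "Suc i \<le> k" by (auto simp: b_def)
        then show "y \<in> H" using H(2) by auto
      qed
      from M.module_span_minimal[OF H(1) this] have "carrier M \<subseteq> H" using A(3) by simp
      then show ?thesis using M.submodule_carrier[OF H(1)] by auto
    qed
    then have "gen k b" using bM by (auto simp: gen_def b_def)
    then show ?thesis by blast
  qed
  then obtain n where n: "\<exists>b. gen n b" and least: "\<And>k. k < n \<Longrightarrow> \<nexists>b. gen k b"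
    using exists_least_iff[of "\<lambda>n. \<exists>b. gen n b"] by auto
  then obtain b where b: "gen n b" by (elim exE)
  have bM: "b j \<in> carrier M" for j using b by (simp add: gen_def)
  have b0: "b 0 = x" using b by (simp add: gen_def)
  have genH: "H = carrier M" if "submodule H R M" "b ` {..n} \<subseteq> H" for H using b that unfolding gen_def by blast
  let ?N = "Suc n" and ?F = "free_mod R (Suc n)"
  interpret F: module R ?F by (rule module_free_mod)
  have ehom: "lincomb M ?N b \<in> mod_hom R ?F M" by (rule M.lincomb_mod_hom[OF bM])
  have eb: "lincomb M ?N b (basis_vec R ?N j) = b j" if "j < ?N" for j
    by (rule M.lincomb_basis_vec[OF bM that])
  have surj: "lincomb M ?N b ` carrier ?F = carrier M"
  proof (rule genH)
    show "submodule (lincomb M ?N b ` carrier ?F) R M"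
      by (rule submodule_image[OF F.module_axioms M ehom F.carrier_is_submodule])
    show "b ` {..n} \<subseteq> lincomb M ?N b ` carrier ?F"
    proof
      fix y assume "y \<in> b ` {..n}"
      then obtain j where "y = b j" "j \<in> {..n}" by (rule imageE)
      then have j: "j < ?N" "y = b j" by simp_all
      show "y \<in> lincomb M ?N b ` carrier ?F"
        by (rule image_eqI[of _ _ "basis_vec R ?N j"]) (simp_all add: eb[OF j(1)] j(2))
    qed
  qed
  have split: "lincomb M ?N b v = v j \<odot>\<^bsub>M\<^esub> b j \<oplus>\<^bsub>M\<^esub> (\<Oplus>\<^bsub>M\<^esub>i\<in>{..<?N} - {j}. v i \<odot>\<^bsub>M\<^esub> b i)"
    if v: "v \<in> carrier ?F" and j: "j < ?N" for v j
  proof -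
    note cv = free_coord[OF v]
    have "{..<?N} = insert j ({..<?N} - {j})" using j by auto
    then have "lincomb M ?N b v = finsum M (\<lambda>i. v i \<odot>\<^bsub>M\<^esub> b i) (insert j ({..<?N} - {j}))"
      unfolding lincomb_def by simp
    also have "\<dots> = v j \<odot>\<^bsub>M\<^esub> b j \<oplus>\<^bsub>M\<^esub> (\<Oplus>\<^bsub>M\<^esub>i\<in>{..<?N} - {j}. v i \<odot>\<^bsub>M\<^esub> b i)"
      by (rule M.finsum_insert) (use cv bM j in auto)
    finally show ?thesis .
  qed
  have unit_solve: "b j \<in> H" if H: "submodule H R M" and v: "v \<in> carrier ?F" "lincomb M ?N b v = \<zero>\<^bsub>M\<^esub>"
    and j: "j < ?N" "v j \<notin> \<mm>" and rest: "\<And>i. i < ?N \<Longrightarrow> i \<noteq> j \<Longrightarrow> v i \<odot>\<^bsub>M\<^esub> b i \<in> H" for H v j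
  proof -
    note cv = free_coord[OF v(1)]
    have r: "(\<Oplus>\<^bsub>M\<^esub>i\<in>{..<?N} - {j}. v i \<odot>\<^bsub>M\<^esub> b i) \<in> H"
      by (rule M.submodule_finsum[OF H]) (use rest in auto)
    have z: "\<zero>\<^bsub>M\<^esub> = (\<Oplus>\<^bsub>M\<^esub>i\<in>{..<?N} - {j}. v i \<odot>\<^bsub>M\<^esub> b i) \<oplus>\<^bsub>M\<^esub> v j \<odot>\<^bsub>M\<^esub> b j"
      using split[OF v(1) j(1)] v(2) cv[OF j(1)] bM M.submodule_carrier[OF H r] by (simp add: M.M.a_comm)
    have "v j \<odot>\<^bsub>M\<^esub> b j \<in> H"
      by (rule M.submodule_add_cancel[OF H r]) (use z[symmetric] M.submodule_zero[OF H] cv[OF j(1)] bM in simp_all)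
    moreover obtain w where w: "w \<in> carrier R" "w \<otimes> v j = \<one>" using unit_if_notin_mm[OF cv[OF j(1)] j(2)] by (elim bexE)
    ultimately have "w \<odot>\<^bsub>M\<^esub> (v j \<odot>\<^bsub>M\<^esub> b j) \<in> H" using M.submodule_smult[OF H] by simp
    then show ?thesis using w cv[OF j(1)] bM by (simp add: M.smult_assoc1[symmetric])
  qed
  have later: "v j \<in> \<mm>" if v: "v \<in> carrier ?F" "lincomb M ?N b v = \<zero>\<^bsub>M\<^esub>" and j: "j < ?N" "0 < j" for v j
  proof (rule ccontr)
    assume vj: "v j \<notin> \<mm>"
    note cv = free_coord[OF v(1)]
    define b' where "b' i = (if i = j then b n else b i)" for i
    have npos: "0 < n" using j by simp
    have "H = carrier M" if H: "submodule H R M" "b' ` {..n - 1} \<subseteq> H" for H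
    proof (rule genH[OF H(1)])
      have other: "b i \<in> H" if i: "i < ?N" "i \<noteq> j" for i
      proof (cases "i = n")
        case True
        then have "j \<le> n - 1" "b i = b' j" using i j by (auto simp: b'_def)
        then show ?thesis using H(2) by auto
      next
        case False
        then have "i \<le> n - 1" "b i = b' i" using i by (auto simp: b'_def)
        then show ?thesis using H(2) by auto
      qed
      have "b j \<in> H"
        by (rule unit_solve[OF H(1) v j(1) vj]) (use other cv M.submodule_smult[OF H(1)] in auto)
      then show "b ` {..n} \<subseteq> H" using other by (auto simp: less_Suc_eq_le)
    qed
    then have "gen (n - 1) b'" unfolding gen_def using b0 bM j by (auto simp: b'_def)
    then show False using least[of "n - 1"] npos by auto
  qed
  have "v j \<in> \<mm>" if v: "v \<in> carrier ?F" "lincomb M ?N b v = \<zero>\<^bsub>M\<^esub>" and j: "j < ?N" for v j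
  proof (cases "j = 0")
    case True
    show ?thesis
    proof (rule ccontr)
      assume vj: "v j \<notin> \<mm>"
      have mc: "\<mm> \<subseteq> carrier R" using mm_carrier by auto
      have "b j \<in> ideal_smult R M \<mm> (carrier M)"
      proof (rule unit_solve[OF M.ideal_smult_submodule[OF mc order_refl] v j vj])
        fix i assume "i < ?N" "i \<noteq> j"
        then have "v i \<in> \<mm>" using later[OF v] True by simp
        then show "v i \<odot>\<^bsub>M\<^esub> b i \<in> ideal_smult R M \<mm> (carrier M)" by (rule M.ideal_smultI[OF _ bM])
      qed
      then show False using x(2) b0 True by simp
    qed
  qed (use later[OF v j] in simp)
  then show ?thesis using ehom surj eb[of 0] b0
    by (intro exI[of _ ?N] exI[of _ "lincomb M ?N b"]) simp
qed

section \<open>Local arguments at a prime\<close>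

lemma (in abelian_group) minus_of_zero: "\<ominus> \<zero> = \<zero>"
  using minus_equality[of \<zero> \<zero>] by simp

lemma (in cring) free_coord_minus:
  assumes v: "v \<in> carrier (free_mod R n)" and w: "w \<in> carrier (free_mod R n)" and i: "i < n"
  shows "(v \<ominus>\<^bsub>free_mod R n\<^esub> w) i = v i \<ominus> w i"
proof -
  interpret F: module R "free_mod R n" by (rule module_free_mod)
  have nc: "(\<ominus>\<^bsub>free_mod R n\<^esub> w) i \<in> carrier R" by (rule free_coord[OF F.M.a_inv_closed[OF w] i])
  have "(\<ominus>\<^bsub>free_mod R n\<^esub> w \<oplus>\<^bsub>free_mod R n\<^esub> w) i = \<zero>" unfolding F.M.l_neg[OF w] using i by simp
  then have "(\<ominus>\<^bsub>free_mod R n\<^esub> w) i \<oplus> w i = \<zero>" using i by simp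
  then have "\<ominus> w i = (\<ominus>\<^bsub>free_mod R n\<^esub> w) i" by (rule minus_equality[OF _ free_coord[OF w i] nc])
  then show ?thesis using i by (simp add: a_minus_def)
qed

lemma torsion_freeD:
  "\<lbrakk>torsion_free R M; regular_elem R a; y \<in> carrier M; a \<odot>\<^bsub>M\<^esub> y = \<zero>\<^bsub>M\<^esub>\<rbrakk> \<Longrightarrow> y = \<zero>\<^bsub>M\<^esub>"
  unfolding torsion_free_def regular_elem_def by blast

lemma (in cring) torsion_free_free: "torsion_free R (free_mod R n)"
  unfolding torsion_free_def
proof (intro ballI impI)
  interpret F: module R "free_mod R n" by (rule module_free_mod)
  fix a v assume a: "a \<in> carrier R" "\<forall>b\<in>carrier R. a \<otimes> b = \<zero> \<longrightarrow> b = \<zero>"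
    and v: "v \<in> carrier (free_mod R n)" "a \<odot>\<^bsub>free_mod R n\<^esub> v = \<zero>\<^bsub>free_mod R n\<^esub>"
  show "v = \<zero>\<^bsub>free_mod R n\<^esub>"
  proof (rule free_eqI[OF v(1) F.M.zero_closed])
    fix j assume j: "j < n"
    have "a \<otimes> v j = \<zero>" using fun_cong[OF v(2), of j] j by simp
    then show "v j = \<zero>\<^bsub>free_mod R n\<^esub> j" using a(2) free_coord[OF v(1) j] j by simp
  qed
qed

lemma (in module) ideal_module_annihilator:
  assumes "y \<in> carrier M"
  shows "ideal {s \<in> carrier R. s \<odot>\<^bsub>M\<^esub> y = \<zero>\<^bsub>M\<^esub>} R"
  by (rule cring_idealI) (use assms in \<open>auto simp: smult_l_distr smult_assoc1\<close>)

lemma (in noetherian_cring) locally_zero: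
  assumes M: "module R M" "torsion_free R M" and y: "y \<in> carrier M"
    and loc: "\<And>P. P \<in> Ass R \<Longrightarrow> \<exists>s\<in>carrier R - P. s \<odot>\<^bsub>M\<^esub> y = \<zero>\<^bsub>M\<^esub>"
  shows "y = \<zero>\<^bsub>M\<^esub>"
proof -
  interpret M: module R M by fact
  have "\<exists>a\<in>{s \<in> carrier R. s \<odot>\<^bsub>M\<^esub> y = \<zero>\<^bsub>M\<^esub>}. regular_elem R a"
  proof (rule ideal_has_regular_elem[OF M.ideal_module_annihilator[OF y]])
    show "\<not> {s \<in> carrier R. s \<odot>\<^bsub>M\<^esub> y = \<zero>\<^bsub>M\<^esub>} \<subseteq> P" if "P \<in> Ass R" for P
      using loc[OF that] by auto
  qed
  then show ?thesis using torsion_freeD[OF M(2) _ y] by auto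
qed

lemma (in module) common_multiplier:
  assumes P: "primeideal P R" and H: "submodule H R M" and Y: "finite Y" "Y \<subseteq> carrier M"
    and ex: "\<And>y. y \<in> Y \<Longrightarrow> \<exists>s\<in>carrier R - P. s \<odot>\<^bsub>M\<^esub> y \<in> H"
  shows "\<exists>s\<in>carrier R - P. \<forall>y\<in>Y. s \<odot>\<^bsub>M\<^esub> y \<in> H"
proof -
  have "\<exists>s\<in>carrier R - P. \<forall>Q\<in>(\<lambda>y. {s \<in> carrier R. s \<odot>\<^bsub>M\<^esub> y \<in> H}) ` Y. s \<in> Q"
  proof (rule prime_avoids_finite[OF P])
    show "finite ((\<lambda>y. {s \<in> carrier R. s \<odot>\<^bsub>M\<^esub> y \<in> H}) ` Y)" using Y by simp
    fix Q assume "Q \<in> (\<lambda>y. {s \<in> carrier R. s \<odot>\<^bsub>M\<^esub> y \<in> H}) ` Y"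
    then obtain y where y: "Q = {s \<in> carrier R. s \<odot>\<^bsub>M\<^esub> y \<in> H}" "y \<in> Y" by (rule imageE)
    have yM: "y \<in> carrier M" using y(2) Y(2) by auto
    show "ideal Q R" unfolding y(1)
      by (rule cring_idealI)
        (use yM submodule_zero[OF H] submodule_add[OF H] submodule_smult[OF H] in
          \<open>auto simp: smult_l_distr smult_assoc1\<close>)
    show "\<not> Q \<subseteq> P" unfolding y(1) using ex[OF y(2)] by auto
  qed
  then show ?thesis by auto
qed

text \<open>Homomorphisms to \<open>R\<close> detect the elements of \<open>M\<close> that do not vanish in \<open>M \<otimes> \<kappa>(P)\<close>. Among the submodules
\<open>L B\<close> generated by \<open>PM\<close> and the generators with index in \<open>B\<close>, take a largest one that contains no multiple of
\<open>w\<close> by an element outside \<open>P\<close>. Then every \<open>y\<close> has a multiple \<open>s y\<close>, with \<open>s \<notin> P\<close>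
independent of \<open>y\<close>, that is congruent to some \<open>v w\<close> modulo \<open>L B\<close>, and \<open>v\<close> is unique modulo \<open>P\<close>. If \<open>P\<close> is
the annihilator of \<open>c\<close>, then \<open>y \<mapsto> c v\<close> is well defined, and it sends \<open>w\<close> to \<open>c s \<noteq> 0\<close>.\<close>

lemma (in cring) functional_at_associated_prime:
  assumes M: "module R M" and e: "e \<in> mod_hom R (free_mod R n) M" "e ` carrier (free_mod R n) = carrier M"
    and PA: "P \<in> Ass R" and w: "w \<in> carrier M"
    and nin: "\<And>s v. \<lbrakk>s \<in> carrier R - P; v \<in> carrier (free_mod R n); \<forall>j<n. v j \<in> P\<rbrakk> \<Longrightarrow> s \<odot>\<^bsub>M\<^esub> w \<noteq> e v"
  shows "\<exists>f\<in>mod_hom R M (self_module R). f w \<noteq> \<zero>"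
proof -
  interpret M: module R M by fact
  let ?F = "free_mod R n"
  interpret F: module R ?F by (rule module_free_mod)
  have P: "primeideal P R" using PA by (simp add: Ass_iff)
  obtain c where c: "c \<in> carrier R" "P = annihilator R c" using PA by (auto simp: Ass_iff)
  have PI: "ideal P R" by (rule primeideal.axioms(1)[OF P])
  note ec = mod_hom_closed[OF e(1)]
  define V where "V B = {v \<in> carrier ?F. \<forall>j<n. j \<notin> B \<longrightarrow> v j \<in> P}" for B
  define L where "L B = e ` V B" for B
  have Vsub: "submodule (V B) R ?F" for B
  proof (rule F.submoduleI')
    show "u \<oplus>\<^bsub>?F\<^esub> v \<in> V B" if "u \<in> V B" "v \<in> V B" for u v
      using that ideal_add[OF PI] F.M.a_closed[of u v] by (auto simp: V_def)
    show "a \<odot>\<^bsub>?F\<^esub> v \<in> V B" if "a \<in> carrier R" "v \<in> V B" for a v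
      using that ideal_lmult[OF PI] F.smult_closed[of a v] by (auto simp: V_def)
  qed (auto simp: V_def ideal_zero[OF PI])
  have Lsub: "submodule (L B) R M" for B
    unfolding L_def by (rule submodule_image[OF F.module_axioms M e(1) Vsub])
  define good where "good B \<longleftrightarrow> (\<forall>s\<in>carrier R - P. s \<odot>\<^bsub>M\<^esub> w \<notin> L B)" for B
  have "good {}" unfolding good_def L_def V_def using nin by auto
  then have "\<exists>B\<in>{B \<in> Pow {..<n}. good B}. \<forall>B'\<in>{B \<in> Pow {..<n}. good B}. B \<subseteq> B' \<longrightarrow> B = B'"
    by (intro finite_has_maximal) auto
  then obtain B where B: "B \<subseteq> {..<n}" "good B"
    and maxB: "\<And>B'. \<lbrakk>B' \<subseteq> {..<n}; good B'; B \<subseteq> B'\<rbrakk> \<Longrightarrow> B = B'" by auto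
  define H where "H = {y \<in> carrier M. \<exists>v\<in>carrier R. y \<ominus>\<^bsub>M\<^esub> v \<odot>\<^bsub>M\<^esub> w \<in> L B}"
  have Hsub: "submodule H R M"
  proof (rule M.submoduleI')
    show "H \<subseteq> carrier M" by (auto simp: H_def)
    have "\<zero>\<^bsub>M\<^esub> \<ominus>\<^bsub>M\<^esub> \<zero> \<odot>\<^bsub>M\<^esub> w \<in> L B" using w M.submodule_zero[OF Lsub] by (simp add: a_minus_def M.M.minus_of_zero)
    then show "\<zero>\<^bsub>M\<^esub> \<in> H" unfolding H_def using zero_closed by blast
    fix y z assume "y \<in> H" "z \<in> H"
    then obtain u v where *: "y \<in> carrier M" "z \<in> carrier M" "u \<in> carrier R" "v \<in> carrier R"
      "y \<ominus>\<^bsub>M\<^esub> u \<odot>\<^bsub>M\<^esub> w \<in> L B" "z \<ominus>\<^bsub>M\<^esub> v \<odot>\<^bsub>M\<^esub> w \<in> L B" by (auto simp: H_def)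
    have "(y \<oplus>\<^bsub>M\<^esub> z) \<ominus>\<^bsub>M\<^esub> (u \<oplus> v) \<odot>\<^bsub>M\<^esub> w = (y \<ominus>\<^bsub>M\<^esub> u \<odot>\<^bsub>M\<^esub> w) \<oplus>\<^bsub>M\<^esub> (z \<ominus>\<^bsub>M\<^esub> v \<odot>\<^bsub>M\<^esub> w)"
      using *(1-4) w by (simp add: a_minus_def M.smult_l_distr M.minus_add M.M.a_ac)
    then have "(y \<oplus>\<^bsub>M\<^esub> z) \<ominus>\<^bsub>M\<^esub> (u \<oplus> v) \<odot>\<^bsub>M\<^esub> w \<in> L B" using M.submodule_add[OF Lsub *(5,6)] by simp
    then show "y \<oplus>\<^bsub>M\<^esub> z \<in> H" unfolding H_def using *(1-4) by blast
  next
    fix a y assume a: "a \<in> carrier R" and "y \<in> H"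
    then obtain u where *: "y \<in> carrier M" "u \<in> carrier R" "y \<ominus>\<^bsub>M\<^esub> u \<odot>\<^bsub>M\<^esub> w \<in> L B" by (auto simp: H_def)
    have "a \<odot>\<^bsub>M\<^esub> y \<ominus>\<^bsub>M\<^esub> (a \<otimes> u) \<odot>\<^bsub>M\<^esub> w = a \<odot>\<^bsub>M\<^esub> (y \<ominus>\<^bsub>M\<^esub> u \<odot>\<^bsub>M\<^esub> w)"
      using *(1,2) a w by (simp add: a_minus_def M.smult_r_distr M.smult_r_minus M.smult_assoc1)
    then have "a \<odot>\<^bsub>M\<^esub> y \<ominus>\<^bsub>M\<^esub> (a \<otimes> u) \<odot>\<^bsub>M\<^esub> w \<in> L B" using M.submodule_smult[OF Lsub a *(3)] by simp
    then show "a \<odot>\<^bsub>M\<^esub> y \<in> H" unfolding H_def using *(1,2) a by blast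
  qed
  let ?g = "\<lambda>j. e (basis_vec R n j)"
  have gM: "?g j \<in> carrier M" for j by (rule ec[OF basis_vec_carrier])
  have bv: "basis_vec R n j i = (if i = j then \<one> else \<zero>)" if "i < n" for i j
    using that by (simp add: basis_vec_def)
  have ex: "\<exists>s\<in>carrier R - P. s \<odot>\<^bsub>M\<^esub> y \<in> H" if y: "y \<in> ?g ` {..<n}" for y
  proof -
    obtain j where j: "j < n" "y = ?g j" using y by auto
    show ?thesis
    proof (cases "j \<in> B")
      case True
      have "basis_vec R n j \<in> V B" unfolding V_def using True bv ideal_zero[OF PI] by auto
      then have "?g j \<in> L B" unfolding L_def by (rule imageI)
      then have "\<one> \<odot>\<^bsub>M\<^esub> y \<ominus>\<^bsub>M\<^esub> \<zero> \<odot>\<^bsub>M\<^esub> w \<in> L B" using gM w unfolding j(2) by (simp add: a_minus_def M.M.minus_of_zero)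
      then have "\<one> \<odot>\<^bsub>M\<^esub> y \<in> H" unfolding H_def using zero_closed gM j(2) by auto
      then show ?thesis using prime_one_notin[OF P] by blast
    next
      case False
      have "\<not> good (insert j B)" using maxB[of "insert j B"] B(1) j(1) False by auto
      then obtain s where s: "s \<in> carrier R - P" "s \<odot>\<^bsub>M\<^esub> w \<in> L (insert j B)" unfolding good_def by blast
      then obtain u where u: "u \<in> V (insert j B)" "s \<odot>\<^bsub>M\<^esub> w = e u" unfolding L_def by (elim imageE)
      have uF: "u \<in> carrier ?F" and uP: "\<And>i. \<lbrakk>i < n; i \<noteq> j; i \<notin> B\<rbrakk> \<Longrightarrow> u i \<in> P" using u(1) by (auto simp: V_def)
      note cu = free_coord[OF uF]
      have ujP: "u j \<notin> P"
      proof
        assume "u j \<in> P"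
        then have "u \<in> V B" unfolding V_def using uF uP by auto
        then show False using B(2) s(1) u(2) unfolding good_def L_def by auto
      qed
      define u' where "u' = (u j \<odot>\<^bsub>?F\<^esub> basis_vec R n j) \<ominus>\<^bsub>?F\<^esub> u"
      have u'F: "u' \<in> carrier ?F" unfolding u'_def using cu[OF j(1)] uF by simp
      have u'i: "u' i = u j \<otimes> (if i = j then \<one> else \<zero>) \<ominus> u i" if i: "i < n" for i
        unfolding u'_def using free_coord_minus[OF _ uF i, of "u j \<odot>\<^bsub>?F\<^esub> basis_vec R n j"]
          i bv[OF i] cu[OF j(1)] by simp
      have "u' \<in> V B" unfolding V_def using u'F
      proof (intro CollectI conjI allI impI)
        fix i assume i: "i < n" "i \<notin> B"
        show "u' i \<in> P"
        proof (cases "i = j")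
          case True
          then show ?thesis using u'i[OF i(1)] cu[OF i(1)] ideal_zero[OF PI] by (simp add: a_minus_def r_neg)
        next
          case False
          then have "\<ominus> u i \<in> P" using uP i ideal_uminus[OF PI] by simp
          then show ?thesis using u'i[OF i(1)] False cu[OF i(1)] cu[OF j(1)] by (simp add: a_minus_def)
        qed
      qed
      then have "e u' \<in> L B" unfolding L_def by (rule imageI)
      moreover have "e u' = u j \<odot>\<^bsub>M\<^esub> y \<ominus>\<^bsub>M\<^esub> s \<odot>\<^bsub>M\<^esub> w"
        unfolding u'_def u(2) j(2)
        using mod_hom_minus[OF F.module_axioms M e(1) _ uF] mod_hom_smult[OF e(1)] cu[OF j(1)] by simp
      ultimately have "u j \<odot>\<^bsub>M\<^esub> y \<in> H" unfolding H_def using s(1) cu[OF j(1)] gM j(2) by auto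
      then show ?thesis using ujP cu[OF j(1)] by blast
    qed
  qed
  obtain s where s: "s \<in> carrier R - P" "\<forall>y\<in>?g ` {..<n}. s \<odot>\<^bsub>M\<^esub> y \<in> H"
    using M.common_multiplier[OF P Hsub _ _ ex] gM by (metis (no_types, lifting) finite_imageI finite_lessThan image_subsetI)
  have sc: "s \<in> carrier R" using s(1) by simp
  have sH: "s \<odot>\<^bsub>M\<^esub> y \<in> H" if y: "y \<in> carrier M" for y
  proof -
    obtain v where v: "v \<in> carrier ?F" "y = e v" using y e(2) by (metis imageE)
    note cv = free_coord[OF v(1)]
    have "s \<odot>\<^bsub>M\<^esub> y = e (s \<odot>\<^bsub>?F\<^esub> v)" using v mod_hom_smult[OF e(1) sc] by simp
    also have "\<dots> = lincomb M n ?g (s \<odot>\<^bsub>?F\<^esub> v)" by (rule M.hom_from_free[OF e(1)]) (use v sc in simp)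
    also have "\<dots> \<in> H"
    proof (rule M.lincomb_in_submodule[OF Hsub])
      fix j assume j: "j < n"
      have "(s \<odot>\<^bsub>?F\<^esub> v) j \<odot>\<^bsub>M\<^esub> ?g j = v j \<odot>\<^bsub>M\<^esub> (s \<odot>\<^bsub>M\<^esub> ?g j)"
        using j sc cv[OF j] gM by (simp add: M.smult_assoc1[symmetric] m_comm)
      then show "(s \<odot>\<^bsub>?F\<^esub> v) j \<odot>\<^bsub>M\<^esub> ?g j \<in> H" using M.submodule_smult[OF Hsub cv[OF j]] s(2) j by simp
    qed
    finally show ?thesis .
  qed
  define p where "p y = (SOME v. v \<in> carrier R \<and> s \<odot>\<^bsub>M\<^esub> y \<ominus>\<^bsub>M\<^esub> v \<odot>\<^bsub>M\<^esub> w \<in> L B)" for y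
  have p: "p y \<in> carrier R" "s \<odot>\<^bsub>M\<^esub> y \<ominus>\<^bsub>M\<^esub> p y \<odot>\<^bsub>M\<^esub> w \<in> L B" if "y \<in> carrier M" for y
  proof -
    have "\<exists>v. v \<in> carrier R \<and> s \<odot>\<^bsub>M\<^esub> y \<ominus>\<^bsub>M\<^esub> v \<odot>\<^bsub>M\<^esub> w \<in> L B" using sH[OF that] by (auto simp: H_def)
    from someI_ex[OF this] show "p y \<in> carrier R" "s \<odot>\<^bsub>M\<^esub> y \<ominus>\<^bsub>M\<^esub> p y \<odot>\<^bsub>M\<^esub> w \<in> L B" by (simp_all add: p_def)
  qed
  have uniq: "c \<otimes> p y = c \<otimes> v" if y: "y \<in> carrier M" and v: "v \<in> carrier R" "s \<odot>\<^bsub>M\<^esub> y \<ominus>\<^bsub>M\<^esub> v \<odot>\<^bsub>M\<^esub> w \<in> L B" for y v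
  proof -
    have "(s \<odot>\<^bsub>M\<^esub> y \<ominus>\<^bsub>M\<^esub> v \<odot>\<^bsub>M\<^esub> w) \<ominus>\<^bsub>M\<^esub> (s \<odot>\<^bsub>M\<^esub> y \<ominus>\<^bsub>M\<^esub> p y \<odot>\<^bsub>M\<^esub> w) = (p y \<ominus> v) \<odot>\<^bsub>M\<^esub> w"
    proof -
      have "(p y \<ominus> v) \<odot>\<^bsub>M\<^esub> w = p y \<odot>\<^bsub>M\<^esub> w \<oplus>\<^bsub>M\<^esub> \<ominus>\<^bsub>M\<^esub> (v \<odot>\<^bsub>M\<^esub> w)"
        using p(1)[OF y] v(1) w by (simp add: a_minus_def M.smult_l_distr M.smult_l_minus)
      moreover have "(s \<odot>\<^bsub>M\<^esub> y \<ominus>\<^bsub>M\<^esub> v \<odot>\<^bsub>M\<^esub> w) \<ominus>\<^bsub>M\<^esub> (s \<odot>\<^bsub>M\<^esub> y \<ominus>\<^bsub>M\<^esub> p y \<odot>\<^bsub>M\<^esub> w)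
          = p y \<odot>\<^bsub>M\<^esub> w \<oplus>\<^bsub>M\<^esub> \<ominus>\<^bsub>M\<^esub> (v \<odot>\<^bsub>M\<^esub> w)"
        using p(1)[OF y] v(1) w y sc
        by (simp add: a_minus_def M.minus_add M.M.a_ac M.r_neg1 M.r_neg2)
      ultimately show ?thesis by simp
    qed
    then have "(p y \<ominus> v) \<odot>\<^bsub>M\<^esub> w \<in> L B" using M.submodule_minus[OF Lsub v(2) p(2)[OF y]] by simp
    then have "p y \<ominus> v \<in> P" using B(2) p(1)[OF y] v(1) unfolding good_def by auto
    then have "(p y \<ominus> v) \<otimes> c = \<zero>" unfolding c(2) annihilator_def by simp
    then have "c \<otimes> p y \<ominus> c \<otimes> v = \<zero>" using p(1)[OF y] v(1) c(1)
      by (simp add: a_minus_def l_distr l_minus m_comm[of c])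
    then show ?thesis using r_right_minus_eq[of "c \<otimes> p y" "c \<otimes> v"] p(1)[OF y] v(1) c(1) by simp
  qed
  have "(\<lambda>y. c \<otimes> p y) \<in> mod_hom R M (self_module R)"
  proof (rule mod_homI; simp)
    show "c \<otimes> p y \<in> carrier R" if "y \<in> carrier M" for y using p(1)[OF that] c(1) by simp
    fix y assume y: "y \<in> carrier M"
    show "c \<otimes> p (y \<oplus>\<^bsub>M\<^esub> z) = c \<otimes> p y \<oplus> c \<otimes> p z" if z: "z \<in> carrier M" for z
    proof -
      have "s \<odot>\<^bsub>M\<^esub> (y \<oplus>\<^bsub>M\<^esub> z) \<ominus>\<^bsub>M\<^esub> (p y \<oplus> p z) \<odot>\<^bsub>M\<^esub> w =
          (s \<odot>\<^bsub>M\<^esub> y \<ominus>\<^bsub>M\<^esub> p y \<odot>\<^bsub>M\<^esub> w) \<oplus>\<^bsub>M\<^esub> (s \<odot>\<^bsub>M\<^esub> z \<ominus>\<^bsub>M\<^esub> p z \<odot>\<^bsub>M\<^esub> w)"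
        using y z w sc p(1)[OF y] p(1)[OF z]
        by (simp add: a_minus_def M.smult_r_distr M.smult_l_distr M.minus_add M.M.a_ac)
      then have "c \<otimes> p (y \<oplus>\<^bsub>M\<^esub> z) = c \<otimes> (p y \<oplus> p z)"
        using M.submodule_add[OF Lsub p(2)[OF y] p(2)[OF z]] y z p(1)[OF y] p(1)[OF z] by (intro uniq) simp_all
      then show ?thesis using c(1) p(1)[OF y] p(1)[OF z] by (simp add: r_distr)
    qed
    show "c \<otimes> p (a \<odot>\<^bsub>M\<^esub> y) = a \<otimes> (c \<otimes> p y)" if a: "a \<in> carrier R" for a
    proof -
      have "s \<odot>\<^bsub>M\<^esub> (a \<odot>\<^bsub>M\<^esub> y) \<ominus>\<^bsub>M\<^esub> (a \<otimes> p y) \<odot>\<^bsub>M\<^esub> w = a \<odot>\<^bsub>M\<^esub> (s \<odot>\<^bsub>M\<^esub> y \<ominus>\<^bsub>M\<^esub> p y \<odot>\<^bsub>M\<^esub> w)"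
        using y w sc a p(1)[OF y]
        by (simp add: a_minus_def M.smult_r_distr M.smult_r_minus M.smult_assoc1[symmetric] m_comm)
      then have "c \<otimes> p (a \<odot>\<^bsub>M\<^esub> y) = c \<otimes> (a \<otimes> p y)"
        using M.submodule_smult[OF Lsub a p(2)[OF y]] y a p(1)[OF y] by (intro uniq) simp_all
      then show ?thesis using c(1) p(1)[OF y] a by (simp add: m_lcomm)
    qed
  qed
  moreover have "c \<otimes> p w \<noteq> \<zero>"
  proof -
    have "s \<odot>\<^bsub>M\<^esub> w \<ominus>\<^bsub>M\<^esub> s \<odot>\<^bsub>M\<^esub> w \<in> L B"
      using w sc M.submodule_zero[OF Lsub] by (simp add: a_minus_def M.M.r_neg)
    then have "c \<otimes> p w = c \<otimes> s" by (rule uniq[OF w sc])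
    moreover have "s \<otimes> c \<noteq> \<zero>" using s(1) unfolding c(2) annihilator_def by auto
    ultimately show ?thesis using c(1) sc by (simp add: m_comm)
  qed
  ultimately show ?thesis by (intro bexI[of _ "\<lambda>y. c \<otimes> p y"])
qed

text \<open>If \<open>\<theta>\<close> maps \<open>M\<close> into \<open>PM\<close> locally at a minimal prime \<open>P\<close>, it is locally nilpotent, because \<open>P\<close> is.
Let \<open>N\<close> be the locally \<open>\<theta>\<close>-nilpotent part of \<open>M\<close>, and suppose that the ideal \<open>C\<close> of all \<open>c\<close> with
\<open>cM \<subseteq> N\<close> is proper. There is \<open>c \<notin> C\<close> with \<open>cP \<subseteq> C\<close>. Then \<open>\<theta>(cM) \<subseteq> cPM \<subseteq> N\<close> locally, so
\<open>cM \<subseteq> N\<close>, a contradiction.\<close>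

lemma (in noetherian_cring) locally_nilpotent:
  assumes M: "module R M" and e: "e \<in> mod_hom R (free_mod R n) M"
    and PM: "P \<in> MinPrimes R" and h: "\<theta> \<in> mod_hom R M M"
    and im: "\<And>y. y \<in> carrier M \<Longrightarrow>
      \<exists>s\<in>carrier R - P. \<exists>v\<in>carrier (free_mod R n). (\<forall>j<n. v j \<in> P) \<and> s \<odot>\<^bsub>M\<^esub> \<theta> y = e v"
    and y: "y \<in> carrier M"
  shows "\<exists>k. \<exists>s\<in>carrier R - P. s \<odot>\<^bsub>M\<^esub> (\<theta> ^^ k) y = \<zero>\<^bsub>M\<^esub>"
proof -
  interpret M: module R M by fact
  let ?F = "free_mod R n"
  interpret F: module R ?F by (rule module_free_mod)
  have P: "primeideal P R" using PM by (simp add: MinPrimes_def)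
  note hk = mod_hom_funpow[OF h] and hc = mod_hom_closed[OF mod_hom_funpow[OF h]]
  define N where "N = {y \<in> carrier M. \<exists>k. \<exists>s\<in>carrier R - P. s \<odot>\<^bsub>M\<^esub> (\<theta> ^^ k) y = \<zero>\<^bsub>M\<^esub>}"
  have up: "s \<odot>\<^bsub>M\<^esub> (\<theta> ^^ (l + k)) y = \<zero>\<^bsub>M\<^esub>"
    if "s \<in> carrier R" "y \<in> carrier M" "s \<odot>\<^bsub>M\<^esub> (\<theta> ^^ k) y = \<zero>\<^bsub>M\<^esub>" for s y k l
  proof -
    have "s \<odot>\<^bsub>M\<^esub> (\<theta> ^^ (l + k)) y = (\<theta> ^^ l) (s \<odot>\<^bsub>M\<^esub> (\<theta> ^^ k) y)"
      using mod_hom_smult[OF hk that(1) hc[OF that(2)]] by (simp add: funpow_add)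
    then show ?thesis using mod_hom_zero[OF M M hk] that(3) by simp
  qed
  have Nsub: "submodule N R M"
  proof (rule M.submoduleI')
    show "N \<subseteq> carrier M" by (auto simp: N_def)
    show "\<zero>\<^bsub>M\<^esub> \<in> N" unfolding N_def using prime_one_notin[OF P] by (auto intro!: exI[of _ "0::nat"] bexI[of _ \<one>])
    fix y z assume "y \<in> N" "z \<in> N"
    then obtain k l s t where *: "y \<in> carrier M" "z \<in> carrier M" "s \<in> carrier R - P" "t \<in> carrier R - P"
      "s \<odot>\<^bsub>M\<^esub> (\<theta> ^^ k) y = \<zero>\<^bsub>M\<^esub>" "t \<odot>\<^bsub>M\<^esub> (\<theta> ^^ l) z = \<zero>\<^bsub>M\<^esub>" by (auto simp: N_def)
    have st: "s \<in> carrier R" "t \<in> carrier R" using *(3,4) by auto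
    have 1: "s \<odot>\<^bsub>M\<^esub> (\<theta> ^^ (k + l)) y = \<zero>\<^bsub>M\<^esub>" using up[OF st(1) *(1,5), of l] by (simp add: add.commute)
    have 2: "t \<odot>\<^bsub>M\<^esub> (\<theta> ^^ (k + l)) z = \<zero>\<^bsub>M\<^esub>" using up[OF st(2) *(2,6), of k] .
    have "(s \<otimes> t) \<odot>\<^bsub>M\<^esub> (\<theta> ^^ (k + l)) (y \<oplus>\<^bsub>M\<^esub> z) =
        t \<odot>\<^bsub>M\<^esub> (s \<odot>\<^bsub>M\<^esub> (\<theta> ^^ (k + l)) y) \<oplus>\<^bsub>M\<^esub> s \<odot>\<^bsub>M\<^esub> (t \<odot>\<^bsub>M\<^esub> (\<theta> ^^ (k + l)) z)"
      using mod_hom_add[OF hk *(1,2)] hc[OF *(1)] hc[OF *(2)] st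
      by (simp add: M.smult_r_distr M.smult_assoc1[symmetric] m_comm)
    also have "\<dots> = \<zero>\<^bsub>M\<^esub>" unfolding 1 2 using st by simp
    finally show "y \<oplus>\<^bsub>M\<^esub> z \<in> N" unfolding N_def using prime_complement_mult[OF P *(3,4)] *(1,2) by blast
  next
    fix a y assume a: "a \<in> carrier R" and "y \<in> N"
    then obtain k s where *: "y \<in> carrier M" "s \<in> carrier R - P" "s \<odot>\<^bsub>M\<^esub> (\<theta> ^^ k) y = \<zero>\<^bsub>M\<^esub>" by (auto simp: N_def)
    have "s \<odot>\<^bsub>M\<^esub> (\<theta> ^^ k) (a \<odot>\<^bsub>M\<^esub> y) = a \<odot>\<^bsub>M\<^esub> (s \<odot>\<^bsub>M\<^esub> (\<theta> ^^ k) y)"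
      using mod_hom_smult[OF hk a *(1)] hc[OF *(1)] a *(2) by (simp add: M.smult_assoc1[symmetric] m_comm)
    then have "s \<odot>\<^bsub>M\<^esub> (\<theta> ^^ k) (a \<odot>\<^bsub>M\<^esub> y) = \<zero>\<^bsub>M\<^esub>" using *(3) a by simp
    then show "a \<odot>\<^bsub>M\<^esub> y \<in> N" unfolding N_def using *(1,2) a by blast
  qed
  have sat: "y \<in> N" if y: "y \<in> carrier M" "s \<in> carrier R - P" "s \<odot>\<^bsub>M\<^esub> y \<in> N" for s y
  proof -
    obtain k t where *: "t \<in> carrier R - P" "t \<odot>\<^bsub>M\<^esub> (\<theta> ^^ k) (s \<odot>\<^bsub>M\<^esub> y) = \<zero>\<^bsub>M\<^esub>" using y(3) by (auto simp: N_def)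
    have "(t \<otimes> s) \<odot>\<^bsub>M\<^esub> (\<theta> ^^ k) y = \<zero>\<^bsub>M\<^esub>"
      using *(2) mod_hom_smult[OF hk _ y(1), of s] hc[OF y(1)] y(2) *(1) by (simp add: M.smult_assoc1)
    then show ?thesis unfolding N_def using prime_complement_mult[OF P *(1) y(2)] y(1) by blast
  qed
  have shift: "y \<in> N" if y: "y \<in> carrier M" "\<theta> y \<in> N" for y
  proof -
    obtain k t where *: "t \<in> carrier R - P" "t \<odot>\<^bsub>M\<^esub> (\<theta> ^^ k) (\<theta> y) = \<zero>\<^bsub>M\<^esub>" using y(2) by (auto simp: N_def)
    then have "t \<odot>\<^bsub>M\<^esub> (\<theta> ^^ Suc k) y = \<zero>\<^bsub>M\<^esub>" by (simp add: funpow_swap1)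
    then show ?thesis unfolding N_def using y(1) *(1) by blast
  qed
  define C where "C = {c \<in> carrier R. \<forall>y\<in>carrier M. c \<odot>\<^bsub>M\<^esub> y \<in> N}"
  have "\<one> \<in> C"
  proof (rule ccontr)
    assume one: "\<one> \<notin> C"
    have CI: "ideal C R"
      by (rule cring_idealI)
        (use M.submodule_zero[OF Nsub] M.submodule_add[OF Nsub] M.submodule_smult[OF Nsub] in
          \<open>auto simp: C_def M.smult_l_distr M.smult_assoc1\<close>)
    have "\<exists>c\<in>carrier R. c \<notin> C \<and> (\<forall>b\<in>P. c \<otimes> b \<in> C)"
    proof (rule ex_absorbing_elem[OF CI one])
      show "P \<subseteq> carrier R" using ideal_carrier[OF primeideal.axioms(1)[OF P]] by auto
      fix b c assume b: "b \<in> P" and c: "c \<in> carrier R"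
      have bc: "b \<in> carrier R" by (rule ideal_carrier[OF primeideal.axioms(1)[OF P] b])
      obtain s k where s: "s \<in> carrier R - P" "s \<otimes> b [^] (k::nat) = \<zero>"
        using minimal_prime_nilpotent[OF PM b] by (elim bexE exE)
      have sc: "s \<in> carrier R" using s(1) by simp
      have "(c \<otimes> b [^] k) \<odot>\<^bsub>M\<^esub> y \<in> N" if y: "y \<in> carrier M" for y
      proof -
        have "s \<odot>\<^bsub>M\<^esub> ((c \<otimes> b [^] k) \<odot>\<^bsub>M\<^esub> y) = (c \<otimes> (s \<otimes> b [^] k)) \<odot>\<^bsub>M\<^esub> y"
          using y sc c bc by (simp add: M.smult_assoc1[symmetric] m_ac)
        also have "\<dots> \<in> N" unfolding s(2) using c y M.submodule_zero[OF Nsub] by simp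
        finally have "s \<odot>\<^bsub>M\<^esub> ((c \<otimes> b [^] k) \<odot>\<^bsub>M\<^esub> y) \<in> N" .
        from sat[OF _ s(1) this] show ?thesis using y c bc by simp
      qed
      then show "\<exists>k::nat. c \<otimes> b [^] k \<in> C" unfolding C_def using c bc by (intro exI[of _ k]) simp
    qed
    then obtain c where c: "c \<in> carrier R" "c \<notin> C" and Pc: "\<forall>b\<in>P. c \<otimes> b \<in> C" by (elim bexE conjE)
    have "c \<odot>\<^bsub>M\<^esub> y \<in> N" if y: "y \<in> carrier M" for y
    proof -
      obtain s v where s: "s \<in> carrier R - P" and v: "v \<in> carrier ?F" "\<forall>j<n. v j \<in> P" "s \<odot>\<^bsub>M\<^esub> \<theta> y = e v"
        using im[OF y] by (elim bexE conjE)
      have sc: "s \<in> carrier R" using s by simp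
      have ty: "\<theta> y \<in> carrier M" by (rule mod_hom_closed[OF h y])
      have "s \<odot>\<^bsub>M\<^esub> \<theta> (c \<odot>\<^bsub>M\<^esub> y) = c \<odot>\<^bsub>M\<^esub> (s \<odot>\<^bsub>M\<^esub> \<theta> y)"
        using mod_hom_smult[OF h c(1) y] ty sc c(1) by (simp add: M.smult_assoc1[symmetric] m_comm)
      also have "\<dots> = e (c \<odot>\<^bsub>?F\<^esub> v)" unfolding v(3) using mod_hom_smult[OF e c(1) v(1)] by simp
      also have "\<dots> = lincomb M n (\<lambda>j. e (basis_vec R n j)) (c \<odot>\<^bsub>?F\<^esub> v)"
        by (rule M.hom_from_free[OF e]) (use v(1) c(1) in simp)
      also have "\<dots> \<in> N"
      proof (rule M.lincomb_in_submodule[OF Nsub])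
        fix j assume j: "j < n"
        have "c \<otimes> v j \<in> C" using Pc v(2) j by simp
        then show "(c \<odot>\<^bsub>?F\<^esub> v) j \<odot>\<^bsub>M\<^esub> e (basis_vec R n j) \<in> N"
          using j mod_hom_closed[OF e basis_vec_carrier] by (simp add: C_def)
      qed
      finally have "s \<odot>\<^bsub>M\<^esub> \<theta> (c \<odot>\<^bsub>M\<^esub> y) \<in> N" .
      from sat[OF _ s this] have "\<theta> (c \<odot>\<^bsub>M\<^esub> y) \<in> N" using mod_hom_closed[OF h] c(1) y by simp
      from shift[OF _ this] show ?thesis using c(1) y by simp
    qed
    then show False using c unfolding C_def by simp
  qed
  then have "\<one> \<odot>\<^bsub>M\<^esub> y \<in> N" using y unfolding C_def by blast
  then show ?thesis using y unfolding N_def by simp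
qed

text \<open>A local form of the fact that a surjective endomorphism of a Noetherian module is injective.
  Start from \<open>v\<close> in the kernel and divide by \<open>\<theta>\<close> repeatedly (up to units at \<open>P\<close>): the
  \<open>k\<close>-th quotient is killed by \<open>\<theta>\<^bsup>k+1\<^esup>\<close>, while \<open>\<theta>\<^sup>k\<close> returns it to a unit times \<open>v\<close>. Once a quotient lies in
  the span of the earlier ones, \<open>v\<close> is locally zero.\<close>

lemma locally_surjective_injective:
  assumes N: "module R N" and acc: "acc_on R N (carrier N)" and P: "primeideal P R"
    and h: "\<theta> \<in> mod_hom R N N"
    and surj: "\<And>y. y \<in> carrier N \<Longrightarrow> \<exists>t\<in>carrier R - P. \<exists>w\<in>carrier N. \<theta> w = t \<odot>\<^bsub>N\<^esub> y"
    and v: "v \<in> carrier N" "\<theta> v = \<zero>\<^bsub>N\<^esub>"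
  shows "\<exists>t\<in>carrier R - P. t \<odot>\<^bsub>N\<^esub> v = \<zero>\<^bsub>N\<^esub>"
proof -
  interpret N: module R N by fact
  obtain t w where tw: "\<And>y. y \<in> carrier N \<Longrightarrow> t y \<in> carrier R - P \<and> w y \<in> carrier N \<and> \<theta> (w y) = t y \<odot>\<^bsub>N\<^esub> y"
    using surj by metis
  define y where "y k = (w ^^ k) v" for k
  have yN: "y k \<in> carrier N" for k by (induction k) (use v tw in \<open>auto simp: y_def\<close>)
  have returns: "\<exists>T\<in>carrier R - P. (\<theta> ^^ k) (y k) = T \<odot>\<^bsub>N\<^esub> v" for k
  proof (induction k)
    case 0
    then show ?case using N.prime_one_notin[OF P] v by (intro bexI[of _ "\<one>\<^bsub>R\<^esub>"]) (auto simp: y_def)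
  next
    case (Suc k)
    then obtain T where T: "T \<in> carrier R - P" "(\<theta> ^^ k) (y k) = T \<odot>\<^bsub>N\<^esub> v" by (elim bexE)
    have tk: "t (y k) \<in> carrier R - P" using tw[OF yN] by simp
    have "(\<theta> ^^ Suc k) (y (Suc k)) = (\<theta> ^^ k) (\<theta> (w (y k)))" by (simp add: y_def funpow_swap1)
    also have "\<dots> = t (y k) \<odot>\<^bsub>N\<^esub> (T \<odot>\<^bsub>N\<^esub> v)"
      using tw[OF yN[of k]] mod_hom_smult[OF mod_hom_funpow[OF h] _ yN[of k], of "t (y k)" k] T(2) by simp
    also have "\<dots> = (t (y k) \<otimes>\<^bsub>R\<^esub> T) \<odot>\<^bsub>N\<^esub> v" using tk T(1) v(1) by (simp add: N.smult_assoc1)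
    finally show ?case using N.prime_complement_mult[OF P tk T(1)] by blast
  qed
  obtain K where K: "\<forall>k. y k \<in> module_span R N (y ` {..<K})" using acc_onD[of R N _ y, OF acc yN] by (rule exE)
  have "y k \<in> {z \<in> carrier N. (\<theta> ^^ K) z = \<zero>\<^bsub>N\<^esub>}" if k: "k < K" for k
  proof -
    obtain T where T: "T \<in> carrier R - P" "(\<theta> ^^ k) (y k) = T \<odot>\<^bsub>N\<^esub> v" using returns by blast
    have "\<theta> (T \<odot>\<^bsub>N\<^esub> v) = \<zero>\<^bsub>N\<^esub>" using mod_hom_smult[OF h _ v(1), of T] T(1) v(2) by simp
    then have "(\<theta> ^^ Suc k) (y k) = \<zero>\<^bsub>N\<^esub>" using T(2) by simp
    moreover have "(\<theta> ^^ K) (y k) = (\<theta> ^^ (K - Suc k)) ((\<theta> ^^ Suc k) (y k))"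
    proof -
      have "K = (K - Suc k) + Suc k" using k by simp
      then show ?thesis by (metis funpow_add comp_apply)
    qed
    ultimately have "(\<theta> ^^ K) (y k) = \<zero>\<^bsub>N\<^esub>" using mod_hom_zero[OF N N mod_hom_funpow[OF h]] by simp
    then show ?thesis using yN by simp
  qed
  then have "y ` {..<K} \<subseteq> {z \<in> carrier N. (\<theta> ^^ K) z = \<zero>\<^bsub>N\<^esub>}" by auto
  from N.module_span_minimal[OF submodule_kernel[OF N N mod_hom_funpow[OF h]] this] K
  have "(\<theta> ^^ K) (y K) = \<zero>\<^bsub>N\<^esub>" by auto
  then show ?thesis using returns[of K] by auto
qed

text \<open>Modulo a prime, \<open>R\<^sup>n\<close> does not embed into \<open>R\<^sup>r\<close> for \<open>r < n\<close>: following the map by the inclusion of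
  \<open>R\<^sup>r\<close> into \<open>R\<^sup>n\<close>, the iterated images of the last basis vector would be independent modulo \<open>P\<close>.\<close>

lemma (in noetherian_cring) rank_le_of_injective_mod_prime:
  assumes P: "primeideal P R" and A: "A \<in> mod_hom R (free_mod R n) (free_mod R r)"
    and inj: "\<And>v. \<lbrakk>v \<in> carrier (free_mod R n); \<forall>i<r. A v i \<in> P\<rbrakk> \<Longrightarrow> \<forall>j<n. v j \<in> P"
  shows "n \<le> r"
proof (rule ccontr)
  assume "\<not> n \<le> r"
  then have rn: "r < n" by simp
  let ?F = "free_mod R n"
  interpret F: module R ?F by (rule module_free_mod)
  have PI: "ideal P R" by (rule primeideal.axioms(1)[OF P])
  define p where "p = n - 1"
  have p: "p < n" "r \<le> p" using rn by (auto simp: p_def)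
  note Ac = free_coord[OF mod_hom_closed[OF A]]
  define \<theta> where "\<theta> v = (\<lambda>i\<in>{..<n}. if i < r then A v i else \<zero>)" for v
  have h: "\<theta> \<in> mod_hom R ?F ?F"
  proof (rule mod_homI)
    fix v assume v: "v \<in> carrier ?F"
    show "\<theta> v \<in> carrier ?F" unfolding free_carrier_iff \<theta>_def using Ac[OF v] by auto
    show "\<theta> (v \<oplus>\<^bsub>?F\<^esub> w) = \<theta> v \<oplus>\<^bsub>?F\<^esub> \<theta> w" if w: "w \<in> carrier ?F" for w
      using mod_hom_add[OF A v w] by (auto simp: \<theta>_def free_mod_eq intro!: restrict_ext)
    show "\<theta> (a \<odot>\<^bsub>?F\<^esub> v) = a \<odot>\<^bsub>?F\<^esub> \<theta> v" if a: "a \<in> carrier R" for a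
      using mod_hom_smult[OF A a v] a by (auto simp: \<theta>_def free_mod_eq intro!: restrict_ext)
  qed
  note hc = mod_hom_closed[OF h]
  define inP where "inP v \<longleftrightarrow> (\<forall>j<n. v j \<in> P)" for v :: "nat \<Rightarrow> 'a"
  have inj': "inP v" if v: "v \<in> carrier ?F" "inP (\<theta> v)" for v
  proof -
    have "A v i \<in> P" if i: "i < r" for i
    proof -
      have "\<theta> v i \<in> P" using v(2) i rn by (simp add: inP_def)
      then show ?thesis using i rn by (simp add: \<theta>_def)
    qed
    then show ?thesis using inj[OF v(1)] by (simp add: inP_def)
  qed
  define y where "y k = (\<theta> ^^ k) (basis_vec R n p)" for k
  have yF: "y k \<in> carrier ?F" for k
    unfolding y_def by (rule mod_hom_closed[OF mod_hom_funpow[OF h] basis_vec_carrier])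
  have indep: "\<forall>k<N. d k \<in> P" if "\<forall>k<N. d k \<in> carrier R" "inP (lincomb ?F N y d)" for N d
    using that
  proof (induction N arbitrary: d)
    case 0
    then show ?case by simp
  next
    case (Suc N)
    have dc: "d k \<in> carrier R" if "k < Suc N" for k using Suc.prems(1) that by simp
    let ?d' = "\<lambda>k. d (Suc k)"
    have lN: "lincomb ?F N y ?d' \<in> carrier ?F" by (rule F.lincomb_closed) (use yF dc in auto)
    have "lincomb ?F (Suc N) y d = lincomb ?F N (\<lambda>k. y (Suc k)) ?d' \<oplus>\<^bsub>?F\<^esub> d 0 \<odot>\<^bsub>?F\<^esub> y 0"
    proof (cases N)
      case 0
      then show ?thesis using dc[of 0] yF by (simp add: lincomb_def lessThan_Suc)
    next
      case (Suc m)
      have "(\<lambda>k. d k \<odot>\<^bsub>?F\<^esub> y k) \<in> {..Suc m} \<rightarrow> carrier ?F" using dc yF Suc by auto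
      from F.M.finsum_Suc2[OF this] show ?thesis unfolding lincomb_def Suc lessThan_Suc_atMost .
    qed
    also have "lincomb ?F N (\<lambda>k. y (Suc k)) ?d' = \<theta> (lincomb ?F N y ?d')"
    proof -
      have "\<theta> (lincomb ?F N y ?d') = lincomb ?F N (\<lambda>k. \<theta> (y k)) ?d'"
        by (rule F.lincomb_hom[OF F.module_axioms h]) (use yF dc in auto)
      then show ?thesis by (simp add: y_def)
    qed
    finally have eq: "lincomb ?F (Suc N) y d = \<theta> (lincomb ?F N y ?d') \<oplus>\<^bsub>?F\<^esub> d 0 \<odot>\<^bsub>?F\<^esub> y 0" .
    have coord: "\<theta> (lincomb ?F N y ?d') j \<oplus> d 0 \<otimes> y 0 j \<in> P" if "j < n" for j
      using Suc.prems(2) that unfolding eq inP_def by simp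
    have "d 0 \<in> P" using coord[OF p(1)] p dc[of 0] by (simp add: \<theta>_def y_def basis_vec_def)
    have "inP (\<theta> (lincomb ?F N y ?d'))" unfolding inP_def
    proof (intro allI impI)
      fix j assume j: "j < n"
      note c1 = free_coord[OF hc[OF lN] j] and c2 = free_coord[OF yF j, of 0]
      have "d 0 \<otimes> y 0 j \<in> P" by (rule ideal_rmult[OF PI c2 \<open>d 0 \<in> P\<close>])
      then show "\<theta> (lincomb ?F N y ?d') j \<in> P"
        using ideal_add_cancel[OF PI _ _ c1, of "d 0 \<otimes> y 0 j"] coord[OF j] c1 c2 dc[of 0] by (simp add: a_comm)
    qed
    then have "inP (lincomb ?F N y ?d')" by (rule inj'[OF lN])
    then have "\<forall>k<N. ?d' k \<in> P" using Suc.IH[of ?d'] dc by simp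
    with \<open>d 0 \<in> P\<close> show ?case by (metis less_Suc_eq_0_disj)
  qed
  obtain K where "\<forall>k. y k \<in> module_span R ?F (y ` {..<K})" using acc_onD[of R ?F _ y, OF acc_free yF] by (rule exE)
  then have "y K \<in> lincomb ?F K y ` carrier (free_mod R K)"
    using F.module_span_lincomb[of K y, OF yF] by blast
  then obtain c where c: "y K = lincomb ?F K y c" "c \<in> carrier (free_mod R K)" by (rule imageE)
  note cc = free_coord[OF c(2)]
  \<comment> \<open>The relation \<open>\<Sum> c k y k - y K = 0\<close> has a coefficient outside \<open>P\<close>.\<close>
  define d where "d k = (if k < K then c k else \<ominus> \<one>)" for k
  have dc: "\<forall>k<Suc K. d k \<in> carrier R" using cc by (auto simp: d_def)
  have lcK: "lincomb ?F K y d = y K" unfolding c(1) by (rule F.lincomb_cong) (use yF cc in \<open>auto simp: d_def\<close>)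
  have "lincomb ?F (Suc K) y d = d K \<odot>\<^bsub>?F\<^esub> y K \<oplus>\<^bsub>?F\<^esub> lincomb ?F K y d"
    unfolding lincomb_def lessThan_Suc using dc yF by (subst F.M.finsum_insert) auto
  also have "\<dots> = \<zero>\<^bsub>?F\<^esub>" unfolding lcK using yF[of K]
    by (simp add: d_def F.smult_l_minus F.M.l_neg)
  finally have "inP (lincomb ?F (Suc K) y d)" using ideal_zero[OF PI] by (simp add: inP_def)
  then have "d K \<in> P" using indep[OF dc] by simp
  then have "\<ominus> \<one> \<in> P" by (simp add: d_def)
  from ideal_uminus[OF PI this] have "\<one> \<in> P" by simp
  then show False using prime_one_notin[OF P] by simp
qed

section \<open>Rank\<close>

text \<open>\<open>E : R\<^sup>r \<rightarrow> M\<close> becomes an isomorphism after localization at \<open>P\<close>, expressed by denominators outside \<open>P\<close>.\<close>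

definition local_coordinates ::
  "('a, 'k) ring_scheme \<Rightarrow> ('a, 'm, 'l) module_scheme \<Rightarrow> nat \<Rightarrow> 'a set \<Rightarrow> ((nat \<Rightarrow> 'a) \<Rightarrow> 'm) \<Rightarrow> bool" where
  "local_coordinates R M r P E \<longleftrightarrow> E \<in> mod_hom R (free_mod R r) M \<and>
    (\<forall>y\<in>carrier M. \<exists>s\<in>carrier R - P. \<exists>c\<in>carrier (free_mod R r). s \<odot>\<^bsub>M\<^esub> y = E c) \<and>
    (\<forall>c\<in>carrier (free_mod R r). E c = \<zero>\<^bsub>M\<^esub> \<longrightarrow> (\<exists>s\<in>carrier R - P. \<forall>i<r. s \<otimes>\<^bsub>R\<^esub> c i = \<zero>\<^bsub>R\<^esub>))"

lemma (in cring) has_rank_local_coordinates: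
  assumes M: "module R M" and rk: "has_rank R M"
  shows "\<exists>r. \<forall>P\<in>Ass R. \<exists>E. local_coordinates R M r P E"
proof -
  interpret M: module R M by fact
  obtain r where r: "\<And>P. P \<in> Ass R \<Longrightarrow> mod_iso (loc_ring R (carrier R - P)) (loc_module R M (carrier R - P))
       (free_mod (loc_ring R (carrier R - P)) r)"
    using rk unfolding has_rank_def by blast
  have "\<exists>E. local_coordinates R M r P E" if PA: "P \<in> Ass R" for P
  proof -
    have P: "primeideal P R" using PA by (simp add: Ass_iff)
    have loc: "localization R M (carrier R - P)"
    proof (intro localization.intro[OF M] localization_axioms.intro)
      show "carrier R - P \<subseteq> carrier R" by auto
      show "\<one> \<in> carrier R - P" by (rule prime_one_notin[OF P])
      show "s \<otimes> t \<in> carrier R - P" if "s \<in> carrier R - P" "t \<in> carrier R - P" for s t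
        by (rule prime_complement_mult[OF P that])
    qed
    obtain e where e: "\<forall>i<r. e i \<in> carrier M"
      "\<forall>y\<in>carrier M. \<exists>s\<in>carrier R - P. \<exists>c\<in>carrier (free_mod R r). s \<odot>\<^bsub>M\<^esub> y = lincomb M r e c"
      "\<forall>c\<in>carrier (free_mod R r). lincomb M r e c = \<zero>\<^bsub>M\<^esub> \<longrightarrow> (\<exists>s\<in>carrier R - P. \<forall>i<r. s \<otimes> c i = \<zero>)"
      using localization.local_basis[OF loc P refl r[OF PA]] by (elim exE conjE)
    have "lincomb M r e \<in> mod_hom R (free_mod R r) M" by (rule M.lincomb_mod_hom) (use e(1) in simp)
    then have "local_coordinates R M r P (lincomb M r e)" unfolding local_coordinates_def using e(2,3) by simp
    then show ?thesis by (intro exI[of _ "lincomb M r e"])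
  qed
  then show ?thesis by (intro exI[of _ r] ballI)
qed

lemma (in module) local_coordinates_compare:
  assumes P: "primeideal P R" and E: "local_coordinates R M r P E"
    and e: "e \<in> mod_hom R (free_mod R n) M"
  shows "\<exists>A\<in>mod_hom R (free_mod R n) (free_mod R r). \<exists>s\<in>carrier R - P.
    \<forall>v\<in>carrier (free_mod R n). E (A v) = s \<odot>\<^bsub>M\<^esub> e v"
proof -
  let ?F = "free_mod R n" and ?G = "free_mod R r"
  interpret F: module R ?F by (rule module_free_mod)
  interpret G: module R ?G by (rule module_free_mod)
  have Eh: "E \<in> mod_hom R ?G M"
    and Es: "\<And>y. y \<in> carrier M \<Longrightarrow> \<exists>s\<in>carrier R - P. \<exists>c\<in>carrier ?G. s \<odot>\<^bsub>M\<^esub> y = E c"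
    using E unfolding local_coordinates_def by auto
  let ?g = "\<lambda>j. e (basis_vec R n j)"
  have gM: "?g j \<in> carrier M" for j by (rule mod_hom_closed[OF e basis_vec_carrier])
  have "\<exists>s\<in>carrier R - P. \<forall>y\<in>?g ` {..<n}. s \<odot>\<^bsub>M\<^esub> y \<in> E ` carrier ?G"
  proof (rule common_multiplier[OF P submodule_image[OF G.module_axioms module_axioms Eh G.carrier_is_submodule]])
    show "\<exists>s\<in>carrier R - P. s \<odot>\<^bsub>M\<^esub> y \<in> E ` carrier ?G" if y: "y \<in> ?g ` {..<n}" for y
    proof -
      have "y \<in> carrier M" using y gM by auto
      from Es[OF this] show ?thesis by auto
    qed
  qed (use gM in auto)
  then obtain s where s: "s \<in> carrier R - P" "\<And>j. j < n \<Longrightarrow> s \<odot>\<^bsub>M\<^esub> ?g j \<in> E ` carrier ?G" by auto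
  have sc: "s \<in> carrier R" using s(1) by simp
  have "\<exists>c. j < n \<longrightarrow> c \<in> carrier ?G \<and> s \<odot>\<^bsub>M\<^esub> ?g j = E c" for j using s(2)[of j] by (cases "j < n") auto
  then obtain c where c: "\<And>j. j < n \<Longrightarrow> c j \<in> carrier ?G" "\<And>j. j < n \<Longrightarrow> s \<odot>\<^bsub>M\<^esub> ?g j = E (c j)" by metis
  have A: "lincomb ?G n c \<in> mod_hom R ?F ?G" by (rule G.lincomb_mod_hom) (rule c(1))
  have "E (lincomb ?G n c v) = s \<odot>\<^bsub>M\<^esub> e v" if v: "v \<in> carrier ?F" for v
  proof -
    note cv = free_coord[OF v]
    have "E (lincomb ?G n c v) = lincomb M n (\<lambda>j. E (c j)) v"
      by (rule G.lincomb_hom[OF module_axioms Eh]) (use c(1) cv in auto)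
    also have "\<dots> = (\<Oplus>\<^bsub>M\<^esub>j\<in>{..<n}. s \<odot>\<^bsub>M\<^esub> (v j \<odot>\<^bsub>M\<^esub> ?g j))"
      unfolding lincomb_def
      by (rule M.finsum_cong') (use c(2)[symmetric] cv gM sc in \<open>auto simp: smult_assoc1[symmetric] m_comm\<close>)
    also have "\<dots> = s \<odot>\<^bsub>M\<^esub> lincomb M n ?g v"
      unfolding lincomb_def by (rule finsum_smult_ldistr[symmetric]) (use cv gM sc in auto)
    also have "lincomb M n ?g v = e v" by (rule hom_from_free[OF e v, symmetric])
    finally show ?thesis .
  qed
  then show ?thesis using A s(1) by blast
qed

text \<open>At each associated prime \<open>Q\<close> there are maps \<open>A : R\<^sup>n \<rightarrow> R\<^sup>r\<close> and \<open>B : R\<^sup>r \<rightarrow> R\<^sup>n\<close> over \<open>M\<close>, up to a factor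
\<open>s \<notin> Q\<close>. At \<open>P\<close>, where the relations have coefficients in \<open>P\<close>, \<open>BA\<close> is \<open>s\<close> modulo \<open>P\<close>, so \<open>A\<close> is injective modulo \<open>P\<close>
and \<open>n \<le> r\<close>. At any \<open>Q\<close>, \<open>AB\<close> is \<open>s\<close> up to multipliers outside \<open>Q\<close>, so \<open>A\<close> followed by the projection
to the first \<open>n\<close> coordinates is a locally surjective endomorphism of \<open>R\<^sup>n\<close>. It is then locally injective, and
it kills the relations locally.\<close>

lemma (in noetherian_cring) presentation_injective:
  assumes M: "module R M" and e: "e \<in> mod_hom R (free_mod R n) M" "e ` carrier (free_mod R n) = carrier M"
    and rk: "has_rank R M" and PA: "P \<in> Ass R"
    and rel: "\<And>v j. \<lbrakk>v \<in> carrier (free_mod R n); e v = \<zero>\<^bsub>M\<^esub>; j < n\<rbrakk> \<Longrightarrow> v j \<in> P"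
    and v: "v \<in> carrier (free_mod R n)" "e v = \<zero>\<^bsub>M\<^esub>"
  shows "v = \<zero>\<^bsub>free_mod R n\<^esub>"
proof -
  interpret M: module R M by fact
  obtain r where r: "\<forall>Q\<in>Ass R. \<exists>E. local_coordinates R M r Q E"
    using has_rank_local_coordinates[OF M rk] by (rule exE)
  let ?F = "free_mod R n" and ?G = "free_mod R r"
  interpret F: module R ?F by (rule module_free_mod)
  interpret G: module R ?G by (rule module_free_mod)
  have maps: "\<exists>E A B s. E \<in> mod_hom R ?G M \<and> A \<in> mod_hom R ?F ?G \<and> B \<in> mod_hom R ?G ?F \<and> s \<in> carrier R - Q \<and>
    (\<forall>v\<in>carrier ?F. E (A v) = s \<odot>\<^bsub>M\<^esub> e v) \<and> (\<forall>u\<in>carrier ?G. e (B u) = E u) \<and>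
    (\<forall>c\<in>carrier ?G. E c = \<zero>\<^bsub>M\<^esub> \<longrightarrow> (\<exists>s\<in>carrier R - Q. \<forall>i<r. s \<otimes> c i = \<zero>))" if QA: "Q \<in> Ass R" for Q
  proof -
    have Q: "primeideal Q R" using QA by (simp add: Ass_iff)
    obtain E where E: "local_coordinates R M r Q E" using r QA by blast
    have Eh: "E \<in> mod_hom R ?G M" using E by (simp add: local_coordinates_def)
    obtain A s where A: "A \<in> mod_hom R ?F ?G" "s \<in> carrier R - Q" "\<forall>v\<in>carrier ?F. E (A v) = s \<odot>\<^bsub>M\<^esub> e v"
      using M.local_coordinates_compare[OF Q E e(1)] by (elim bexE)
    obtain B where B: "B \<in> mod_hom R ?G ?F" "\<forall>u\<in>carrier ?G. e (B u) = E u"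
      using free_lift[OF F.module_axioms M e Eh] by (elim bexE)
    show ?thesis using Eh A B E unfolding local_coordinates_def by blast
  qed
  have nr: "n \<le> r"
  proof -
    have P: "primeideal P R" using PA by (simp add: Ass_iff)
    have PI: "ideal P R" by (rule primeideal.axioms(1)[OF P])
    obtain E A B s where E: "E \<in> mod_hom R ?G M" and A: "A \<in> mod_hom R ?F ?G" and B: "B \<in> mod_hom R ?G ?F"
      and s: "s \<in> carrier R - P" and EA: "\<forall>v\<in>carrier ?F. E (A v) = s \<odot>\<^bsub>M\<^esub> e v"
      and eB: "\<forall>u\<in>carrier ?G. e (B u) = E u"
      using maps[OF PA] by (elim exE conjE)
    have sc: "s \<in> carrier R" using s by simp
    show ?thesis
    proof (rule rank_le_of_injective_mod_prime[OF P A], intro allI impI)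
      fix v j assume v: "v \<in> carrier ?F" and AP: "\<forall>i<r. A v i \<in> P" and j: "j < n"
      have Av: "A v \<in> carrier ?G" by (rule mod_hom_closed[OF A v])
      have BA: "B (A v) \<in> carrier ?F" by (rule mod_hom_closed[OF B Av])
      have sv: "s \<odot>\<^bsub>?F\<^esub> v \<in> carrier ?F" using sc v by simp
      have "e (B (A v) \<ominus>\<^bsub>?F\<^esub> s \<odot>\<^bsub>?F\<^esub> v) = \<zero>\<^bsub>M\<^esub>"
        using mod_hom_minus[OF F.module_axioms M e(1) BA sv] eB Av EA v mod_hom_smult[OF e(1) sc v]
          mod_hom_closed[OF e(1) v] sc by (simp add: a_minus_def M.M.r_neg)
      then have "(B (A v) \<ominus>\<^bsub>?F\<^esub> s \<odot>\<^bsub>?F\<^esub> v) j \<in> P" using rel BA sv j by simp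
      then have 1: "B (A v) j \<ominus> s \<otimes> v j \<in> P" using free_coord_minus[OF BA sv j] j by simp
      have "B (A v) j = lincomb (self_module R) r (\<lambda>i. B (basis_vec R r i) j) (A v)"
        by (rule module.hom_from_free[OF module_self mod_hom_comp[OF B coord_mod_hom[OF j]] Av])
      moreover have "\<dots> \<in> P"
      proof (rule module.lincomb_in_submodule[OF module_self])
        show "submodule P R (self_module R)"
          by (rule module.submoduleI'[OF module_self])
            (use ideal_carrier[OF PI] ideal_zero[OF PI] ideal_add[OF PI] ideal_lmult[OF PI] in auto)
        fix i assume i: "i < r"
        have "A v i \<in> P" using AP i by simp
        moreover have "B (basis_vec R r i) j \<in> carrier R"
          by (rule free_coord[OF mod_hom_closed[OF B basis_vec_carrier] j])
        ultimately show "A v i \<odot>\<^bsub>self_module R\<^esub> B (basis_vec R r i) j \<in> P"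
          using ideal_rmult[OF PI] by simp
      qed
      ultimately have 2: "B (A v) j \<in> P" by simp
      have c1: "B (A v) j \<in> carrier R" by (rule free_coord[OF BA j])
      have c2: "v j \<in> carrier R" by (rule free_coord[OF v j])
      have "\<ominus> (s \<otimes> v j) \<in> P" using ideal_add_cancel[OF PI 2, of "\<ominus> (s \<otimes> v j)"] 1 sc c2 by (simp add: a_minus_def)
      then have "s \<otimes> v j \<in> P" using ideal_uminus[OF PI, of "\<ominus> (s \<otimes> v j)"] sc c2 by simp
      then show "v j \<in> P" using primeideal.I_prime[OF P sc c2] s by auto
    qed
  qed
  show ?thesis
  proof (rule locally_zero[OF F.module_axioms torsion_free_free v(1)])
    fix Q assume QA: "Q \<in> Ass R"
    have Q: "primeideal Q R" using QA by (simp add: Ass_iff)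
    obtain E A B s where E: "E \<in> mod_hom R ?G M" and A: "A \<in> mod_hom R ?F ?G" and B: "B \<in> mod_hom R ?G ?F"
      and s: "s \<in> carrier R - Q" and EA: "\<forall>v\<in>carrier ?F. E (A v) = s \<odot>\<^bsub>M\<^esub> e v"
      and eB: "\<forall>u\<in>carrier ?G. e (B u) = E u"
      and Einj: "\<forall>c\<in>carrier ?G. E c = \<zero>\<^bsub>M\<^esub> \<longrightarrow> (\<exists>s\<in>carrier R - Q. \<forall>i<r. s \<otimes> c i = \<zero>)"
      using maps[OF QA] by (elim exE conjE)
    have sc: "s \<in> carrier R" using s by simp
    note Ac = free_coord[OF mod_hom_closed[OF A]]
    define \<theta> where "\<theta> v = (\<lambda>i\<in>{..<n}. A v i)" for v
    have inr: "i < r" if "i < n" for i using that nr by simp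
    have h: "\<theta> \<in> mod_hom R ?F ?F"
    proof (rule mod_homI)
      fix v assume v: "v \<in> carrier ?F"
      show "\<theta> v \<in> carrier ?F" unfolding free_carrier_iff \<theta>_def using Ac[OF v] inr by auto
      show "\<theta> (v \<oplus>\<^bsub>?F\<^esub> w) = \<theta> v \<oplus>\<^bsub>?F\<^esub> \<theta> w" if w: "w \<in> carrier ?F" for w
        using mod_hom_add[OF A v w] inr by (auto simp: \<theta>_def free_mod_eq intro!: restrict_ext)
      show "\<theta> (a \<odot>\<^bsub>?F\<^esub> v) = a \<odot>\<^bsub>?F\<^esub> \<theta> v" if a: "a \<in> carrier R" for a
        using mod_hom_smult[OF A a v] inr by (auto simp: \<theta>_def free_mod_eq intro!: restrict_ext)
    qed
    note hc = mod_hom_closed[OF h]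
    have surj: "\<exists>t\<in>carrier R - Q. \<exists>w\<in>carrier ?F. \<theta> w = t \<odot>\<^bsub>?F\<^esub> y" if y: "y \<in> carrier ?F" for y
    proof -
      define u where "u = (\<lambda>i\<in>{..<r}. if i < n then y i else \<zero>)"
      have u: "u \<in> carrier ?G" unfolding free_carrier_iff u_def using free_coord[OF y] by auto
      have Bu: "B u \<in> carrier ?F" by (rule mod_hom_closed[OF B u])
      have ABu: "A (B u) \<in> carrier ?G" by (rule mod_hom_closed[OF A Bu])
      have su: "s \<odot>\<^bsub>?G\<^esub> u \<in> carrier ?G" using sc u by simp
      have "E (A (B u) \<ominus>\<^bsub>?G\<^esub> s \<odot>\<^bsub>?G\<^esub> u) = \<zero>\<^bsub>M\<^esub>"
        using mod_hom_minus[OF G.module_axioms M E ABu su] EA Bu eB u mod_hom_smult[OF E sc u]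
          mod_hom_closed[OF E u] sc by (simp add: a_minus_def M.M.r_neg)
      then obtain t where t: "t \<in> carrier R - Q" "\<forall>i<r. t \<otimes> (A (B u) \<ominus>\<^bsub>?G\<^esub> s \<odot>\<^bsub>?G\<^esub> u) i = \<zero>"
        using Einj G.M.minus_closed[OF ABu su] by blast
      have tc: "t \<in> carrier R" using t(1) by simp
      have "\<theta> (t \<odot>\<^bsub>?F\<^esub> B u) = (t \<otimes> s) \<odot>\<^bsub>?F\<^esub> y"
      proof (rule free_eqI[OF hc])
        fix i assume i: "i < n"
        have c1: "A (B u) i \<in> carrier R" by (rule Ac[OF Bu inr[OF i]])
        have c2: "y i \<in> carrier R" by (rule free_coord[OF y i])
        have "(A (B u) \<ominus>\<^bsub>?G\<^esub> s \<odot>\<^bsub>?G\<^esub> u) i = A (B u) i \<ominus> s \<otimes> y i"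
          unfolding free_coord_minus[OF ABu su inr[OF i]] using i inr[OF i] by (simp add: u_def)
        then have "t \<otimes> (A (B u) i \<ominus> s \<otimes> y i) = \<zero>" using t(2) inr[OF i] by metis
        then have "t \<otimes> A (B u) i \<ominus> t \<otimes> (s \<otimes> y i) = \<zero>" using c1 c2 tc sc by (simp add: a_minus_def r_distr r_minus)
        then have "t \<otimes> A (B u) i = t \<otimes> (s \<otimes> y i)" using c1 c2 tc sc r_right_minus_eq by simp
        moreover have "\<theta> (t \<odot>\<^bsub>?F\<^esub> B u) i = t \<otimes> A (B u) i"
          using mod_hom_smult[OF A tc Bu] i inr[OF i] by (simp add: \<theta>_def)
        ultimately show "\<theta> (t \<odot>\<^bsub>?F\<^esub> B u) i = ((t \<otimes> s) \<odot>\<^bsub>?F\<^esub> y) i" using i c2 tc sc by (simp add: m_assoc)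
      qed (use tc sc Bu y in simp_all)
      then show ?thesis using prime_complement_mult[OF Q t(1) s] tc Bu by (meson F.smult_closed)
    qed
    have "E (A v) = \<zero>\<^bsub>M\<^esub>" using EA v sc by simp
    then obtain t where t: "t \<in> carrier R - Q" "\<forall>i<r. t \<otimes> A v i = \<zero>" using Einj mod_hom_closed[OF A v(1)] by blast
    have tc: "t \<in> carrier R" using t(1) by simp
    have tv: "t \<odot>\<^bsub>?F\<^esub> v \<in> carrier ?F" using tc v(1) by simp
    have "\<theta> (t \<odot>\<^bsub>?F\<^esub> v) = \<zero>\<^bsub>?F\<^esub>"
    proof (rule free_eqI[OF hc[OF tv] F.M.zero_closed])
      fix i assume i: "i < n"
      show "\<theta> (t \<odot>\<^bsub>?F\<^esub> v) i = \<zero>\<^bsub>?F\<^esub> i"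
        using mod_hom_smult[OF A tc v(1)] t(2) i inr[OF i] by (simp add: \<theta>_def)
    qed
    then have "\<exists>q\<in>carrier R - Q. q \<odot>\<^bsub>?F\<^esub> (t \<odot>\<^bsub>?F\<^esub> v) = \<zero>\<^bsub>?F\<^esub>"
      using locally_surjective_injective[OF F.module_axioms acc_free Q h _ tv] surj by simp
    then obtain q where q: "q \<in> carrier R - Q" "q \<odot>\<^bsub>?F\<^esub> (t \<odot>\<^bsub>?F\<^esub> v) = \<zero>\<^bsub>?F\<^esub>" by (elim bexE)
    then have "(q \<otimes> t) \<odot>\<^bsub>?F\<^esub> v = \<zero>\<^bsub>?F\<^esub>" using tc v(1) by (simp add: F.smult_assoc1)
    then show "\<exists>s\<in>carrier R - Q. s \<odot>\<^bsub>?F\<^esub> v = \<zero>\<^bsub>?F\<^esub>" using prime_complement_mult[OF Q q(1) t(1)] by blast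
  qed
qed

section \<open>The endomorphism produced by rigidity\<close>

context noetherian_local
begin

lemma tau_facts:
  assumes "\<tau> \<in> mod_hom R ((self_module R)\<lparr>carrier := \<mm>\<rparr>) M"
  shows tau_closed: "b \<in> \<mm> \<Longrightarrow> \<tau> b \<in> carrier M"
    and tau_add: "\<lbrakk>b \<in> \<mm>; c \<in> \<mm>\<rbrakk> \<Longrightarrow> \<tau> (b \<oplus> c) = \<tau> b \<oplus>\<^bsub>M\<^esub> \<tau> c"
    and tau_mult: "\<lbrakk>r \<in> carrier R; b \<in> \<mm>\<rbrakk> \<Longrightarrow> \<tau> (r \<otimes> b) = r \<odot>\<^bsub>M\<^esub> \<tau> b"
    and tau_swap: "\<lbrakk>b \<in> \<mm>; c \<in> \<mm>\<rbrakk> \<Longrightarrow> b \<odot>\<^bsub>M\<^esub> \<tau> c = c \<odot>\<^bsub>M\<^esub> \<tau> b"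
proof -
  note H = mod_homD[OF assms, simplified]
  show "b \<in> \<mm> \<Longrightarrow> \<tau> b \<in> carrier M" "\<lbrakk>b \<in> \<mm>; c \<in> \<mm>\<rbrakk> \<Longrightarrow> \<tau> (b \<oplus> c) = \<tau> b \<oplus>\<^bsub>M\<^esub> \<tau> c"
    by (rule H; assumption)+
  show m: "\<lbrakk>r \<in> carrier R; b \<in> \<mm>\<rbrakk> \<Longrightarrow> \<tau> (r \<otimes> b) = r \<odot>\<^bsub>M\<^esub> \<tau> b" for r b by (rule H)
  show "\<lbrakk>b \<in> \<mm>; c \<in> \<mm>\<rbrakk> \<Longrightarrow> b \<odot>\<^bsub>M\<^esub> \<tau> c = c \<odot>\<^bsub>M\<^esub> \<tau> b"
    using m[of b c] m[of c b] mm_carrier m_comm[of b c] by simp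
qed

lemma mmM_submodule: "module R M \<Longrightarrow> submodule (ideal_smult R M \<mm> (carrier M)) R M"
  by (rule module.ideal_smult_submodule) (use mm_carrier in auto)

lemma mmM_hom:
  assumes M: "module R M" and h: "h \<in> mod_hom R M M" and y: "y \<in> ideal_smult R M \<mm> (carrier M)"
  shows "h y \<in> ideal_smult R M \<mm> (carrier M)"
proof -
  interpret M: module R M by fact
  have mc: "\<mm> \<subseteq> carrier R" using mm_carrier by auto
  have "ideal_smult R M \<mm> (h ` carrier M) \<subseteq> ideal_smult R M \<mm> (carrier M)"
    unfolding ideal_smult_def by (rule M.module_span_mono) (use mod_hom_closed[OF h] in blast)
  then show ?thesis using ideal_smult_hom[OF M M h mc y] by auto
qed

text \<open>Extend the homomorphism \<open>v \<mapsto> \<tau>(v\<^sub>0)\<close> from the relations to the whole free module, say to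
\<open>\<Phi>\<close>, and put \<open>x = \<tau>(a)\<close>. As \<open>a\<tau>(v\<^sub>0) = v\<^sub>0x\<close>, the map \<open>v \<mapsto> v\<^sub>0x - a\<Phi>(v)\<close> vanishes on relations. The induced
endomorphism of \<open>M\<close> is modulo \<open>a\<close> the projection of \<open>M/aM\<close> onto the residue field spanned by \<open>x\<close>.\<close>

lemma rigid_burch_endomorphism:
  assumes M: "module R M" and rig: "rigid R M"
    and tau: "\<tau> \<in> mod_hom R ((self_module R)\<lparr>carrier := \<mm>\<rparr>) M" and a: "a \<in> \<mm>"
    and n: "0 < n" and e: "e \<in> mod_hom R (free_mod R n) M" "e ` carrier (free_mod R n) = carrier M"
    and e0: "e (basis_vec R n 0) = \<tau> a"
    and rel: "\<And>v j. \<lbrakk>v \<in> carrier (free_mod R n); e v = \<zero>\<^bsub>M\<^esub>; j < n\<rbrakk> \<Longrightarrow> v j \<in> \<mm>"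
  shows "\<exists>h\<in>mod_hom R M M.
    (\<forall>y\<in>carrier M. \<exists>r\<in>carrier R. \<exists>z\<in>carrier M. h y = r \<odot>\<^bsub>M\<^esub> \<tau> a \<oplus>\<^bsub>M\<^esub> a \<odot>\<^bsub>M\<^esub> z) \<and>
    h (\<tau> a) \<ominus>\<^bsub>M\<^esub> \<tau> a \<in> ideal_smult R M \<mm> (carrier M)"
proof -
  interpret M: module R M by fact
  let ?F = "free_mod R n" and ?x = "\<tau> a"
  interpret F: module R ?F by (rule module_free_mod)
  have ac: "a \<in> carrier R" by (rule mm_carrier[OF a])
  have xM: "?x \<in> carrier M" by (rule tau_closed[OF tau a])
  define Om where "Om = {v \<in> carrier ?F. e v = \<zero>\<^bsub>M\<^esub>}"
  have Om0: "v 0 \<in> \<mm>" if "v \<in> Om" for v using rel[OF _ _ n] that by (simp add: Om_def)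
  have "(\<lambda>v. \<tau> (v 0)) \<in> mod_hom R (?F\<lparr>carrier := Om\<rparr>) M"
    by (rule mod_homI) (use n Om0 tau_closed[OF tau] tau_add[OF tau] tau_mult[OF tau] in auto)
  from rigid_extension[OF is_cring M rig e Om_def this]
  obtain \<Phi> where \<Phi>: "\<Phi> \<in> mod_hom R ?F M" "\<forall>v\<in>Om. \<Phi> v = \<tau> (v 0)" by (elim bexE)
  note \<Phi>c = mod_hom_closed[OF \<Phi>(1)]
  define H where "H v = v 0 \<odot>\<^bsub>M\<^esub> ?x \<ominus>\<^bsub>M\<^esub> a \<odot>\<^bsub>M\<^esub> \<Phi> v" for v
  have H: "H \<in> mod_hom R ?F M"
  proof (rule mod_homI)
    fix v assume v: "v \<in> carrier ?F"
    have v0: "v 0 \<in> carrier R" by (rule free_coord[OF v n])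
    show "H v \<in> carrier M" unfolding H_def using v0 xM ac \<Phi>c[OF v] by simp
    show "H (v \<oplus>\<^bsub>?F\<^esub> w) = H v \<oplus>\<^bsub>M\<^esub> H w" if w: "w \<in> carrier ?F" for w
      unfolding H_def using v0 free_coord[OF w n] xM ac \<Phi>c[OF v] \<Phi>c[OF w] mod_hom_add[OF \<Phi>(1) v w] n
      by (simp add: a_minus_def M.smult_l_distr M.smult_r_distr M.minus_add M.M.a_ac)
    show "H (b \<odot>\<^bsub>?F\<^esub> v) = b \<odot>\<^bsub>M\<^esub> H v" if b: "b \<in> carrier R" for b
      unfolding H_def using v0 b xM ac \<Phi>c[OF v] mod_hom_smult[OF \<Phi>(1) b v] n
      by (simp add: a_minus_def M.smult_r_distr M.smult_r_minus M.smult_assoc1[symmetric] m_comm)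
  qed
  have ker: "H v = \<zero>\<^bsub>M\<^esub>" if v: "v \<in> carrier ?F" "e v = \<zero>\<^bsub>M\<^esub>" for v
  proof -
    have vO: "v \<in> Om" using v by (simp add: Om_def)
    have "a \<odot>\<^bsub>M\<^esub> \<Phi> v = v 0 \<odot>\<^bsub>M\<^esub> ?x" using \<Phi>(2) vO tau_swap[OF tau a Om0[OF vO]] by simp
    then show ?thesis unfolding H_def using xM free_coord[OF v(1) n] by (simp add: a_minus_def M.M.r_neg)
  qed
  obtain h where h: "h \<in> mod_hom R M M" "\<And>v. v \<in> carrier ?F \<Longrightarrow> h (e v) = H v"
    by (rule mod_hom_factor[OF F.module_axioms M M e H ker]) auto
  have form: "\<exists>r\<in>carrier R. \<exists>z\<in>carrier M. h y = r \<odot>\<^bsub>M\<^esub> ?x \<oplus>\<^bsub>M\<^esub> a \<odot>\<^bsub>M\<^esub> z" if y: "y \<in> carrier M" for y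
  proof -
    obtain v where v: "v \<in> carrier ?F" "y = e v" using y e(2) by (metis imageE)
    have "h y = v 0 \<odot>\<^bsub>M\<^esub> ?x \<oplus>\<^bsub>M\<^esub> a \<odot>\<^bsub>M\<^esub> (\<ominus>\<^bsub>M\<^esub> \<Phi> v)"
      using h(2)[OF v(1)] v(2) ac \<Phi>c[OF v(1)] by (simp add: H_def a_minus_def M.smult_r_minus)
    then show ?thesis using free_coord[OF v(1) n] M.M.a_inv_closed[OF \<Phi>c[OF v(1)]] by blast
  qed
  have "h ?x \<ominus>\<^bsub>M\<^esub> ?x = \<ominus>\<^bsub>M\<^esub> (a \<odot>\<^bsub>M\<^esub> \<Phi> (basis_vec R n 0))"
  proof -
    have "h ?x = H (basis_vec R n 0)" using h(2)[OF basis_vec_carrier[of n 0]] unfolding e0 .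
    then show ?thesis using xM ac \<Phi>c[OF basis_vec_carrier] n
      by (simp add: H_def basis_vec_def a_minus_def M.M.a_ac M.M.r_neg1 M.M.r_neg2)
  qed
  moreover have "a \<odot>\<^bsub>M\<^esub> \<Phi> (basis_vec R n 0) \<in> ideal_smult R M \<mm> (carrier M)"
    by (rule M.ideal_smultI[OF a \<Phi>c[OF basis_vec_carrier]])
  ultimately have "h ?x \<ominus>\<^bsub>M\<^esub> ?x \<in> ideal_smult R M \<mm> (carrier M)"
    using M.submodule_uminus[OF mmM_submodule[OF M]] by simp
  then show ?thesis using h(1) form by blast
qed

end

section \<open>Depth and socles\<close>

lemma (in ring) Idl_empty: "Idl {} = {\<zero>}"
  using genideal_minimal[OF zeroideal, of "{}"] ideal_zero[OF genideal_ideal[of "{}"]] by auto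

lemma (in cring) regular_sequence_singleton:
  assumes "regular_elem R y" "Idl {y} \<noteq> carrier R"
  shows "regular_sequence R [y]"
  using assms unfolding regular_sequence_def regular_elem_def by (auto simp: Idl_empty)

text \<open>Depth at least two gives \<open>R/aR\<close> a zero socle for every regular element \<open>a\<close>, and not only for the first
member \<open>u\<close> of a regular sequence \<open>u, v\<close>: if \<open>uc = ad\<close> and \<open>vc = ad'\<close>, then \<open>vd = ud'\<close>, hence \<open>d \<in> uR\<close> and
\<open>c \<in> aR\<close>.\<close>

lemma (in noetherian_local) no_socle_of_regular_sequence:
  assumes seq: "regular_sequence R xs" "set xs \<subseteq> \<mm>" and len: "1 < length xs"
    and a: "regular_elem R a" and c: "c \<in> carrier R"
    and soc: "\<And>b. b \<in> \<mm> \<Longrightarrow> \<exists>d\<in>carrier R. b \<otimes> c = a \<otimes> d"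
  shows "\<exists>d\<in>carrier R. c = a \<otimes> d"
proof -
  define u v where "u = xs ! 0" and "v = xs ! 1"
  have ne: "xs \<noteq> []" using len by (cases xs) simp_all
  have um: "u \<in> \<mm>" unfolding u_def by (rule subsetD[OF seq(2) nth_mem]) (use len in linarith)
  have vm: "v \<in> \<mm>" unfolding v_def by (rule subsetD[OF seq(2) nth_mem]) (use len in linarith)
  have uc: "u \<in> carrier R" and vc: "v \<in> carrier R" using um vm mm_carrier by auto
  have ac: "a \<in> carrier R" and areg: "\<And>b. \<lbrakk>b \<in> carrier R; a \<otimes> b = \<zero>\<rbrakk> \<Longrightarrow> b = \<zero>"
    using a by (auto simp: regular_elem_def)
  have step: "\<And>i b. \<lbrakk>i < length xs; b \<in> carrier R; xs ! i \<otimes> b \<in> Idl (set (take i xs))\<rbrakk> \<Longrightarrow> b \<in> Idl (set (take i xs))"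
    using seq(1) unfolding regular_sequence_def by blast
  have ureg: "b = \<zero>" if "b \<in> carrier R" "u \<otimes> b = \<zero>" for b
    using step[of 0 b] that ne by (simp add: u_def Idl_empty)
  have tk: "set (take 1 xs) = {u}" using len by (cases xs) (auto simp: u_def)
  have vreg: "b \<in> PIdl u" if "b \<in> carrier R" "v \<otimes> b \<in> PIdl u" for b
    using step[of 1 b] that len unfolding tk cgenideal_eq_genideal[OF uc] v_def by simp
  obtain d where d: "d \<in> carrier R" "u \<otimes> c = a \<otimes> d" using soc[OF um] by (elim bexE)
  obtain d' where d': "d' \<in> carrier R" "v \<otimes> c = a \<otimes> d'" using soc[OF vm] by (elim bexE)
  have cancel: "x = y" if xy: "x \<in> carrier R" "y \<in> carrier R" "z \<in> carrier R" "z \<otimes> x = z \<otimes> y"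
    and reg: "\<And>b. \<lbrakk>b \<in> carrier R; z \<otimes> b = \<zero>\<rbrakk> \<Longrightarrow> b = \<zero>" for x y z
  proof -
    have "z \<otimes> (x \<ominus> y) = \<zero>" using xy by (simp add: a_minus_def r_distr r_minus r_neg)
    then have "x \<ominus> y = \<zero>" using reg xy by simp
    then show ?thesis using r_right_minus_eq xy by simp
  qed
  have "a \<otimes> (v \<otimes> d) = v \<otimes> (u \<otimes> c)" unfolding d(2) using ac vc d(1) by (simp add: m_lcomm)
  also have "\<dots> = u \<otimes> (v \<otimes> c)" using uc vc c by (simp add: m_lcomm)
  also have "\<dots> = a \<otimes> (u \<otimes> d')" unfolding d'(2) using ac uc d'(1) by (simp add: m_lcomm)
  finally have "v \<otimes> d = u \<otimes> d'" using cancel[OF _ _ ac _ areg] uc vc d(1) d'(1) by simp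
  also have "\<dots> = d' \<otimes> u" using uc d'(1) by (simp add: m_comm)
  finally have "v \<otimes> d \<in> PIdl u" using d'(1) by (auto simp: cgenideal_def)
  then have "d \<in> PIdl u" by (rule vreg[OF d(1)])
  then obtain w where w: "w \<in> carrier R" "d = w \<otimes> u" by (auto simp: cgenideal_def)
  have "u \<otimes> c = u \<otimes> (a \<otimes> w)" unfolding d(2) w(2) using ac uc w(1) by (simp add: m_ac)
  then have "c = a \<otimes> w" using cancel[OF c _ uc _ ureg] ac w(1) by simp
  then show ?thesis using w(1) by blast
qed

lemma (in noetherian_local) regular_elem_mm_not_Ass:
  assumes y: "y \<in> \<mm>" "regular_elem R y" and P: "P \<in> Ass R"
  shows "\<not> \<mm> \<subseteq> P"
proof
  assume "\<mm> \<subseteq> P"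
  then have "y \<in> P" using y by auto
  moreover obtain z where z: "z \<in> carrier R" "P = annihilator R z" using P by (auto simp: Ass_iff)
  ultimately have "z = \<zero>" using y(2) by (auto simp: annihilator_def regular_elem_def)
  then have "\<one> \<in> P" using z by (simp add: annihilator_def)
  then show False using P prime_one_notin by (auto simp: Ass_iff)
qed

text \<open>The elements \<open>b\<close> with \<open>\<tau>(b) \<in> \<mm>M\<close> form an ideal properly contained in \<open>\<mm>\<close>, which is avoided together
with the associated primes.\<close>

lemma (in noetherian_local) tau_at_regular_elem:
  assumes M: "module R M" and tau: "\<tau> \<in> mod_hom R ((self_module R)\<lparr>carrier := \<mm>\<rparr>) M"
    and b: "b \<in> \<mm>" "\<tau> b \<notin> ideal_smult R M \<mm> (carrier M)"
    and mP: "\<And>P. P \<in> Ass R \<Longrightarrow> \<not> \<mm> \<subseteq> P"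
  shows "\<exists>a\<in>\<mm>. \<tau> a \<notin> ideal_smult R M \<mm> (carrier M) \<and> regular_elem R a"
proof -
  interpret M: module R M by fact
  let ?J = "{b \<in> \<mm>. \<tau> b \<in> ideal_smult R M \<mm> (carrier M)}"
  note sub = mmM_submodule[OF M]
  have t0: "\<tau> \<zero> = \<zero>\<^bsub>M\<^esub>"
    using tau_mult[OF tau zero_closed b(1)] tau_closed[OF tau b(1)] mm_carrier[OF b(1)] by simp
  have "ideal ?J R"
  proof (rule cring_idealI)
    show "?J \<subseteq> carrier R" using mm_carrier by auto
    show "\<zero> \<in> ?J" using t0 M.submodule_zero[OF sub] ideal_zero[OF mm_ideal] by simp
    show "x \<oplus> y \<in> ?J" if "x \<in> ?J" "y \<in> ?J" for x y
      using that tau_add[OF tau] M.submodule_add[OF sub] ideal_add[OF mm_ideal] by simp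
    show "r \<otimes> x \<in> ?J" if "r \<in> carrier R" "x \<in> ?J" for r x
      using that tau_mult[OF tau] M.submodule_smult[OF sub] ideal_lmult[OF mm_ideal] by simp
  qed
  moreover have "\<not> \<mm> \<subseteq> ?J" using b by auto
  ultimately have "\<exists>a\<in>\<mm>. a \<notin> ?J \<and> regular_elem R a"
    by (intro ideal_has_regular_elem_outside[OF mm_ideal mP])
  then show ?thesis by auto
qed

section \<open>Depth at most one\<close>

text \<open>For \<open>f : M \<rightarrow> R\<close> and \<open>x = \<tau>(a)\<close> the inclusion \<open>\<mm>x \<subseteq> aM\<close> gives \<open>\<mm> f(x) \<subseteq> aR\<close>, so \<open>f(x) \<in> aR\<close>
by the condition on the socle of \<open>R/aR\<close>, and \<open>f \<circ> h\<close> is a multiple of \<open>a\<close>. A polynomial \<open>\<theta>\<close> in \<open>h\<close> is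
therefore killed by all functionals. So \<open>\<theta>\<close> is locally nilpotent at every associated prime, these being
minimal, and some power of \<open>\<theta>\<close> kills \<open>x\<close>; but it fixes \<open>x\<close> modulo \<open>\<mm>M\<close>.\<close>

lemma (in noetherian_local) no_regular_sequence_of_length_two:
  assumes M: "module R M" "fin_gen R M" "rigid R M" "torsion_free R M"
    and tau: "\<tau> \<in> mod_hom R ((self_module R)\<lparr>carrier := \<mm>\<rparr>) M"
    and a: "a \<in> \<mm>" "regular_elem R a" and x: "\<tau> a \<notin> ideal_smult R M \<mm> (carrier M)"
    and AM: "Ass R = MinPrimes R"
    and soc: "\<And>c. \<lbrakk>c \<in> carrier R; \<And>b. b \<in> \<mm> \<Longrightarrow> \<exists>d\<in>carrier R. b \<otimes> c = a \<otimes> d\<rbrakk> \<Longrightarrow> \<exists>d\<in>carrier R. c = a \<otimes> d"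
  shows False
proof -
  interpret M: module R M by (rule M(1))
  let ?x = "\<tau> a" and ?D = "ideal_smult R M \<mm> (carrier M)" and ?S = "self_module R"
  have ac: "a \<in> carrier R" by (rule mm_carrier[OF a(1)])
  have xM: "?x \<in> carrier M" by (rule tau_closed[OF tau a(1)])
  obtain n e where n: "0 < n" and e: "e \<in> mod_hom R (free_mod R n) M" "e ` carrier (free_mod R n) = carrier M"
    and e0: "e (basis_vec R n 0) = ?x"
    and rel: "\<forall>v\<in>carrier (free_mod R n). e v = \<zero>\<^bsub>M\<^esub> \<longrightarrow> (\<forall>j<n. v j \<in> \<mm>)"
    using minimal_presentation[OF M(1,2) xM x] by (elim exE conjE)
  obtain h where h: "h \<in> mod_hom R M M"
    and form: "\<forall>y\<in>carrier M. \<exists>r\<in>carrier R. \<exists>z\<in>carrier M. h y = r \<odot>\<^bsub>M\<^esub> ?x \<oplus>\<^bsub>M\<^esub> a \<odot>\<^bsub>M\<^esub> z"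
    and hx: "h ?x \<ominus>\<^bsub>M\<^esub> ?x \<in> ?D"
    using rigid_burch_endomorphism[OF M(1,3) tau a(1) n e e0] rel by blast
  have dual: "\<exists>g\<in>mod_hom R M ?S \<inter> extensional (carrier M). \<forall>y\<in>carrier M. f (h y) = a \<odot>\<^bsub>?S\<^esub> g y"
    if f: "f \<in> mod_hom R M ?S" for f
  proof (rule mod_hom_divide[OF M(1) module_self mod_hom_comp[OF h f] ac])
    show "y = \<zero>\<^bsub>?S\<^esub>" if "y \<in> carrier ?S" "a \<odot>\<^bsub>?S\<^esub> y = \<zero>\<^bsub>?S\<^esub>" for y
      using that a(2) by (simp add: regular_elem_def)
    have fc: "f y \<in> carrier R" if "y \<in> carrier M" for y using mod_hom_closed[OF f that] by simp
    have "\<exists>d\<in>carrier R. f ?x = a \<otimes> d"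
    proof (rule soc[OF fc[OF xM]])
      fix b assume b: "b \<in> \<mm>"
      have bM: "\<tau> b \<in> carrier M" by (rule tau_closed[OF tau b])
      have "b \<otimes> f ?x = f (b \<odot>\<^bsub>M\<^esub> ?x)" using mod_hom_smult[OF f mm_carrier[OF b] xM] by simp
      also have "\<dots> = a \<otimes> f (\<tau> b)" unfolding tau_swap[OF tau b a(1)] using mod_hom_smult[OF f ac bM] by simp
      finally show "\<exists>d\<in>carrier R. b \<otimes> f ?x = a \<otimes> d" using fc[OF bM] by blast
    qed
    then obtain d where d: "d \<in> carrier R" "f ?x = a \<otimes> d" by (elim bexE)
    fix y assume y: "y \<in> carrier M"
    obtain r z where rz: "r \<in> carrier R" "z \<in> carrier M" "h y = r \<odot>\<^bsub>M\<^esub> ?x \<oplus>\<^bsub>M\<^esub> a \<odot>\<^bsub>M\<^esub> z"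
      using form y by blast
    have "f (h y) = r \<otimes> f ?x \<oplus> a \<otimes> f z"
      unfolding rz(3) using mod_hom_add[OF f, of "r \<odot>\<^bsub>M\<^esub> ?x" "a \<odot>\<^bsub>M\<^esub> z"] mod_hom_smult[OF f rz(1) xM]
        mod_hom_smult[OF f ac rz(2)] rz(1,2) xM ac by simp
    also have "\<dots> = a \<otimes> (r \<otimes> d \<oplus> f z)" unfolding d(2) using ac rz(1) d(1) fc[OF rz(2)] by (simp add: r_distr m_lcomm)
    finally show "\<exists>z\<in>carrier ?S. f (h y) = a \<odot>\<^bsub>?S\<^esub> z" using rz(1) d(1) fc[OF rz(2)] by auto
  qed
  obtain A where A: "finite A" "A \<subseteq> carrier M" "module_span R M A = carrier M" using M(2) by (auto simp: fin_gen_def)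
  have acc: "acc_on R (Hom_mod R M ?S) (carrier (Hom_mod R M ?S))"
    by (rule acc_Hom_mod[OF M(1) module_self A]) (simp add: acc_self)
  have "\<exists>K c. (\<forall>k<K. c k \<in> carrier R) \<and>
    (\<forall>f\<in>mod_hom R M ?S. \<forall>y\<in>carrier M. f (poly_op R M h K c a y) = \<zero>\<^bsub>?S\<^esub>)"
    by (rule poly_op_kills_precompose[OF M(1) module_self acc h ac]) (rule dual, simp)
  then obtain K c where c: "\<forall>k<K. c k \<in> carrier R"
    and kill: "\<forall>f\<in>mod_hom R M ?S. \<forall>y\<in>carrier M. f (poly_op R M h K c a y) = \<zero>"
    by auto
  define \<theta> where "\<theta> = poly_op R M h K c a"
  have \<theta>: "\<theta> \<in> mod_hom R M M" unfolding \<theta>_def by (rule M.poly_op_mod_hom[OF h _ ac]) (use c in simp)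
  have \<theta>x: "\<theta> ?x \<ominus>\<^bsub>M\<^esub> ?x \<in> ?D" unfolding \<theta>_def
    by (rule M.poly_op_fixes[OF h _ ac mmM_submodule[OF M(1)] M.ideal_smultI[OF a(1)] mmM_hom[OF M(1) h] xM hx])
      (use c in simp)
  have nil: "\<exists>k. \<exists>s\<in>carrier R - P. s \<odot>\<^bsub>M\<^esub> (\<theta> ^^ k) ?x = \<zero>\<^bsub>M\<^esub>" if PA: "P \<in> Ass R" for P
  proof (rule locally_nilpotent[OF M(1) e(1) _ \<theta> _ xM])
    show "P \<in> MinPrimes R" using PA AM by simp
    fix y assume y: "y \<in> carrier M"
    show "\<exists>s\<in>carrier R - P. \<exists>v\<in>carrier (free_mod R n). (\<forall>j<n. v j \<in> P) \<and> s \<odot>\<^bsub>M\<^esub> \<theta> y = e v"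
    proof (rule ccontr)
      assume no: "\<not> ?thesis"
      have "\<exists>f\<in>mod_hom R M ?S. f (\<theta> y) \<noteq> \<zero>"
        by (rule functional_at_associated_prime[OF M(1) e PA mod_hom_closed[OF \<theta> y]]) (use no in blast)
      then show False using kill y unfolding \<theta>_def by blast
    qed
  qed
  define I where "I k = {s \<in> carrier R. s \<odot>\<^bsub>M\<^esub> (\<theta> ^^ k) ?x = \<zero>\<^bsub>M\<^esub>}" for k
  note tk = mod_hom_closed[OF mod_hom_funpow[OF \<theta>] xM]
  have Iid: "ideal (I k) R" for k unfolding I_def by (rule M.ideal_module_annihilator[OF tk])
  have "I k \<subseteq> I (Suc k)" for k
  proof
    fix s assume s: "s \<in> I k"
    then have sc: "s \<in> carrier R" by (simp add: I_def)
    have "s \<odot>\<^bsub>M\<^esub> (\<theta> ^^ Suc k) ?x = \<theta> (s \<odot>\<^bsub>M\<^esub> (\<theta> ^^ k) ?x)"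
      unfolding mod_hom_smult[OF \<theta> sc tk] by simp
    then show "s \<in> I (Suc k)" using s mod_hom_zero[OF M(1) M(1) \<theta>] by (simp add: I_def)
  qed
  then have mono: "I k \<subseteq> I l" if "k \<le> l" for k l using lift_Suc_mono_le[of I k l] that by blast
  obtain J where J: "\<exists>k. J = I k" "\<And>J'. \<exists>k. J' = I k \<Longrightarrow> J \<subseteq> J' \<Longrightarrow> J' = J"
  proof (rule ex_maximal_ideal_with[of "\<lambda>J. \<exists>k. J = I k" "I 0"])
    show "ideal J R" if "\<exists>k. J = I k" for J using that Iid by (elim exE) simp
  qed blast+
  from J(1) obtain m where Jm: "J = I m" by (elim exE)
  have all: "I k \<subseteq> I m" for k
  proof -
    have "I (max k m) = I m" using J(2)[of "I (max k m)"] mono[of m "max k m"] unfolding Jm by (simp add: exI[of _ "max k m"])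
    then show ?thesis using mono[of k "max k m"] by simp
  qed
  have "(\<theta> ^^ m) ?x = \<zero>\<^bsub>M\<^esub>"
  proof (rule locally_zero[OF M(1,4) tk])
    fix P assume "P \<in> Ass R"
    from nil[OF this] obtain k s where s: "s \<in> carrier R - P" "s \<odot>\<^bsub>M\<^esub> (\<theta> ^^ k) ?x = \<zero>\<^bsub>M\<^esub>" by (elim exE bexE)
    then have "s \<in> I k" by (simp add: I_def)
    then have "s \<in> I m" using all by blast
    then show "\<exists>s\<in>carrier R - P. s \<odot>\<^bsub>M\<^esub> (\<theta> ^^ m) ?x = \<zero>\<^bsub>M\<^esub>" using s(1) by (auto simp: I_def)
  qed
  moreover have "(\<theta> ^^ m) ?x \<ominus>\<^bsub>M\<^esub> ?x \<in> ?D"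
    by (rule M.funpow_fixes[OF \<theta> mmM_submodule[OF M(1)] mmM_hom[OF M(1) \<theta>] xM \<theta>x])
  ultimately have "\<ominus>\<^bsub>M\<^esub> ?x \<in> ?D" using xM by (simp add: a_minus_def)
  then have "\<ominus>\<^bsub>M\<^esub> (\<ominus>\<^bsub>M\<^esub> ?x) \<in> ?D" by (rule M.submodule_uminus[OF mmM_submodule[OF M(1)]])
  then show False using x xM by simp
qed

section \<open>Modules with rank\<close>

lemma submodule_of_submodule:
  assumes F: "module R F" and Om: "submodule Om R F" and H: "submodule H R (F\<lparr>carrier := Om\<rparr>)"
  shows "submodule H R F"
proof -
  interpret F: module R F by fact
  have mO: "module R (F\<lparr>carrier := Om\<rparr>)" by (rule submodule.submodule_is_module[OF Om F])
  note f = module.submodule_facts[OF mO H, simplified]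
  show ?thesis
    by (rule F.submoduleI') (use f F.submodule_carrier[OF Om] in auto)
qed

text \<open>A homomorphism from the relations to \<open>M\<close> extends to the free module, and relations have coefficients in
\<open>\<mm>\<close>. As \<open>h(M) \<subseteq> Rx + aM\<close> and \<open>\<mm>x \<subseteq> aM\<close> for \<open>x = \<tau>(a)\<close>, composition with \<open>h\<close> turns it into a multiple of
\<open>a\<close>. A polynomial \<open>\<theta>\<close> in \<open>h\<close> therefore kills its values, among them \<open>v\<^sub>j x\<close> for each relation \<open>v\<close>.
So \<open>v\<^sub>j \<theta>(x) = 0\<close>, where \<open>\<theta>(x)\<close> is non-zero because \<open>\<theta>\<close> fixes \<open>x\<close> modulo \<open>\<mm>M\<close>.\<close>

lemma (in noetherian_local) relations_in_associated_prime:
  assumes M: "module R M" "fin_gen R M" "rigid R M" "torsion_free R M"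
    and tau: "\<tau> \<in> mod_hom R ((self_module R)\<lparr>carrier := \<mm>\<rparr>) M"
    and a: "a \<in> \<mm>" "regular_elem R a" and x: "\<tau> a \<notin> ideal_smult R M \<mm> (carrier M)"
    and n: "0 < n" and e: "e \<in> mod_hom R (free_mod R n) M" "e ` carrier (free_mod R n) = carrier M"
    and e0: "e (basis_vec R n 0) = \<tau> a"
    and rel: "\<And>v j. \<lbrakk>v \<in> carrier (free_mod R n); e v = \<zero>\<^bsub>M\<^esub>; j < n\<rbrakk> \<Longrightarrow> v j \<in> \<mm>"
  shows "\<exists>P\<in>Ass R. \<forall>v\<in>carrier (free_mod R n). e v = \<zero>\<^bsub>M\<^esub> \<longrightarrow> (\<forall>j<n. v j \<in> P)"
proof (rule ccontr)
  assume no: "\<not> ?thesis"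
  interpret M: module R M by (rule M(1))
  let ?x = "\<tau> a" and ?D = "ideal_smult R M \<mm> (carrier M)" and ?F = "free_mod R n"
  interpret F: module R ?F by (rule module_free_mod)
  have ac: "a \<in> carrier R" by (rule mm_carrier[OF a(1)])
  have xM: "?x \<in> carrier M" by (rule tau_closed[OF tau a(1)])
  have "\<exists>h\<in>mod_hom R M M.
    (\<forall>y\<in>carrier M. \<exists>r\<in>carrier R. \<exists>z\<in>carrier M. h y = r \<odot>\<^bsub>M\<^esub> \<tau> a \<oplus>\<^bsub>M\<^esub> a \<odot>\<^bsub>M\<^esub> z) \<and>
    h (\<tau> a) \<ominus>\<^bsub>M\<^esub> \<tau> a \<in> ideal_smult R M \<mm> (carrier M)"
    by (rule rigid_burch_endomorphism[OF M(1,3) tau a(1) n e e0]) (rule rel)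
  then obtain h where h: "h \<in> mod_hom R M M"
    and form: "\<forall>y\<in>carrier M. \<exists>r\<in>carrier R. \<exists>z\<in>carrier M. h y = r \<odot>\<^bsub>M\<^esub> ?x \<oplus>\<^bsub>M\<^esub> a \<odot>\<^bsub>M\<^esub> z"
    and hx: "h ?x \<ominus>\<^bsub>M\<^esub> ?x \<in> ?D"
    by (elim bexE conjE)
  define Om where "Om = {v \<in> carrier ?F. e v = \<zero>\<^bsub>M\<^esub>}"
  have OmF: "v \<in> carrier ?F" if "v \<in> Om" for v using that by (simp add: Om_def)
  let ?O = "?F\<lparr>carrier := Om\<rparr>"
  have Osub: "submodule Om R ?F" unfolding Om_def by (rule submodule_kernel[OF F.module_axioms M(1) e(1)])
  have O: "module R ?O" by (rule submodule.submodule_is_module[OF Osub F.module_axioms])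
  interpret O: module R ?O by (rule O)
  define aM where "aM = (\<lambda>z. a \<odot>\<^bsub>M\<^esub> z) ` carrier M"
  have "(\<lambda>z. a \<odot>\<^bsub>M\<^esub> z) \<in> mod_hom R M M"
    by (rule mod_homI) (use ac in \<open>auto simp: M.smult_r_distr M.smult_assoc1[symmetric] m_comm\<close>)
  then have aMsub: "submodule aM R M" unfolding aM_def
    by (rule submodule_image[OF M(1) M(1) _ M.carrier_is_submodule])
  have hm: "b \<odot>\<^bsub>M\<^esub> h y \<in> aM" if b: "b \<in> \<mm>" and y: "y \<in> carrier M" for b y
  proof -
    have bc: "b \<in> carrier R" by (rule mm_carrier[OF b])
    obtain r z where rz: "r \<in> carrier R" "z \<in> carrier M" "h y = r \<odot>\<^bsub>M\<^esub> ?x \<oplus>\<^bsub>M\<^esub> a \<odot>\<^bsub>M\<^esub> z"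
      using form y by blast
    have tb: "\<tau> b \<in> carrier M" by (rule tau_closed[OF tau b])
    have "b \<odot>\<^bsub>M\<^esub> h y = r \<odot>\<^bsub>M\<^esub> (b \<odot>\<^bsub>M\<^esub> ?x) \<oplus>\<^bsub>M\<^esub> b \<odot>\<^bsub>M\<^esub> (a \<odot>\<^bsub>M\<^esub> z)"
      unfolding rz(3) using bc rz(1,2) xM ac by (simp add: M.smult_r_distr M.smult_assoc1[symmetric] m_comm)
    also have "\<dots> = a \<odot>\<^bsub>M\<^esub> (r \<odot>\<^bsub>M\<^esub> \<tau> b \<oplus>\<^bsub>M\<^esub> b \<odot>\<^bsub>M\<^esub> z)"
      unfolding tau_swap[OF tau b a(1)] using bc rz(1,2) tb ac
      by (simp add: M.smult_r_distr M.smult_assoc1[symmetric] m_comm)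
    finally show ?thesis unfolding aM_def using bc rz(1,2) tb by simp
  qed
  have div: "\<exists>g\<in>mod_hom R ?O M \<inter> extensional (carrier ?O). \<forall>v\<in>carrier ?O. h (f v) = a \<odot>\<^bsub>M\<^esub> g v"
    if f: "f \<in> mod_hom R ?O M" for f
  proof (rule mod_hom_divide[OF O M(1) mod_hom_comp[OF f h] ac])
    show "y = \<zero>\<^bsub>M\<^esub>" if "y \<in> carrier M" "a \<odot>\<^bsub>M\<^esub> y = \<zero>\<^bsub>M\<^esub>" for y
      by (rule torsion_freeD[OF M(4) a(2) that])
    obtain \<Phi> where \<Phi>: "\<Phi> \<in> mod_hom R ?F M" "\<forall>v\<in>Om. \<Phi> v = f v"
      using rigid_extension[OF is_cring M(1,3) e Om_def f] by (elim bexE)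
    fix v assume "v \<in> carrier ?O"
    then have v: "v \<in> Om" by simp
    note cv = free_coord[OF OmF[OF v]]
    have \<Phi>M: "\<Phi> (basis_vec R n j) \<in> carrier M" for j by (rule mod_hom_closed[OF \<Phi>(1) basis_vec_carrier])
    have "h (f v) = h (lincomb M n (\<lambda>j. \<Phi> (basis_vec R n j)) v)"
      using \<Phi>(2) v M.hom_from_free[OF \<Phi>(1) OmF[OF v]] by simp
    also have "\<dots> = lincomb M n (\<lambda>j. h (\<Phi> (basis_vec R n j))) v"
      by (rule M.lincomb_hom[OF M(1) h]) (use \<Phi>M cv in auto)
    also have "\<dots> \<in> aM"
    proof (rule M.lincomb_in_submodule[OF aMsub])
      fix j assume "j < n"
      then have "v j \<in> \<mm>" using v rel[of v j] by (simp add: Om_def)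
      then show "v j \<odot>\<^bsub>M\<^esub> h (\<Phi> (basis_vec R n j)) \<in> aM" by (rule hm[OF _ \<Phi>M])
    qed
    finally show "\<exists>y\<in>carrier M. h (f v) = a \<odot>\<^bsub>M\<^esub> y" unfolding aM_def by auto
  qed
  obtain Y where Y: "finite Y" "Y \<subseteq> Om" "Om \<subseteq> module_span R ?F Y"
    using acc_finite_span[OF acc_free, of Om n] OmF by (meson subsetI)
  have "module_span R ?O Y = carrier ?O"
  proof
    show "module_span R ?O Y \<subseteq> carrier ?O"
      by (rule O.module_span_minimal[OF O.carrier_is_submodule]) (use Y(2) in simp)
    have "submodule (module_span R ?O Y) R ?F"
      by (rule submodule_of_submodule[OF F.module_axioms Osub O.module_span_submodule]) (use Y(2) in simp)
    from F.module_span_minimal[OF this O.module_span_superset] Y(3)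
    show "carrier ?O \<subseteq> module_span R ?O Y" by auto
  qed
  then have acc: "acc_on R (Hom_mod R ?O M) (carrier (Hom_mod R ?O M))"
    using acc_Hom_mod[OF O M(1) Y(1)] Y(2) acc_fin_gen[OF noetherian_cring_axioms M(1,2)] by simp
  have "\<exists>K c. (\<forall>k<K. c k \<in> carrier R) \<and>
    (\<forall>f\<in>mod_hom R ?O M. \<forall>v\<in>carrier ?O. poly_op R M h K c a (f v) = \<zero>\<^bsub>M\<^esub>)"
    by (rule poly_op_kills_postcompose[OF O M(1) acc h ac]) (rule div, simp)
  then obtain K c where c: "\<forall>k<K. c k \<in> carrier R"
    and kill: "\<forall>f\<in>mod_hom R ?O M. \<forall>v\<in>carrier ?O. poly_op R M h K c a (f v) = \<zero>\<^bsub>M\<^esub>"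
    by (elim exE conjE)
  define \<theta> where "\<theta> = poly_op R M h K c a"
  have \<theta>: "\<theta> \<in> mod_hom R M M" unfolding \<theta>_def by (rule M.poly_op_mod_hom[OF h _ ac]) (use c in simp)
  have \<theta>x: "\<theta> ?x \<ominus>\<^bsub>M\<^esub> ?x \<in> ?D" unfolding \<theta>_def
    by (rule M.poly_op_fixes[OF h _ ac mmM_submodule[OF M(1)] M.ideal_smultI[OF a(1)] mmM_hom[OF M(1) h] xM hx])
      (use c in simp)
  have "\<theta> ?x = \<zero>\<^bsub>M\<^esub>"
  proof (rule locally_zero[OF M(1,4) mod_hom_closed[OF \<theta> xM]])
    fix P assume "P \<in> Ass R"
    then obtain v j where v: "v \<in> carrier ?F" "e v = \<zero>\<^bsub>M\<^esub>" "j < n" "v j \<notin> P" using no by blast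
    have vj: "v j \<in> carrier R" by (rule free_coord[OF v(1,3)])
    have "(\<lambda>v. v j \<odot>\<^bsub>M\<^esub> ?x) \<in> mod_hom R ?O M"
    proof (rule mod_homI)
      show "w j \<odot>\<^bsub>M\<^esub> ?x \<in> carrier M" if "w \<in> carrier ?O" for w
        using free_coord[OF OmF v(3)] that xM by simp
      show "(w \<oplus>\<^bsub>?O\<^esub> w') j \<odot>\<^bsub>M\<^esub> ?x = w j \<odot>\<^bsub>M\<^esub> ?x \<oplus>\<^bsub>M\<^esub> w' j \<odot>\<^bsub>M\<^esub> ?x"
        if "w \<in> carrier ?O" "w' \<in> carrier ?O" for w w'
        using free_coord[OF OmF v(3)] that xM v(3) by (simp add: M.smult_l_distr)
      show "(b \<odot>\<^bsub>?O\<^esub> w) j \<odot>\<^bsub>M\<^esub> ?x = b \<odot>\<^bsub>M\<^esub> (w j \<odot>\<^bsub>M\<^esub> ?x)" if "b \<in> carrier R" "w \<in> carrier ?O" for b w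
        using free_coord[OF OmF v(3)] that xM v(3) by (simp add: M.smult_assoc1)
    qed
    from bspec[OF bspec[OF kill this], of v] have "\<theta> (v j \<odot>\<^bsub>M\<^esub> ?x) = \<zero>\<^bsub>M\<^esub>"
      unfolding \<theta>_def using v(1,2) by (simp add: Om_def)
    then have "v j \<odot>\<^bsub>M\<^esub> \<theta> ?x = \<zero>\<^bsub>M\<^esub>" using mod_hom_smult[OF \<theta> vj xM] by simp
    then show "\<exists>s\<in>carrier R - P. s \<odot>\<^bsub>M\<^esub> \<theta> ?x = \<zero>\<^bsub>M\<^esub>" using vj v(4) by blast
  qed
  then have "\<ominus>\<^bsub>M\<^esub> ?x \<in> ?D" using \<theta>x xM by (simp add: a_minus_def)
  then have "\<ominus>\<^bsub>M\<^esub> (\<ominus>\<^bsub>M\<^esub> ?x) \<in> ?D" by (rule M.submodule_uminus[OF mmM_submodule[OF M(1)]])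
  then show False using x xM by simp
qed

lemma is_free_if_presentation_injective:
  assumes M: "module R M" and F: "module R (free_mod R n)"
    and e: "e \<in> mod_hom R (free_mod R n) M" "e ` carrier (free_mod R n) = carrier M"
    and inj: "\<And>v. \<lbrakk>v \<in> carrier (free_mod R n); e v = \<zero>\<^bsub>M\<^esub>\<rbrakk> \<Longrightarrow> v = \<zero>\<^bsub>free_mod R n\<^esub>"
  shows "is_free R M"
proof -
  have ker: "v = \<zero>\<^bsub>free_mod R n\<^esub>" if "v \<in> carrier (free_mod R n)" "e v = \<zero>\<^bsub>M\<^esub>" for v by (rule inj[OF that])
  obtain g where g: "g \<in> mod_hom R M (free_mod R n)" "\<And>v. v \<in> carrier (free_mod R n) \<Longrightarrow> g (e v) = v"
    by (rule mod_hom_factor[OF F M F e mod_hom_id ker]) auto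
  have "bij_betw g (carrier M) (carrier (free_mod R n))"
  proof (rule bij_betw_byWitness[where f' = e])
    show "\<forall>y\<in>carrier M. e (g y) = y"
    proof
      fix y assume "y \<in> carrier M"
      then obtain v where "v \<in> carrier (free_mod R n)" "y = e v" using e(2) by (metis imageE)
      then show "e (g y) = y" using g(2) by simp
    qed
    show "\<forall>v\<in>carrier (free_mod R n). g (e v) = v" using g(2) by simp
    show "g ` carrier M \<subseteq> carrier (free_mod R n)" using mod_hom_closed[OF g(1)] by auto
    show "e ` carrier (free_mod R n) \<subseteq> carrier M" using e(2) by simp
  qed
  then show ?thesis unfolding is_free_def mod_iso_def using g(1) by blast
qed

text \<open>If \<open>\<mm>\<close> is the annihilator of \<open>c\<close>, then \<open>c \<tau>(a) = \<tau>(ca) = 0\<close>. Rank at \<open>\<mm>\<close> makes \<open>M\<close> free, and the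
coordinates of \<open>\<tau>(a)\<close>, being killed by \<open>c\<close>, lie in \<open>\<mm>\<close>.\<close>

lemma (in noetherian_local) mm_not_Ass_if_rank:
  assumes M: "module R M" and rk: "has_rank R M"
    and tau: "\<tau> \<in> mod_hom R ((self_module R)\<lparr>carrier := \<mm>\<rparr>) M"
    and a: "a \<in> \<mm>" "\<tau> a \<notin> ideal_smult R M \<mm> (carrier M)"
  shows "\<mm> \<notin> Ass R"
proof
  assume mA: "\<mm> \<in> Ass R"
  interpret M: module R M by fact
  let ?D = "ideal_smult R M \<mm> (carrier M)"
  note Dsub = mmM_submodule[OF M]
  obtain c where c: "c \<in> carrier R" "\<mm> = annihilator R c" using mA unfolding Ass_iff by (elim conjE bexE)
  obtain r E where "local_coordinates R M r \<mm> E" using has_rank_local_coordinates[OF M rk] mA by blast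
  then have Eh: "E \<in> mod_hom R (free_mod R r) M"
    and Es: "\<forall>y\<in>carrier M. \<exists>s\<in>carrier R - \<mm>. \<exists>d\<in>carrier (free_mod R r). s \<odot>\<^bsub>M\<^esub> y = E d"
    and Ei: "\<forall>d\<in>carrier (free_mod R r). E d = \<zero>\<^bsub>M\<^esub> \<longrightarrow> (\<exists>s\<in>carrier R - \<mm>. \<forall>i<r. s \<otimes> d i = \<zero>)"
    unfolding local_coordinates_def by blast+
  interpret G: module R "free_mod R r" by (rule module_free_mod)
  have xM: "\<tau> a \<in> carrier M" by (rule tau_closed[OF tau a(1)])
  obtain s d where s: "s \<in> carrier R - \<mm>" and d: "d \<in> carrier (free_mod R r)" "s \<odot>\<^bsub>M\<^esub> \<tau> a = E d"
    using Es xM by blast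
  have sc: "s \<in> carrier R" using s by simp
  have "c \<odot>\<^bsub>M\<^esub> \<tau> a = \<zero>\<^bsub>M\<^esub>"
  proof -
    have zm: "\<zero> \<in> \<mm>" by (rule ideal_zero[OF mm_ideal])
    have "a \<in> annihilator R c" using a(1) c(2) by simp
    then have "c \<otimes> a = \<zero>" using c(1) by (simp add: annihilator_def m_comm)
    then have "c \<odot>\<^bsub>M\<^esub> \<tau> a = \<tau> (\<zero> \<otimes> \<zero>)" using tau_mult[OF tau c(1) a(1)] by simp
    also have "\<dots> = \<zero>\<^bsub>M\<^esub>" using tau_mult[OF tau zero_closed zm] tau_closed[OF tau zm] by simp
    finally show ?thesis .
  qed
  then have "E (c \<odot>\<^bsub>free_mod R r\<^esub> d) = \<zero>\<^bsub>M\<^esub>"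
    using mod_hom_smult[OF Eh c(1) d(1)] d(2)[symmetric] xM sc c(1)
    by (simp add: M.smult_assoc1[symmetric] m_comm[of c s]) (simp add: M.smult_assoc1)
  then obtain t where t: "t \<in> carrier R - \<mm>" "\<forall>i<r. t \<otimes> (c \<odot>\<^bsub>free_mod R r\<^esub> d) i = \<zero>"
    using Ei G.smult_closed[OF c(1) d(1)] by blast
  have dm: "d i \<in> \<mm>" if i: "i < r" for i
  proof -
    have di: "d i \<in> carrier R" by (rule free_coord[OF d(1) i])
    have tc: "t \<in> carrier R" using t(1) by simp
    have "(t \<otimes> d i) \<otimes> c = t \<otimes> (c \<otimes> d i)" using di c(1) tc by (simp add: m_ac)
    also have "\<dots> = \<zero>" using t(2) i by simp
    finally have "(t \<otimes> d i) \<otimes> c = \<zero>" .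
    then have "t \<otimes> d i \<in> \<mm>" unfolding c(2) annihilator_def using tc di by simp
    then show ?thesis using primeideal.I_prime[OF mm_prime tc di] t(1) by simp
  qed
  have "s \<odot>\<^bsub>M\<^esub> \<tau> a \<in> ?D"
    unfolding d(2) M.hom_from_free[OF Eh d(1)]
  proof (rule M.lincomb_in_submodule[OF Dsub])
    fix i assume "i < r"
    then show "d i \<odot>\<^bsub>M\<^esub> E (basis_vec R r i) \<in> ?D"
      using dm M.ideal_smultI mod_hom_closed[OF Eh basis_vec_carrier] by blast
  qed
  moreover obtain w where w: "w \<in> carrier R" "w \<otimes> s = \<one>" using unit_if_notin_mm[of s] s by auto
  ultimately have "w \<odot>\<^bsub>M\<^esub> (s \<odot>\<^bsub>M\<^esub> \<tau> a) \<in> ?D" using M.submodule_smult[OF Dsub] by simp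
  then show False using w sc xM a(2) by (simp add: M.smult_assoc1[symmetric])
qed

theorem theorem2p12:
  fixes R :: "('a, 'k) ring_scheme" and M :: "('a, 'm, 'l) module_scheme"
  assumes "cring R" and "noetherian_ring R" and "local_ring R"
    and "module R M" and "fin_gen R M"
    and "burch TYPE('t) R M" and "rigid R M" and "torsion_free R M"
  shows "(Ass R = MinPrimes R \<longrightarrow>
            ring_depth R \<le> 1 \<and> (artinian_ring R \<or> ring_depth R = 1)) \<and>
         (has_rank R M \<longrightarrow> is_free R M \<and> (field R \<or> dvr R))"
proof -
  interpret noetherian_local R
    using assms(1-3)
    by (intro noetherian_local.intro noetherian_cring.intro noetherian_local_axioms.intro)
      (auto simp: local_ring_def)
  note M = assms(4,5,7,8)
  interpret M: module R M by (rule M(1))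
  obtain \<tau> b where tau: "\<tau> \<in> mod_hom R ((self_module R)\<lparr>carrier := \<mm>\<rparr>) M"
    and b: "b \<in> \<mm>" "\<tau> b \<notin> ideal_smult R M \<mm> (carrier M)"
    using burch_hom[OF assms(4,6)] by (elim bexE)
  have depth1: "ring_depth R \<le> 1 \<and> (artinian_ring R \<or> ring_depth R = 1)" if AM: "Ass R = MinPrimes R"
  proof -
    have short: "length xs \<le> 1" if seq: "regular_sequence R xs" "set xs \<subseteq> \<mm>" for xs
    proof (rule ccontr)
      assume "\<not> length xs \<le> 1"
      then have len: "1 < length xs" by simp
      have y: "xs ! 0 \<in> \<mm>" by (rule subsetD[OF seq(2) nth_mem]) (use len in linarith)
      have "regular_elem R (xs ! 0)"
      proof -
        have "\<forall>a\<in>carrier R. xs ! 0 \<otimes>\<^bsub>R\<^esub> a \<in> Idl\<^bsub>R\<^esub> (set (take 0 xs)) \<longrightarrow> a \<in> Idl\<^bsub>R\<^esub> (set (take 0 xs))"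
          using seq(1) len unfolding regular_sequence_def by (metis less_trans zero_less_one)
        then show ?thesis using mm_carrier[OF y] by (simp add: regular_elem_def Idl_empty)
      qed
      from regular_elem_mm_not_Ass[OF y this]
      obtain a where a: "a \<in> \<mm>" "\<tau> a \<notin> ideal_smult R M \<mm> (carrier M)" "regular_elem R a"
        using tau_at_regular_elem[OF M(1) tau b] by blast
      show False
        by (rule no_regular_sequence_of_length_two[OF M tau a(1,3,2) AM])
          (rule no_socle_of_regular_sequence[OF seq len a(3)])
    qed
    have le: "ring_depth R \<le> 1"
      unfolding ring_depth_def by (rule Sup_least) (use short in \<open>auto simp: one_enat_def\<close>)
    moreover have "artinian_ring R \<or> ring_depth R = 1"
    proof (cases "\<mm> \<in> Ass R")
      case True
      then show ?thesis using artinian_if_mm_minimal AM by simp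
    next
      case False
      then obtain y where y: "y \<in> \<mm>" "regular_elem R y"
        using mm_Ass_or_regular ideal_has_regular_elem[OF mm_ideal] by blast
      have "Idl\<^bsub>R\<^esub> {y} \<subseteq> \<mm>" by (rule genideal_minimal[OF mm_ideal]) (use y in simp)
      then have "Idl\<^bsub>R\<^esub> {y} \<noteq> carrier R" using one_notin_mm by blast
      then have "regular_sequence R [y]" by (rule regular_sequence_singleton[OF y(2)])
      then have "enat (length [y]) \<in> {enat (length xs) | xs. regular_sequence R xs \<and> set xs \<subseteq> \<mm>}"
        using y(1) by (intro CollectI exI[of _ "[y]"]) simp
      then have "enat (length [y]) \<le> ring_depth R" unfolding ring_depth_def by (rule Sup_upper)
      then have "1 \<le> ring_depth R" by (simp add: one_enat_def)
      then show ?thesis using le by simp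
    qed
    ultimately show ?thesis by simp
  qed
  have free: "is_free R M \<and> (field R \<or> dvr R)" if rk: "has_rank R M"
  proof -
    have "\<mm> \<notin> Ass R" by (rule mm_not_Ass_if_rank[OF M(1) rk tau b])
    then have "\<And>P. P \<in> Ass R \<Longrightarrow> \<not> \<mm> \<subseteq> P" using mm_Ass_or_regular by blast
    from tau_at_regular_elem[OF M(1) tau b this]
    obtain a where a: "a \<in> \<mm>" "\<tau> a \<notin> ideal_smult R M \<mm> (carrier M)" "regular_elem R a" by blast
    have ac: "a \<in> carrier R" by (rule mm_carrier[OF a(1)])
    obtain n e where n: "0 < n" and e: "e \<in> mod_hom R (free_mod R n) M" "e ` carrier (free_mod R n) = carrier M"
      and e0: "e (basis_vec R n 0) = \<tau> a"
      and rel: "\<forall>v\<in>carrier (free_mod R n). e v = \<zero>\<^bsub>M\<^esub> \<longrightarrow> (\<forall>j<n. v j \<in> \<mm>)"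
      using minimal_presentation[OF M(1,2) tau_closed[OF tau a(1)] a(2)] by (elim exE conjE)
    have "\<exists>P\<in>Ass R. \<forall>v\<in>carrier (free_mod R n). e v = \<zero>\<^bsub>M\<^esub> \<longrightarrow> (\<forall>j<n. v j \<in> P)"
      by (rule relations_in_associated_prime[OF M tau a(1,3,2) n e e0]) (use rel in simp)
    then obtain P where P: "P \<in> Ass R" "\<forall>v\<in>carrier (free_mod R n). e v = \<zero>\<^bsub>M\<^esub> \<longrightarrow> (\<forall>j<n. v j \<in> P)"
      by (elim bexE)
    let ?F = "free_mod R n"
    interpret F: module R ?F by (rule module_free_mod)
    have inj: "v = \<zero>\<^bsub>?F\<^esub>" if v: "v \<in> carrier ?F" "e v = \<zero>\<^bsub>M\<^esub>" for v
      by (rule presentation_injective[OF M(1) e rk P(1) _ v]) (use P(2) in simp)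
    have fr: "is_free R M" by (rule is_free_if_presentation_injective[OF M(1) F.module_axioms e inj])
    have "\<mm> \<subseteq> PIdl\<^bsub>R\<^esub> a"
    proof
      fix c assume c: "c \<in> \<mm>"
      have cc: "c \<in> carrier R" by (rule mm_carrier[OF c])
      obtain v where v: "v \<in> carrier ?F" "\<tau> c = e v" using tau_closed[OF tau c] e(2) by (metis imageE)
      have bc: "c \<odot>\<^bsub>?F\<^esub> basis_vec R n 0 \<in> carrier ?F" "a \<odot>\<^bsub>?F\<^esub> v \<in> carrier ?F" using cc ac v(1) by simp_all
      have "e (c \<odot>\<^bsub>?F\<^esub> basis_vec R n 0) = e (a \<odot>\<^bsub>?F\<^esub> v)"
        using mod_hom_smult[OF e(1) cc basis_vec_carrier[of n 0]] mod_hom_smult[OF e(1) ac v(1)]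
          tau_swap[OF tau c a(1)] unfolding e0 v(2) by simp
      then have "e (c \<odot>\<^bsub>?F\<^esub> basis_vec R n 0 \<ominus>\<^bsub>?F\<^esub> a \<odot>\<^bsub>?F\<^esub> v) = \<zero>\<^bsub>M\<^esub>"
        using mod_hom_minus[OF F.module_axioms M(1) e(1) bc] mod_hom_closed[OF e(1) bc(2)]
        by (simp add: a_minus_def M.M.r_neg)
      then have "c \<odot>\<^bsub>?F\<^esub> basis_vec R n 0 \<ominus>\<^bsub>?F\<^esub> a \<odot>\<^bsub>?F\<^esub> v = \<zero>\<^bsub>?F\<^esub>" using inj bc by simp
      then have "c \<odot>\<^bsub>?F\<^esub> basis_vec R n 0 = a \<odot>\<^bsub>?F\<^esub> v" using F.minus_eq_zero_iff[OF bc] by simp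
      from fun_cong[OF this, of 0] have "c = a \<otimes>\<^bsub>R\<^esub> v 0" using n cc by (simp add: basis_vec_def)
      also have "\<dots> = v 0 \<otimes>\<^bsub>R\<^esub> a" using ac free_coord[OF v(1) n] by (simp add: m_comm)
      finally show "c \<in> PIdl\<^bsub>R\<^esub> a" using free_coord[OF v(1) n] by (auto simp: cgenideal_def)
    qed
    then have "\<mm> = PIdl\<^bsub>R\<^esub> a" using cgenideal_minimal[OF mm_ideal a(1)] by auto
    from principal_domain_if_mm_principal[OF a(3) this]
    have "field R \<or> dvr R" using assms(3) by (simp add: dvr_def)
    then show ?thesis using fr by simp
  qed
  show ?thesis using depth1 free by blast
qed

end
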